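(* Assume $H:\mathbb R^d\to\mathbb R$ satisfies the assumptions on the Hamiltonian listed in the context (with exponent $q>1$), let $B$ be a standard $m$-dimensional Brownian motion on $(\Omega,\mathbf F,\mathbf P)$, and let $R>0$, $0<\tau<T$, $\sigma_0>0$, $K>0$, and $0<\theta<\frac{q}{2+q}$. Then there exist $M=M(R,T,\tau,\sigma_0,K,\theta,q)>0$ and, for any $p\ge1$, $C=C(T,\sigma_0,K,\theta,p,q)>0$ such that, if $\sigma\in(0,\sigma_0)$ and $\Lambda>0$ satisfy $\sigma\Lambda=K$, then $$\mathbf P\left(\sup_{f\in F_{\sigma,\Lambda}}[L_f]_{C^\theta_{x,y}C^{\theta/q}_{s,t}(U_{\tau,R,T})}>M+\lambda\right)\le\frac{CM^p\sigma^p}{\lambda^p}\quad\text{for all }\lambda\ge1.$$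
   Context: $C^1_b$ is the space of functions that are bounded and continuous together with their first derivatives. The integers $d,m$ and the Hamiltonian $H$ are fixed, and all constants may depend on them. Assumptions on the Hamiltonian. $H:\mathbb R^d\to\mathbb R$ is convex and, for some $C>1$ and $q>1$, $\frac1C|p|^q-C\le H(p)\le C(|p|^q+1)$ for all $p\in\mathbb R^d$. With $H^*(v)=\sup_{p}(p\cdot v-H(p))$ and $q'=q/(q-1)$, it is also assumed that, for some $C>0$, $|H^*(p_1)-H^*(p_2)|\le C(1+|p_1|^{q'-1}+|p_2|^{q'-1})|p_1-p_2|$ for all $p_1,p_2\in\mathbb R^d$. Notation. $F_{\sigma,\Lambda}=\{f\in C^1_b(\mathbb R^d,\mathbb R^m):\|f\|_\infty\le\sigma,\ \|Df\|_\infty\le\Lambda\}$. For $f\in C^1_b(\mathbb R^d,\mathbb R^m)$, $x,y\in\mathbb R^d$ and $0\le s<t$, $$L_f(x,y,s,t,\omega)=\inf\left\{\int_s^tH^*(\dot\gamma_r)\,dr+\int_s^tf(\gamma_r)\cdot dB_r(\omega):\gamma\in W^{1,\infty}([s,t],\mathbb R^d),\ \gamma_s=x,\ \gamma_t=y\right\},$$ where, for each $\omega$, the second integral is defined by integration by parts: $\int_s^tf(\gamma_r)\cdot dB_r=f(y)\cdot B_t-f(x)\cdot B_s-\int_s^t(Df(\gamma_r)\dot\gamma_r)\cdot B_r\,dr$. Also $$U_{\tau,R,T}=\{(x,y,s,t)\in\mathbb R^d\times\mathbb R^d\times[0,T]\times[0,T]:|x-y|\le R,\ \tau<t-s<T\},$$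 and $[g]_{C^\alpha_{x,y}C^\beta_{s,t}(U)}$ denotes the supremum of $\frac{|g(x,y,s,t)-g(\tilde x,\tilde y,\tilde s,\tilde t)|}{|(x,y)-(\tilde x,\tilde y)|^\alpha+|(s,t)-(\tilde s,\tilde t)|^\beta}$ over pairs of distinct points $(x,y,s,t),(\tilde x,\tilde y,\tilde s,\tilde t)\in U$. *)

theory Defs
  imports "HOL-Probability.Probability"
begin

definition legendre :: "(real^'d \<Rightarrow> real) \<Rightarrow> real^'d \<Rightarrow> real" where
  "legendre H v = (SUP p. p \<bullet> v - H p)"

text \<open>
  Paths are continuous for every \<omega> (not just almost surely), since the stochastic integrals
  below are defined pathwise, for each \<omega>. The increments over [s, t] are centred Gaussian with
  covariance (t - s) times the identity, expressed through their joint density.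
\<close>

definition standard_brownian_motion :: "'w measure \<Rightarrow> (real \<Rightarrow> 'w \<Rightarrow> real^'m) \<Rightarrow> bool" where
  "standard_brownian_motion P B \<longleftrightarrow>
     prob_space P \<and>
     (\<forall>t\<ge>0. B t \<in> borel_measurable P) \<and>
     (AE \<omega> in P. B 0 \<omega> = 0) \<and>
     (\<forall>\<omega>\<in>space P. continuous_on {0..} (\<lambda>t. B t \<omega>)) \<and>
     (\<forall>(n::nat) (t::nat \<Rightarrow> real). 0 \<le> t 0 \<and> mono t \<longrightarrow>
        prob_space.indep_vars P (\<lambda>_. borel) (\<lambda>i \<omega>. B (t (Suc i)) \<omega> - B (t i) \<omega>) {..<n}) \<and>
     (\<forall>s t. 0 \<le> s \<and> s < t \<longrightarrow>
        distributed P lborel (\<lambda>\<omega>. B t \<omega> - B s \<omega>)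
          (\<lambda>z. ennreal (\<Prod>i\<in>UNIV. normal_density 0 (sqrt (t - s)) (z $ i))))"

definition Dfun :: "(real^'d \<Rightarrow> real^'m) \<Rightarrow> real^'d \<Rightarrow> (real^'d) \<Rightarrow>\<^sub>L (real^'m)" where
  "Dfun f x = Blinfun (frechet_derivative f (at x))"

definition C1b :: "(real^'d \<Rightarrow> real^'m) set" where
  "C1b = {f. f differentiable_on UNIV \<and> bounded (range f) \<and>
             continuous_on UNIV (Dfun f) \<and> bounded (range (Dfun f))}"

definition sup_norm :: "('a \<Rightarrow> 'b::real_normed_vector) \<Rightarrow> real" where
  "sup_norm f = (SUP x. norm (f x))"

text \<open>The norm of the derivative is the operator norm.\<close>

definition Fclass :: "real \<Rightarrow> real \<Rightarrow> (real^'d \<Rightarrow> real^'m) set" where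
  "Fclass \<sigma> \<Lambda> = {f \<in> C1b. sup_norm f \<le> \<sigma> \<and> sup_norm (Dfun f) \<le> \<Lambda>}"

text \<open>
  The curve \<gamma> is (the continuous representative of) an element of the Sobolev space of order
  (1, \<infinity>) on [s, t], and v is a representative of its weak derivative, which is unique up to
  null sets.
\<close>

definition W1inf :: "real \<Rightarrow> real \<Rightarrow> (real \<Rightarrow> real^'d) \<Rightarrow> (real \<Rightarrow> real^'d) \<Rightarrow> bool" where
  "W1inf s t \<gamma> v \<longleftrightarrow>
     v \<in> borel_measurable borel \<and>
     (\<exists>K. AE r in lborel. r \<in> {s..t} \<longrightarrow> norm (v r) \<le> K) \<and>
     (\<forall>r\<in>{s..t}. \<gamma> r = \<gamma> s + (LINT u:{s..r}|lborel. v u))"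

text \<open>The integral of f along \<gamma> against the path b, defined by integration by parts.\<close>

definition path_integral ::
  "(real^'d \<Rightarrow> real^'m) \<Rightarrow> (real \<Rightarrow> real^'m) \<Rightarrow> real \<Rightarrow> real \<Rightarrow>
   (real \<Rightarrow> real^'d) \<Rightarrow> (real \<Rightarrow> real^'d) \<Rightarrow> real" where
  "path_integral f b s t \<gamma> v =
     f (\<gamma> t) \<bullet> b t - f (\<gamma> s) \<bullet> b s - (LINT r:{s..t}|lborel. blinfun_apply (Dfun f (\<gamma> r)) (v r) \<bullet> b r)"

definition Lfun ::
  "(real^'d \<Rightarrow> real) \<Rightarrow> (real^'d \<Rightarrow> real^'m) \<Rightarrow> (real \<Rightarrow> real^'m) \<Rightarrow>
   (real^'d) \<times> (real^'d) \<times> real \<times> real \<Rightarrow> real" where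
  "Lfun H f b = (\<lambda>(x, y, s, t).
     Inf {(LINT r:{s..t}|lborel. legendre H (v r)) + path_integral f b s t \<gamma> v | \<gamma> v.
          W1inf s t \<gamma> v \<and> \<gamma> s = x \<and> \<gamma> t = y})"

definition Udom :: "real \<Rightarrow> real \<Rightarrow> real \<Rightarrow> ((real^'d) \<times> (real^'d) \<times> real \<times> real) set" where
  "Udom \<tau> R T = {(x, y, s, t). s \<in> {0..T} \<and> t \<in> {0..T} \<and> norm (x - y) \<le> R \<and> \<tau> < t - s \<and> t - s < T}"

text \<open>Extended-real valued, as the supremum may be infinite.\<close>

definition holder_seminorm ::
  "real \<Rightarrow> real \<Rightarrow> ((real^'d) \<times> (real^'d) \<times> real \<times> real) set \<Rightarrow>
   ((real^'d) \<times> (real^'d) \<times> real \<times> real \<Rightarrow> real) \<Rightarrow> ereal" where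
  "holder_seminorm \<alpha> \<beta> U g =
     Sup {ereal (\<bar>g (x, y, s, t) - g (x', y', s', t')\<bar> /
                 (norm ((x, y) - (x', y')) powr \<alpha> + norm ((s, t) - (s', t')) powr \<beta>)) |
          x y s t x' y' s' t'.
          (x, y, s, t) \<in> U \<and> (x', y', s', t') \<in> U \<and> (x, y, s, t) \<noteq> (x', y', s', t')}"

end

theory Submission
  imports Defs
begin

text \<open>
  Cut \<open>[0, T]\<close> into cells of length of order \<open>\<sigma>\<^sup>2\<close>. On a cell the increment of
  \<open>\<integral>f(\<gamma>) dB\<close> is at most \<open>\<sigma>\<close> times the oscillation of \<open>B\<close> plus \<open>\<Lambda>\<close> times that oscillation times
  the length of \<open>\<gamma>\<close>; since \<open>\<sigma> \<Lambda> = K\<close>, both contributions stay bounded when summed over the cells,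
  uniformly in \<open>\<sigma>\<close>. What is needed of \<open>B\<close> is therefore a law of large numbers: the empirical \<open>r\<close>-th
  moments of its normalised dyadic increments, on all levels finer than \<open>\<sigma>\<^sup>2\<close>, exceed \<open>m + u\<close> only with
  probability of order \<open>(\<sigma>\<^sup>2 / u)\<^sup>k\<close>, for every \<open>k\<close>. A large \<open>r\<close> lets one localise to short time
  intervals \<open>I\<close>, where the noise is of order \<open>|I|\<close> to a power just below \<open>1/2\<close>. The coercivity of
  \<open>H\<^sup>*\<close> then bounds the energy of near minimisers, and moving an endpoint by \<open>D\<close> through an affine
  correction on a window of length \<open>D\<close> to the power \<open>2 q / (2 + q)\<close> costs \<open>D\<close> to any power
  \<open>\<theta> < q / (2 + q)\<close>. An endpoint in time is moved by truncating or prolonging the path, which shifts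
  the endpoint in space by a multiple of the time shift to the power \<open>1 / q\<close>.

  The Hoelder seminorm is thus at most cubic in the empirical moments. The supremum is over an
  uncountable class of functions, but it is lower semicontinuous in the path for the uniform distance,
  hence measurable.
\<close>

section \<open>Lipschitz curves and the pathwise integral\<close>

text \<open>Every estimate uses of \<open>f\<close> only the bounds \<open>\<sigma>\<close> and
  \<open>\<Lambda>\<close>, so a single event for \<open>B\<close> serves the whole class: there is
  no chaining over functions, and all the probability sits in the dyadic means.

  The threshold \<open>q / (2 + q)\<close> comes from an optimisation. On a window of length
  \<open>len\<close> the noise costs about \<open>len powr (1/2)\<close>, while moving an endpoint
  by \<open>D\<close> costs \<open>D * len powr (- 1 / q)\<close> in the Lagrangian. With
  \<open>len\<close> of order \<open>D powr a\<close> the exponents \<open>a / 2\<close> and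
  \<open>1 - a / q\<close> agree at \<open>a = 2 * q / (2 + q)\<close>, where both equal
  \<open>q / (2 + q)\<close>. Moments of finite order \<open>r\<close> give the noise exponent
  \<open>1/2 - 1 / r\<close> only; the strict inequality for \<open>\<theta>\<close> leaves room for
  this loss.

  The parameters \<open>R\<close> and \<open>\<tau>\<close> enter through the deterministic Hoelder
  estimate alone, after \<open>r\<close>, the grid and the tail constants are fixed. This is why
  \<open>C\<close> does not depend on them. The factor \<open>M powr p\<close> appears because the
  deviation is measured relative to \<open>M\<close>: an excess \<open>u\<close> of the dyadic means
  corresponds to \<open>u ^ 3 = 1 + l / M\<close>.\<close>

lemma set_integral_combine:
  fixes f :: "real \<Rightarrow> 'a::{banach, second_countable_topology}"
  assumes "a \<le> b" "b \<le> c" "set_integrable lborel {a..c} f"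
  shows "(LINT r:{a..c}|lborel. f r) = (LINT r:{a..b}|lborel. f r) + (LINT r:{b..c}|lborel. f r)"
proof -
  have "{a..c} = {a..b} \<union> {b..c}" using assms by auto
  moreover have "AE x in lborel. \<not> (x \<in> {a..b} \<and> x \<in> {b..c})"
    using AE_lborel_singleton[of b] by eventually_elim auto
  ultimately show ?thesis
    using assms set_integrable_subset[OF assms(3), of "{a..b}"] set_integrable_subset[OF assms(3), of "{b..c}"]
    by (auto intro!: set_integral_Un_AE)
qed

lemma set_integral_singleton [simp]:
  fixes f :: "real \<Rightarrow> 'a::{banach, second_countable_topology}"
  shows "(LINT r:{a}|lborel. f r) = 0"
proof -
  have "AE x in lborel. x \<noteq> a" by (rule AE_lborel_singleton)
  then show ?thesis
    unfolding set_lebesgue_integral_def by (intro integral_eq_zero_AE) (auto elim: eventually_mono)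
qed

lemma set_integrable_const_Icc [simp]:
  fixes c :: "'a::{banach, second_countable_topology}"
  shows "set_integrable lborel {a..b::real} (\<lambda>_. c)"
  by (intro borel_integrable_atLeastAtMost') simp

lemma set_integral_const_Icc:
  fixes c :: real
  shows "a \<le> b \<Longrightarrow> (LINT r:{a..b}|lborel. c) = (b - a) * c"
  by (simp add: set_lebesgue_integral_def)

lemma set_integral_nonneg_Icc:
  fixes f :: "real \<Rightarrow> real"
  assumes "\<And>r. r \<in> {a..b} \<Longrightarrow> 0 \<le> f r"
  shows "0 \<le> (LINT r:{a..b}|lborel. f r)"
  using assms by (auto simp: set_lebesgue_integral_def indicator_def intro!: integral_nonneg_AE)

lemma set_integral_mono_Icc:
  fixes f :: "real \<Rightarrow> real"
  assumes "s \<le> a" "b \<le> t" "set_integrable lborel {s..t} f" "\<And>r. r \<in> {s..t} \<Longrightarrow> 0 \<le> f r"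
  shows "(LINT r:{a..b}|lborel. f r) \<le> (LINT r:{s..t}|lborel. f r)"
  unfolding set_lebesgue_integral_def
  by (rule integral_mono)
     (use assms set_integrable_subset[OF assms(3), of "{a..b}"] in
        \<open>auto simp: set_integrable_def indicator_def\<close>)

lemma W1inf_measurable: "W1inf s t \<gamma> v \<Longrightarrow> v \<in> borel_measurable borel"
  by (simp add: W1inf_def)

text \<open>Essential boundedness of \<open>v\<close> keeps \<open>g (v r)\<close> in the compact
  image of a ball for almost every \<open>r\<close>. Norms, energies and Lagrangians of the velocity
  all become integrable through this one lemma.\<close>

lemma W1inf_compose_integrable:
  fixes g :: "real^'d \<Rightarrow> 'b::{banach, second_countable_topology}"
  assumes "W1inf s t \<gamma> v" "continuous_on UNIV g"
  shows "set_integrable lborel {s..t} (\<lambda>r. g (v r))"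
proof -
  obtain K where K: "AE r in lborel. r \<in> {s..t} \<longrightarrow> norm (v r) \<le> K"
    using assms by (auto simp: W1inf_def)
  have "compact (g ` cball 0 K)"
    by (intro compact_continuous_image continuous_on_subset[OF assms(2)]) auto
  then obtain C where C: "\<And>x. norm x \<le> K \<Longrightarrow> norm (g x) \<le> C"
    by (force dest!: compact_imp_bounded simp: bounded_iff)
  have [measurable]: "g \<in> borel_measurable borel" "v \<in> borel_measurable borel"
    using assms by (auto intro: borel_measurable_continuous_onI W1inf_measurable)
  show ?thesis
  proof (rule set_integrable_bound[of _ _ "\<lambda>_. C"])
    show "AE r in lborel. r \<in> {s..t} \<longrightarrow> norm (g (v r)) \<le> norm C"
      using K by eventually_elim (use C in force)
    show "set_borel_measurable lborel {s..t} (\<lambda>r. g (v r))"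
      unfolding set_borel_measurable_def by measurable
  qed simp
qed

text \<open>Complements the previous lemma for integrands that also depend on \<open>r\<close>
  directly, as the stochastic one does through \<open>Dfun f (\<gamma> r)\<close> and
  \<open>b r\<close>. Being linear in \<open>v r\<close>, it can be written with a continuous factor
  \<open>w\<close>.\<close>

lemma W1inf_inner_integrable:
  assumes "W1inf s t \<gamma> v" "continuous_on {s..t} w"
  shows "set_integrable lborel {s..t} (\<lambda>r. w r \<bullet> v r)"
proof -
  obtain K where K: "AE r in lborel. r \<in> {s..t} \<longrightarrow> norm (v r) \<le> K"
    using assms by (auto simp: W1inf_def)
  have "compact (w ` {s..t})"
    by (intro compact_continuous_image assms(2)) auto
  then obtain C where C: "\<And>r. r \<in> {s..t} \<Longrightarrow> norm (w r) \<le> C"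
    by (force dest!: compact_imp_bounded simp: bounded_iff)
  have [measurable]: "v \<in> borel_measurable borel"
    "(\<lambda>r. indicator {s..t} r *\<^sub>R w r) \<in> borel_measurable borel"
    using W1inf_measurable[OF assms(1)] borel_measurable_continuous_on_indicator[OF _ assms(2)] by auto
  show ?thesis
  proof (rule set_integrable_bound[of _ _ "\<lambda>_. C * K"])
    show "AE r in lborel. r \<in> {s..t} \<longrightarrow> norm (w r \<bullet> v r) \<le> norm (C * K)"
      using K
    proof eventually_elim
      case (elim r)
      show ?case
      proof
        assume r: "r \<in> {s..t}"
        have "norm (w r \<bullet> v r) \<le> norm (w r) * norm (v r)" by (simp add: Cauchy_Schwarz_ineq2)
        also have "\<dots> \<le> C * K" using C[OF r] elim r
          by (intro mult_mono) (auto intro: order_trans[OF norm_ge_zero])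
        finally show "norm (w r \<bullet> v r) \<le> norm (C * K)" by simp
      qed
    qed
    have "(\<lambda>r. indicator {s..t} r *\<^sub>R (w r \<bullet> v r)) = (\<lambda>r. (indicator {s..t} r *\<^sub>R w r) \<bullet> v r)"
      by auto
    then show "set_borel_measurable lborel {s..t} (\<lambda>r. w r \<bullet> v r)"
      unfolding set_borel_measurable_def by (simp only:) measurable
  qed simp
qed

lemma W1inf_integrable: "W1inf s t \<gamma> v \<Longrightarrow> set_integrable lborel {s..t} v"
  using W1inf_compose_integrable[of s t \<gamma> v "\<lambda>x. x"] by simp

lemma W1inf_diff:
  assumes "W1inf s t \<gamma> v" "s \<le> a" "a \<le> b" "b \<le> t"
  shows "\<gamma> b - \<gamma> a = (LINT r:{a..b}|lborel. v r)"
proof -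
  have "\<gamma> b = \<gamma> s + (LINT u:{s..b}|lborel. v u)" "\<gamma> a = \<gamma> s + (LINT u:{s..a}|lborel. v u)"
    using assms unfolding W1inf_def by (meson atLeastAtMost_iff order_trans)+
  moreover have "(LINT u:{s..b}|lborel. v u) = (LINT u:{s..a}|lborel. v u) + (LINT u:{a..b}|lborel. v u)"
    using assms set_integrable_subset[OF W1inf_integrable[OF assms(1)], of "{s..b}"]
    by (intro set_integral_combine) auto
  ultimately show ?thesis by simp
qed

lemma W1inf_subinterval:
  assumes "W1inf s t \<gamma> v" "s \<le> a" "a \<le> b" "b \<le> t"
  shows "W1inf a b \<gamma> v"
proof -
  obtain K where "AE r in lborel. r \<in> {s..t} \<longrightarrow> norm (v r) \<le> K"
    using assms by (auto simp: W1inf_def)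
  then have "AE r in lborel. r \<in> {a..b} \<longrightarrow> norm (v r) \<le> K"
    by eventually_elim (use assms in auto)
  moreover have "\<gamma> r = \<gamma> a + (LINT u:{a..r}|lborel. v u)" if "r \<in> {a..b}" for r
    using W1inf_diff[OF assms(1), of a r] that assms by (simp add: algebra_simps)
  ultimately show ?thesis
    using W1inf_measurable[OF assms(1)] unfolding W1inf_def by blast
qed

lemma W1inf_primitive:
  fixes v :: "real \<Rightarrow> real^'d"
  assumes "v \<in> borel_measurable borel" "AE r in lborel. r \<in> {s..t} \<longrightarrow> norm (v r) \<le> K"
  shows "W1inf s t (\<lambda>r. x + (LINT u:{s..r}|lborel. v u)) v"
  using assms unfolding W1inf_def by auto

lemma W1inf_norm_diff:
  assumes "W1inf s t \<gamma> v" "s \<le> a" "a \<le> b" "b \<le> t"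
  shows "norm (\<gamma> b - \<gamma> a) \<le> (LINT r:{a..b}|lborel. norm (v r))"
proof -
  have "W1inf a b \<gamma> v" by (rule W1inf_subinterval) fact+
  then show ?thesis
    unfolding W1inf_diff[OF assms]
    by (intro set_integral_norm_bound W1inf_integrable)
qed

lemma W1inf_lipschitz:
  assumes "W1inf s t \<gamma> v"
  shows "\<exists>K\<ge>0. \<forall>a b. s \<le> a \<and> a \<le> b \<and> b \<le> t \<longrightarrow>
    norm (\<gamma> b - \<gamma> a) \<le> K * (b - a) \<and> (LINT r:{a..b}|lborel. norm (v r)) \<le> K * (b - a)"
proof -
  obtain K where K: "AE r in lborel. r \<in> {s..t} \<longrightarrow> norm (v r) \<le> K"
    using assms by (auto simp: W1inf_def)
  have *: "(LINT r:{a..b}|lborel. norm (v r)) \<le> max K 0 * (b - a)" if "s \<le> a" "a \<le> b" "b \<le> t" for a b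
  proof -
    have "(LINT r:{a..b}|lborel. norm (v r)) \<le> (LINT r:{a..b}|lborel. max K 0)"
    proof (rule set_integral_mono_AE)
      show "set_integrable lborel {a..b} (\<lambda>r. norm (v r))"
        by (rule W1inf_compose_integrable[OF W1inf_subinterval[OF assms that]])
           (intro continuous_intros)
      show "AE r\<in>{a..b} in lborel. norm (v r) \<le> max K 0"
        using K by eventually_elim (use that in auto)
    qed simp
    then show ?thesis using that by (simp add: set_integral_const_Icc mult.commute)
  qed
  have "norm (\<gamma> b - \<gamma> a) \<le> max K 0 * (b - a)" if "s \<le> a" "a \<le> b" "b \<le> t" for a b
    using W1inf_norm_diff[OF assms that] *[OF that] by linarith
  with * show ?thesis by (intro exI[of _ "max K 0"]) auto
qed

lemma W1inf_continuous:
  assumes "W1inf s t \<gamma> v"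
  shows "continuous_on {s..t} \<gamma>"
proof -
  obtain K where K: "K \<ge> 0" "\<And>a b. s \<le> a \<Longrightarrow> a \<le> b \<Longrightarrow> b \<le> t \<Longrightarrow> norm (\<gamma> b - \<gamma> a) \<le> K * (b - a)"
    using W1inf_lipschitz[OF assms] by blast
  have "K-lipschitz_on {s..t} \<gamma>"
  proof (rule lipschitz_onI)
    fix x y assume "x \<in> {s..t}" "y \<in> {s..t}"
    then show "dist (\<gamma> x) (\<gamma> y) \<le> K * dist x y"
      using K(2)[of x y] K(2)[of y x]
      by (cases "x \<le> y") (auto simp: dist_norm norm_minus_commute)
  qed (fact K)
  then show ?thesis by (rule lipschitz_on_continuous_on)
qed

section \<open>Functions of class \<open>C1b\<close> along Lipschitz curves and the integral by
  parts\<close>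

lemma Fclass_bounds:
  assumes "f \<in> Fclass \<sigma> \<Lambda>"
  shows "norm (f x) \<le> \<sigma>" "norm (Dfun f x) \<le> \<Lambda>"
proof -
  have *: "norm (g x) \<le> sup_norm g" if bd: "bounded (range g)" for g :: "'c \<Rightarrow> 'e::real_normed_vector" and x
  proof -
    obtain a where "\<And>y. norm (g y) \<le> a" using bd unfolding bounded_iff by blast
    then have "bdd_above (range (\<lambda>x. norm (g x)))" by (intro bdd_aboveI[of _ a]) auto
    then show ?thesis unfolding sup_norm_def by (intro cSUP_upper) auto
  qed
  show "norm (f x) \<le> \<sigma>" "norm (Dfun f x) \<le> \<Lambda>"
    using assms *[of f x] *[of "Dfun f" x] by (simp_all add: Fclass_def C1b_def)
qed

lemma C1b_has_derivative:
  assumes "f \<in> C1b"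
  shows "(f has_derivative blinfun_apply (Dfun f x)) (at x)"
proof -
  have *: "(f has_derivative frechet_derivative f (at x)) (at x)"
    using assms frechet_derivative_works[of f "at x"] by (simp add: C1b_def differentiable_on_def)
  then have "blinfun_apply (Dfun f x) = frechet_derivative f (at x)"
    unfolding Dfun_def by (intro bounded_linear_Blinfun_apply has_derivative_bounded_linear)
  with * show ?thesis by simp
qed

lemma Fclass_C1b: "f \<in> Fclass \<sigma> \<Lambda> \<Longrightarrow> f \<in> C1b"
  by (simp add: Fclass_def)

lemma C1b_continuous_Dfun:
  assumes "f \<in> C1b" "W1inf s t \<gamma> v"
  shows "continuous_on {s..t} (\<lambda>r. Dfun f (\<gamma> r))"
proof -
  have "continuous_on UNIV (Dfun f)"
    using assms(1) by (simp add: C1b_def)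
  from continuous_on_compose2[OF this W1inf_continuous[OF assms(2)]] show ?thesis by simp
qed

lemma path_integrand_integrable:
  assumes f: "f \<in> C1b" and \<gamma>: "W1inf s t \<gamma> v" and b: "continuous_on {s..t} b"
  shows "set_integrable lborel {s..t} (\<lambda>r. blinfun_apply (Dfun f (\<gamma> r)) (v r) \<bullet> b r)"
proof -
  \<comment> \<open>The derivative is moved to the other side of the inner product: the vector on
    the right is its adjoint applied to \<open>b r\<close>, written in the basis, and depends
    continuously on \<open>r\<close>.\<close>
  have eq: "blinfun_apply (Dfun f (\<gamma> r)) (v r) \<bullet> b r =
     (\<Sum>i\<in>Basis. (blinfun_apply (Dfun f (\<gamma> r)) i \<bullet> b r) *\<^sub>R i) \<bullet> v r" for r
  proof -
    have "blinfun_apply (Dfun f (\<gamma> r)) (v r) = blinfun_apply (Dfun f (\<gamma> r)) (\<Sum>i\<in>Basis. (v r \<bullet> i) *\<^sub>R i)"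
      by (simp only: euclidean_representation)
    also have "\<dots> = (\<Sum>i\<in>Basis. (v r \<bullet> i) *\<^sub>R blinfun_apply (Dfun f (\<gamma> r)) i)"
      by (simp only: blinfun.sum_right blinfun.scaleR_right)
    finally have "blinfun_apply (Dfun f (\<gamma> r)) (v r) \<bullet> b r =
        (\<Sum>i\<in>Basis. (v r \<bullet> i) * (blinfun_apply (Dfun f (\<gamma> r)) i \<bullet> b r))"
      by (simp only: inner_sum_left inner_scaleR_left)
    also have "\<dots> = (\<Sum>i\<in>Basis. (blinfun_apply (Dfun f (\<gamma> r)) i \<bullet> b r) * (i \<bullet> v r))"
      by (intro sum.cong refl) (simp add: inner_commute mult.commute)
    finally show ?thesis
      by (simp only: inner_sum_left inner_scaleR_left)
  qed
  have "continuous_on {s..t} (\<lambda>r. \<Sum>i\<in>Basis. (blinfun_apply (Dfun f (\<gamma> r)) i \<bullet> b r) *\<^sub>R i)"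
    by (intro continuous_on_sum continuous_on_scaleR continuous_on_inner continuous_on_const b
        blinfun.continuous_on C1b_continuous_Dfun[OF f \<gamma>])
  from W1inf_inner_integrable[OF \<gamma> this] show ?thesis by (simp only: eq)
qed


lemma path_integral_combine:
  assumes f: "f \<in> C1b" and \<gamma>: "W1inf s t \<gamma> v" and b: "continuous_on {s..t} b"
    and "s \<le> u" "u \<le> t"
  shows "path_integral f b s t \<gamma> v = path_integral f b s u \<gamma> v + path_integral f b u t \<gamma> v"
  using set_integral_combine[OF assms(4,5) path_integrand_integrable[OF f \<gamma> b]]
  unfolding path_integral_def by simp

lemma path_integral_point [simp]: "path_integral f b s s \<gamma> v = 0"
  by (simp add: path_integral_def)

lemma C1b_chain_rule:
  assumes f: "f \<in> C1b" and \<gamma>: "W1inf s t \<gamma> v" and "s \<le> t"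
  shows "(LINT r:{s..t}|lborel. blinfun_apply (Dfun f (\<gamma> r)) (v r) \<bullet> c) = f (\<gamma> t) \<bullet> c - f (\<gamma> s) \<bullet> c"
proof -
  define F where "F r = blinfun_apply (Dfun f (\<gamma> r)) (v r) \<bullet> c" for r
  define g where "g r = f (\<gamma> r) \<bullet> c - (LINT u:{s..r}|lborel. F u)" for r
  have Fint: "set_integrable lborel {s..t} F"
    unfolding F_def by (rule path_integrand_integrable[OF f \<gamma>]) (rule continuous_on_const)
  obtain K where K: "K \<ge> 0" "\<And>a b. s \<le> a \<Longrightarrow> a \<le> b \<Longrightarrow> b \<le> t \<Longrightarrow> norm (\<gamma> b - \<gamma> a) \<le> K * (b - a)"
     "\<And>a b. s \<le> a \<Longrightarrow> a \<le> b \<Longrightarrow> b \<le> t \<Longrightarrow> (LINT r:{a..b}|lborel. norm (v r)) \<le> K * (b - a)"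
    using W1inf_lipschitz[OF \<gamma>] by blast
  \<comment> \<open>The base point \<open>z\<close> may be either end of the interval, so that the
    one estimate covers difference quotients from the right and from the left.\<close>
  have step: "\<bar>g y - g x\<bar> \<le> (norm (f (\<gamma> z') - f (\<gamma> z) - blinfun_apply (Dfun f (\<gamma> z)) (\<gamma> z' - \<gamma> z)) + e * K * (y - x)) * norm c"
    if xy: "s \<le> x" "x \<le> y" "y \<le> t" and z: "z = x \<and> z' = y \<or> z = y \<and> z' = x"
      and e: "\<And>r. x \<le> r \<Longrightarrow> r \<le> y \<Longrightarrow> norm (Dfun f (\<gamma> r) - Dfun f (\<gamma> z)) \<le> e" for x y z z' e
  proof -
    let ?A = "Dfun f (\<gamma> z)"
    have sub: "W1inf x y \<gamma> v" by (rule W1inf_subinterval[OF \<gamma> xy])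
    have "(LINT u:{s..y}|lborel. F u) = (LINT u:{s..x}|lborel. F u) + (LINT u:{x..y}|lborel. F u)"
      using xy set_integrable_subset[OF Fint, of "{s..y}"] by (intro set_integral_combine) auto
    then have 1: "g y - g x = (f (\<gamma> y) - f (\<gamma> x)) \<bullet> c - (LINT u:{x..y}|lborel. F u)"
      by (simp add: g_def inner_diff_left)
    have Fi: "set_integrable lborel {x..y} F"
      using xy set_integrable_subset[OF Fint, of "{x..y}"] by auto
    have Ai: "set_integrable lborel {x..y} (\<lambda>r. blinfun_apply ?A (v r) \<bullet> c)"
      by (rule W1inf_compose_integrable[OF sub, of "\<lambda>w. blinfun_apply ?A w \<bullet> c"]) (intro continuous_intros)
    have ni: "set_integrable lborel {x..y} (\<lambda>r. norm (v r))"
      by (rule W1inf_compose_integrable[OF sub]) (intro continuous_intros)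
    have "bounded_linear (\<lambda>w. blinfun_apply ?A w \<bullet> c)"
      by (intro bounded_linear_inner_left_comp blinfun.bounded_linear_right)
    from integral_bounded_linear[OF this W1inf_integrable[OF sub, unfolded set_integrable_def]]
    have 2: "(LINT r:{x..y}|lborel. blinfun_apply ?A (v r) \<bullet> c) = blinfun_apply ?A (\<gamma> y - \<gamma> x) \<bullet> c"
      unfolding W1inf_diff[OF \<gamma> xy] set_lebesgue_integral_def by (simp add: blinfun.scaleR_right)
    have "\<bar>(LINT r:{x..y}|lborel. F r) - (LINT r:{x..y}|lborel. blinfun_apply ?A (v r) \<bullet> c)\<bar>
        = \<bar>LINT r:{x..y}|lborel. F r - blinfun_apply ?A (v r) \<bullet> c\<bar>"
      using Fi Ai by simp
    also have "\<dots> \<le> (LINT r:{x..y}|lborel. \<bar>F r - blinfun_apply ?A (v r) \<bullet> c\<bar>)"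
      using set_integral_norm_bound[OF set_integral_diff(1)[OF Fi Ai]] by simp
    also have "\<dots> \<le> (LINT r:{x..y}|lborel. (e * norm c) * norm (v r))"
    proof (rule set_integral_mono)
      fix r assume r: "r \<in> {x..y}"
      have "F r - blinfun_apply ?A (v r) \<bullet> c = blinfun_apply (Dfun f (\<gamma> r) - ?A) (v r) \<bullet> c"
        by (simp add: F_def blinfun.diff_left inner_diff_left)
      also have "\<bar>\<dots>\<bar> \<le> norm (blinfun_apply (Dfun f (\<gamma> r) - ?A) (v r)) * norm c"
        by (rule Cauchy_Schwarz_ineq2)
      also have "\<dots> \<le> (e * norm (v r)) * norm c"
        using e[of r] r by (intro mult_right_mono order_trans[OF norm_blinfun]) auto
      finally show "\<bar>F r - blinfun_apply ?A (v r) \<bullet> c\<bar> \<le> (e * norm c) * norm (v r)" by (simp add: mult_ac)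
    qed (use set_integral_diff(1)[OF Fi Ai] ni in \<open>auto intro: set_integrable_abs\<close>)
    also have "\<dots> = (e * norm c) * (LINT r:{x..y}|lborel. norm (v r))" by simp
    also have "\<dots> \<le> (e * norm c) * (K * (y - x))"
    proof -
      have "0 \<le> e" using e[of x] xy by (auto intro: order_trans[OF norm_ge_zero])
      then show ?thesis using K(3)[OF xy] by (intro mult_left_mono) auto
    qed
    finally have 3: "\<bar>(LINT r:{x..y}|lborel. F r) - blinfun_apply ?A (\<gamma> y - \<gamma> x) \<bullet> c\<bar> \<le> (e * norm c) * (K * (y - x))"
      unfolding 2 .
    have 4: "\<bar>(f (\<gamma> y) - f (\<gamma> x) - blinfun_apply ?A (\<gamma> y - \<gamma> x)) \<bullet> c\<bar>
        \<le> norm (f (\<gamma> z') - f (\<gamma> z) - blinfun_apply ?A (\<gamma> z' - \<gamma> z)) * norm c"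
    proof -
      have "norm (f (\<gamma> y) - f (\<gamma> x) - blinfun_apply ?A (\<gamma> y - \<gamma> x))
          = norm (f (\<gamma> z') - f (\<gamma> z) - blinfun_apply ?A (\<gamma> z' - \<gamma> z))"
      proof (cases "z = x \<and> z' = y")
        case False
        with z have zz: "z = y" "z' = x" by auto
        have "f (\<gamma> y) - f (\<gamma> x) - blinfun_apply ?A (\<gamma> y - \<gamma> x)
            = - (f (\<gamma> x) - f (\<gamma> y) - blinfun_apply ?A (\<gamma> x - \<gamma> y))"
          by (simp add: blinfun.diff_right)
        then show ?thesis unfolding zz by (metis norm_minus_cancel)
      qed simp
      then show ?thesis using Cauchy_Schwarz_ineq2 by metis
    qed
    have "g y - g x = (f (\<gamma> y) - f (\<gamma> x) - blinfun_apply ?A (\<gamma> y - \<gamma> x)) \<bullet> c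
        - ((LINT r:{x..y}|lborel. F r) - blinfun_apply ?A (\<gamma> y - \<gamma> x) \<bullet> c)"
      unfolding 1 by (simp add: inner_diff_left)
    then show ?thesis using 3 4 by (simp add: algebra_simps)
  qed
  have "(g has_derivative (\<lambda>h. 0)) (at z within {s..t})" if z: "z \<in> {s..t}" for z
    unfolding has_derivative_within_alt
  proof (intro conjI allI impI)
    show "bounded_linear (\<lambda>h::real. 0::real)" by (rule bounded_linear_zero)
    fix e :: real assume "e > 0"
    \<comment> \<open>Two errors of size \<open>e' * K * \<bar>y - z\<bar> * norm c\<close> will be
      added: the linearisation of \<open>f\<close> and the oscillation of \<open>Dfun f\<close>. The
      added ones keep the denominator positive.\<close>
    define e' where "e' = e / (2 * (K + 1) * (norm c + 1))"
    have pos: "2 * (K + 1) * (norm c + 1) > 0" using K(1) by (auto intro!: mult_pos_pos add_nonneg_pos)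
    have e': "e' > 0" using \<open>e > 0\<close> pos unfolding e'_def by (intro divide_pos_pos)
    obtain d1 where d1: "d1 > 0" "\<And>y. norm (y - \<gamma> z) < d1 \<Longrightarrow>
        norm (f y - f (\<gamma> z) - blinfun_apply (Dfun f (\<gamma> z)) (y - \<gamma> z)) \<le> e' * norm (y - \<gamma> z)"
      using C1b_has_derivative[OF f, of "\<gamma> z"] e' unfolding has_derivative_within_alt by auto
    obtain d2 where d2: "d2 > 0" "\<And>r. r \<in> {s..t} \<Longrightarrow> dist r z < d2 \<Longrightarrow>
        dist (Dfun f (\<gamma> r)) (Dfun f (\<gamma> z)) < e'"
      using C1b_continuous_Dfun[OF f \<gamma>] z e' unfolding continuous_on_iff by meson
    define d where "d = min (d1 / (K + 1)) d2"
    have "d > 0" using d1 d2 K(1) by (simp add: d_def)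
    moreover have "norm (g y - g z - 0) \<le> e * norm (y - z)" if y: "y \<in> {s..t}" "norm (y - z) < d" for y
    proof -
      have yd: "\<bar>y - z\<bar> < d2" "\<bar>y - z\<bar> * (K + 1) < d1"
        using y K(1) by (auto simp: d_def field_simps)
      have \<gamma>y: "norm (\<gamma> y - \<gamma> z) \<le> K * \<bar>y - z\<bar>"
        using K(2)[of y z] K(2)[of z y] y z by (cases "y \<le> z") (auto simp: norm_minus_commute)
      also have "\<dots> < d1" using yd by (smt (verit) mult.commute mult_le_cancel_left)
      finally have D: "norm (f (\<gamma> y) - f (\<gamma> z) - blinfun_apply (Dfun f (\<gamma> z)) (\<gamma> y - \<gamma> z)) \<le> e' * (K * \<bar>y - z\<bar>)"
        using d1(2) \<gamma>y e' by (meson less_eq_real_def mult_left_mono order_trans)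
      have osc: "norm (Dfun f (\<gamma> r) - Dfun f (\<gamma> z)) \<le> e'" if "min y z \<le> r" "r \<le> max y z" for r
      proof -
        have "r \<in> {s..t}" "dist r z < d2" using that y z yd by (auto simp: dist_real_def)
        from d2(2)[OF this] show ?thesis by (simp add: dist_norm)
      qed
      have "\<bar>g (max y z) - g (min y z)\<bar> \<le> (norm (f (\<gamma> y) - f (\<gamma> z) - blinfun_apply (Dfun f (\<gamma> z)) (\<gamma> y - \<gamma> z))
           + e' * K * (max y z - min y z)) * norm c"
        using y z osc by (intro step) auto
      also have "\<dots> \<le> (e' * (K * \<bar>y - z\<bar>) + e' * K * \<bar>y - z\<bar>) * norm c"
        using D by (intro mult_right_mono add_mono) (auto simp: min_def max_def)
      also have "\<dots> = (e' * \<bar>y - z\<bar>) * (2 * K * norm c)" by (simp add: algebra_simps)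
      also have "\<dots> \<le> (e' * \<bar>y - z\<bar>) * (2 * (K + 1) * (norm c + 1))"
        using e' K(1) by (intro mult_left_mono mult_mono) auto
      also have "\<dots> = e * \<bar>y - z\<bar>" 
      proof -
        have "e' * (2 * (K + 1) * (norm c + 1)) = e" using less_imp_neq[OF pos] unfolding e'_def by (metis nonzero_eq_divide_eq)
        then show ?thesis by (metis mult.assoc mult.commute)
      qed
      finally show ?thesis by (auto simp: min_def max_def split: if_splits)
    qed
    ultimately show "\<exists>d>0. \<forall>y\<in>{s..t}. norm (y - z) < d \<longrightarrow> norm (g y - g z - 0) \<le> e * norm (y - z)"
      by blast
  qed
  then have "g t = g s"
    using assms(3) by (intro has_derivative_zero_unique[of "{s..t}" g t s]) auto
  then show ?thesis
    by (simp add: g_def F_def)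
qed

text \<open>Only the increments of \<open>b\<close> matter: \<open>b\<close> may be recentred at any constant \<open>c\<close>.\<close>

lemma path_integral_bound:
  assumes f: "f \<in> Fclass \<sigma> \<Lambda>" and \<gamma>: "W1inf s t \<gamma> v" and "s \<le> t" and b: "continuous_on {s..t} b"
    and o: "\<And>r. r \<in> {s..t} \<Longrightarrow> norm (b r - c) \<le> o'"
  shows "\<bar>path_integral f b s t \<gamma> v\<bar> \<le> 2 * \<sigma> * o' + \<Lambda> * o' * (LINT r:{s..t}|lborel. norm (v r))"
proof -
  note fC = Fclass_C1b[OF f]
  have o'0: "0 \<le> o'" using o[of s] \<open>s \<le> t\<close> by (auto intro: order_trans[OF norm_ge_zero])
  have \<sigma>0: "0 \<le> \<sigma>" "0 \<le> \<Lambda>" using Fclass_bounds[OF f] by (auto intro: order_trans[OF norm_ge_zero])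
  let ?I = "\<lambda>h. LINT r:{s..t}|lborel. blinfun_apply (Dfun f (\<gamma> r)) (v r) \<bullet> h r"
  have cont: "continuous_on {s..t} (\<lambda>r. b r - c)" by (intro continuous_intros b)
  have "?I b = ?I (\<lambda>r. b r - c) + ?I (\<lambda>_. c)"
    using set_integral_add(2)[OF path_integrand_integrable[OF fC \<gamma> cont]
        path_integrand_integrable[OF fC \<gamma> continuous_on_const[of _ c]]]
    by (simp add: inner_add_right[symmetric])
  \<comment> \<open>By the chain rule the integral against the constant \<open>c\<close> equals the
    boundary terms in \<open>c\<close>, so the two cancel in the formula by parts.\<close>
  then have eq: "path_integral f b s t \<gamma> v = f (\<gamma> t) \<bullet> (b t - c) - f (\<gamma> s) \<bullet> (b s - c) - ?I (\<lambda>r. b r - c)"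
    unfolding path_integral_def using C1b_chain_rule[OF fC \<gamma> \<open>s \<le> t\<close>, of c] by (simp add: inner_diff_right)
  have end_bound: "\<bar>f x \<bullet> (b r - c)\<bar> \<le> \<sigma> * o'" if "r \<in> {s..t}" for x r
    using Fclass_bounds(1)[OF f, of x] o[OF that] \<sigma>0 o'0
    by (intro order_trans[OF Cauchy_Schwarz_ineq2] mult_mono) auto
  have "\<bar>?I (\<lambda>r. b r - c)\<bar> \<le> (LINT r:{s..t}|lborel. \<bar>blinfun_apply (Dfun f (\<gamma> r)) (v r) \<bullet> (b r - c)\<bar>)"
    using set_integral_norm_bound[OF path_integrand_integrable[OF fC \<gamma> cont]] by simp
  also have "\<dots> \<le> (LINT r:{s..t}|lborel. (\<Lambda> * o') * norm (v r))"
  proof (rule set_integral_mono)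
    show "set_integrable lborel {s..t} (\<lambda>r. \<Lambda> * o' * norm (v r))"
      by (rule W1inf_compose_integrable[OF \<gamma>]) (intro continuous_intros)
    fix r assume r: "r \<in> {s..t}"
    have "\<bar>blinfun_apply (Dfun f (\<gamma> r)) (v r) \<bullet> (b r - c)\<bar>
        \<le> norm (blinfun_apply (Dfun f (\<gamma> r)) (v r)) * norm (b r - c)"
      by (rule Cauchy_Schwarz_ineq2)
    also have "\<dots> \<le> (\<Lambda> * norm (v r)) * o'"
      using Fclass_bounds(2)[OF f, of "\<gamma> r"] o[OF r] \<sigma>0 o'0
      by (intro mult_mono order_trans[OF norm_blinfun] mult_right_mono) auto
    finally show "\<bar>blinfun_apply (Dfun f (\<gamma> r)) (v r) \<bullet> (b r - c)\<bar> \<le> \<Lambda> * o' * norm (v r)"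
      by (simp add: mult_ac)
  qed (intro set_integrable_abs path_integrand_integrable fC \<gamma> cont)
  also have "\<dots> = \<Lambda> * o' * (LINT r:{s..t}|lborel. norm (v r))" by simp
  finally show ?thesis
    unfolding eq using end_bound[of s "\<gamma> s"] end_bound[of t "\<gamma> t"] \<open>s \<le> t\<close> by auto
qed

lemma path_integral_sum:
  assumes f: "f \<in> C1b" and \<gamma>: "W1inf (c 0) (c N) \<gamma> v" and b: "continuous_on {c 0..c N} b"
    and "mono c"
  shows "path_integral f b (c 0) (c N) \<gamma> v = (\<Sum>j<N. path_integral f b (c j) (c (Suc j)) \<gamma> v)"
proof -
  have "path_integral f b (c 0) (c n) \<gamma> v = (\<Sum>j<n. path_integral f b (c j) (c (Suc j)) \<gamma> v)" if "n \<le> N" for n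
    using that
  proof (induction n)
    case (Suc n)
    have le: "c 0 \<le> c n" "c n \<le> c (Suc n)" "c (Suc n) \<le> c N"
      using Suc.prems \<open>mono c\<close> by (auto simp: mono_def)
    have "path_integral f b (c 0) (c (Suc n)) \<gamma> v =
        path_integral f b (c 0) (c n) \<gamma> v + path_integral f b (c n) (c (Suc n)) \<gamma> v"
      using le by (intro path_integral_combine f W1inf_subinterval[OF \<gamma>] continuous_on_subset[OF b]) auto
    with Suc show ?case by simp
  qed simp
  then show ?thesis by simp
qed

section \<open>Dyadic oscillation of a path\<close>

definition dyadic_incr :: "real \<Rightarrow> (real \<Rightarrow> 'a::real_normed_vector) \<Rightarrow> nat \<Rightarrow> nat \<Rightarrow> real" where
  "dyadic_incr T b n j = norm (b (T * real (Suc j) / 2 ^ n) - b (T * real j / 2 ^ n))"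

text \<open>The factor \<open>sqrt (2 ^ n)\<close> makes the moments of a Brownian increment over a
  cell of length \<open>T / 2 ^ n\<close> independent of the level, so one bound on the means can be
  asked for on all fine levels at once.\<close>

definition dyadic_mean :: "real \<Rightarrow> nat \<Rightarrow> (real \<Rightarrow> 'a::real_normed_vector) \<Rightarrow> nat \<Rightarrow> real" where
  "dyadic_mean T r b n = (\<Sum>j<2 ^ n. (sqrt (2 ^ n) * dyadic_incr T b n j) ^ r) / 2 ^ n"

lemma sum_blocks:
  fixes g :: "nat \<Rightarrow> real"
  shows "(\<Sum>j<M. \<Sum>i<N. g (j * N + i)) = (\<Sum>l<M * N. g l)"
proof (induction M)
  case (Suc M)
  have "(\<Sum>l<Suc M * N. g l) = (\<Sum>l<M * N. g l) + (\<Sum>l=M*N..<M*N+N. g l)"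
    by (metis add.commute atLeast0LessThan le_add1 mult_Suc sum.atLeastLessThan_concat zero_le)
  also have "(\<Sum>l=M*N..<M*N+N. g l) = (\<Sum>i<N. g (M * N + i))"
    by (simp add: sum.shift_bounds_nat_ivl[of g 0 "M*N" N, simplified] atLeast0LessThan add.commute)
  finally show ?case using Suc by simp
qed simp

text \<open>Levy's chaining inside one cell: a point of level \<open>m\<close> is its parent
  \<open>i div 2\<close> on the level above, or one increment further when \<open>i\<close> is odd.
  Each level therefore contributes at most one increment.\<close>

lemma chain_dyadic:
  fixes b :: "real \<Rightarrow> 'a::real_normed_vector"
  assumes incr: "\<And>m i. i < 2 ^ m \<Longrightarrow> dyadic_incr T b (n + m) (j * 2 ^ m + i) \<le> (4/5) ^ m * D"
    and "i \<le> 2 ^ m"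
  shows "norm (b (T * real (j * 2 ^ m + i) / 2 ^ (n + m)) - b (T * real j / 2 ^ n)) \<le> (\<Sum>l\<le>m. (4/5) ^ l) * D"
  using \<open>i \<le> 2 ^ m\<close>
proof (induction m arbitrary: i)
  case 0
  have "0 \<le> D" using incr[of 0 0] by (auto simp: dyadic_incr_def intro: order_trans[OF norm_ge_zero])
  from 0 have "i = 0 \<or> i = 1" by auto
  then show ?case using incr[of 0 0] \<open>0 \<le> D\<close> by (auto simp: dyadic_incr_def add.commute)
next
  case (Suc m)
  define p where "p = i div 2"
  have p: "p \<le> 2 ^ m" using Suc.prems by (auto simp: p_def)
  have D0: "0 \<le> D" using incr[of 0 0] by (auto simp: dyadic_incr_def intro: order_trans[OF norm_ge_zero])
  have pt: "T * real (j * 2 ^ Suc m + 2 * p) / 2 ^ (n + Suc m) = T * real (j * 2 ^ m + p) / 2 ^ (n + m)"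
    by (simp add: field_simps)
  have IH: "norm (b (T * real (j * 2 ^ Suc m + 2 * p) / 2 ^ (n + Suc m)) - b (T * real j / 2 ^ n)) \<le> (\<Sum>l\<le>m. (4/5) ^ l) * D"
    unfolding pt by (rule Suc.IH[OF p])
  show ?case
  proof (cases "even i")
    case True
    then have "i = 2 * p" by (simp add: p_def)
    moreover have "(\<Sum>l\<le>m. (4/5) ^ l) * D \<le> (\<Sum>l\<le>Suc m. (4/5) ^ l) * D"
      using D0 by (intro mult_right_mono) auto
    ultimately show ?thesis using IH by simp
  next
    case False
    then have i: "i = Suc (2 * p)" by (simp add: p_def odd_two_times_div_two_succ)
    with Suc.prems have "2 * p < 2 ^ Suc m" by simp
    from incr[OF this] have
      "norm (b (T * real (j * 2 ^ Suc m + i) / 2 ^ (n + Suc m)) - b (T * real (j * 2 ^ Suc m + 2 * p) / 2 ^ (n + Suc m)))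
        \<le> (4/5) ^ Suc m * D"
      unfolding dyadic_incr_def i by simp
    with IH have "norm (b (T * real (j * 2 ^ Suc m + i) / 2 ^ (n + Suc m)) - b (T * real j / 2 ^ n))
        \<le> (4/5) ^ Suc m * D + (\<Sum>l\<le>m. (4/5) ^ l) * D"
      using norm_triangle_ineq[of "b (T * real (j * 2 ^ Suc m + i) / 2 ^ (n + Suc m)) - b (T * real (j * 2 ^ Suc m + 2 * p) / 2 ^ (n + Suc m))"
          "b (T * real (j * 2 ^ Suc m + 2 * p) / 2 ^ (n + Suc m)) - b (T * real j / 2 ^ n)"]
      by (simp only: diff_add_cancel add_diff_eq diff_add_eq)
    then show ?thesis by (simp add: algebra_simps)
  qed
qed

text \<open>Dyadic points are dense and \<open>b\<close> is continuous, so the chained bound passes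
  to every point of the cell. The factor 5 is the sum of the geometric series with ratio
  \<open>4/5\<close>.\<close>

lemma chain_cell:
  fixes b :: "real \<Rightarrow> 'a::real_normed_vector"
  assumes T: "T > 0" and b: "continuous_on {0..T} b" and j: "j < 2 ^ n"
    and incr: "\<And>m i. i < 2 ^ m \<Longrightarrow> dyadic_incr T b (n + m) (j * 2 ^ m + i) \<le> (4/5) ^ m * D"
    and u: "T * real j / 2 ^ n \<le> u" "u \<le> T * real (Suc j) / 2 ^ n"
  shows "norm (b u - b (T * real j / 2 ^ n)) \<le> 5 * D"
proof -
  have D0: "0 \<le> D" using incr[of 0 0] by (auto simp: dyadic_incr_def intro: order_trans[OF norm_ge_zero])
  define w where "w = u * 2 ^ n / T - real j"
  have w: "0 \<le> w" "w \<le> 1" using u T by (auto simp: w_def field_simps)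
  have uw: "u = T * (real j + w) / 2 ^ n" using T by (simp add: w_def)
  \<comment> \<open>The largest level-\<open>m\<close> point not beyond the relative position
    \<open>w\<close> in the cell; these points approach \<open>u\<close> from the left.\<close>
  define i where "i m = nat \<lfloor>w * 2 ^ m\<rfloor>" for m
  have i: "real (i m) \<le> w * 2 ^ m" "w * 2 ^ m < real (i m) + 1" for m
    using w by (auto simp: i_def of_nat_nat intro!: floor_correct)
  have i2: "i m \<le> 2 ^ m" for m
  proof -
    have "w * 2 ^ m \<le> 1 * 2 ^ m" using w by (intro mult_right_mono) auto
    with i(1)[of m] have "real (i m) \<le> real (2 ^ m)"
      unfolding of_nat_power of_nat_numeral by linarith
    then show ?thesis by (simp only: of_nat_le_iff)
  qed
  define x where "x m = T * real (j * 2 ^ m + i m) / 2 ^ (n + m)" for m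
  have x_eq: "x m = T * (real j + real (i m) / 2 ^ m) / 2 ^ n" for m
    by (simp add: x_def field_simps power_add)
  have "(\<lambda>m. real (i m) / 2 ^ m) \<longlonglongrightarrow> w"
  proof (rule tendsto_sandwich)
    show "\<forall>\<^sub>F m in sequentially. w - (1/2) ^ m \<le> real (i m) / 2 ^ m"
    proof (intro always_eventually allI)
      fix m
      have "w \<le> (real (i m) + 1) / 2 ^ m" using i(2)[of m] by (simp add: pos_le_divide_eq less_imp_le)
      then show "w - (1/2) ^ m \<le> real (i m) / 2 ^ m" by (simp add: power_one_over add_divide_distrib)
    qed
    show "\<forall>\<^sub>F m in sequentially. real (i m) / 2 ^ m \<le> w"
      using i(1) by (intro always_eventually) (auto simp: field_simps)
    have "(\<lambda>m. w - (1/2) ^ m) \<longlonglongrightarrow> w - 0"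
      by (intro tendsto_intros LIMSEQ_power_zero) auto
    then show "(\<lambda>m. w - (1/2) ^ m) \<longlonglongrightarrow> w" by simp
  qed simp
  then have "x \<longlonglongrightarrow> T * (real j + w) / 2 ^ n"
    unfolding x_eq by (intro tendsto_intros) auto
  then have lim: "x \<longlonglongrightarrow> u" by (simp add: uw)
  have in_T: "T * (real j + y) / 2 ^ n \<in> {0..T}" if "0 \<le> y" "y \<le> 1" for y
  proof -
    have "real (Suc j) \<le> 2 ^ n" using j by (metis Suc_leI of_nat_le_iff of_nat_numeral of_nat_power)
    then have "real j + y \<le> 2 ^ n" using that by simp
    then have "T * (real j + y) \<le> T * 2 ^ n" using T by (intro mult_left_mono) auto
    then show ?thesis using T that by (simp add: divide_le_eq)
  qed
  have "u \<in> {0..T}" using in_T[OF w] by (simp add: uw)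
  moreover have "x m \<in> {0..T}" for m
  proof -
    have "real (i m) \<le> 2 ^ m" using i2[of m] by (metis of_nat_le_iff of_nat_numeral of_nat_power)
    then show ?thesis unfolding x_eq by (intro in_T) (simp_all add: divide_le_eq)
  qed
  ultimately have "(\<lambda>m. b (x m)) \<longlonglongrightarrow> b u"
    using b lim by (auto simp: continuous_on_sequentially o_def)
  then have "(\<lambda>m. norm (b (x m) - b (T * real j / 2 ^ n))) \<longlonglongrightarrow> norm (b u - b (T * real j / 2 ^ n))"
    by (intro tendsto_intros)
  moreover have "norm (b (x m) - b (T * real j / 2 ^ n)) \<le> 5 * D" for m
  proof -
    have "(\<Sum>l\<le>m. (4/5) ^ l) \<le> (5::real)"
      using geometric_sum[of "4/5::real" "Suc m"] unfolding lessThan_Suc_atMost by simp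
    then show ?thesis
      using chain_dyadic[OF incr i2[of m]] D0 unfolding x_def
      by (meson mult_right_mono order_trans)
  qed
  ultimately show ?thesis by (intro LIMSEQ_le_const2) auto
qed


lemma dyadic_mean_nonneg: "0 \<le> dyadic_mean T r b n"
  unfolding dyadic_mean_def dyadic_incr_def by (intro divide_nonneg_pos sum_nonneg zero_le_power mult_nonneg_nonneg) auto

text \<open>Means on all finer levels are converted into one oscillation \<open>X j\<close> per cell
  of level \<open>n\<close>, with control of the mean of \<open>X j ^ r\<close>. The ratio
  \<open>4/5\<close> of the chaining exceeds the Brownian ratio \<open>1 / sqrt 2\<close> between
  consecutive levels; for \<open>r\<close> large this surplus also pays for the doubling of the
  number of increments per level.\<close>

lemma dyadic_oscillation:
  fixes b :: "real \<Rightarrow> 'a::real_normed_vector"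
  assumes T: "T > 0" and b: "continuous_on {0..T} b" and r: "12 \<le> r"
    and z: "\<forall>k\<ge>n. dyadic_mean T r b k \<le> z"
  shows "\<exists>X. (\<forall>j. 0 \<le> X j) \<and>
     (\<forall>j<2 ^ n. \<forall>u. T * real j / 2 ^ n \<le> u \<and> u \<le> T * real (Suc j) / 2 ^ n \<longrightarrow>
        sqrt (2 ^ n) * norm (b u - b (T * real j / 2 ^ n)) \<le> X j) \<and>
     (\<Sum>j<2 ^ n. X j ^ r) / 2 ^ n \<le> 2 * 5 ^ r * z"
proof -
  have z0: "0 \<le> z" using z dyadic_mean_nonneg[of T r b n] by (auto intro: order_trans)
  define e where "e m l = (sqrt (2 ^ n) * dyadic_incr T b (n + m) l) ^ r" for m l
  define W where "W m j = (\<Sum>i<2 ^ m. e m (j * 2 ^ m + i))" for m j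
  \<comment> \<open>The weight undoes the decay allowed in chaining: a bound of \<open>a m j\<close>
    by a common \<open>Q j\<close> for all \<open>m\<close> says that level \<open>n + m\<close>
    increments in cell \<open>j\<close> are at most
    \<open>(4/5) ^ m * root r (Q j) / sqrt (2 ^ n)\<close>.\<close>
  define a where "a m j = (5/4) ^ (m * r) * W m j" for m j
  have e0: "0 \<le> e m l" for m l by (simp add: e_def dyadic_incr_def)
  have W0: "0 \<le> W m j" for m j unfolding W_def by (intro sum_nonneg e0)
  have a0: "0 \<le> a m j" for m j unfolding a_def by (intro mult_nonneg_nonneg W0) auto
  \<comment> \<open>The ratio between the bounds for consecutive levels: weight, doubling of the
    cells, and change of normalisation. It is at most \<open>1/2\<close> once
    \<open>(25/32) ^ (r / 2)\<close> is at most \<open>1/4\<close>, which is the origin of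
    \<open>12 \<le> r\<close>.\<close>
  define c :: real where "c = (5/4) ^ r * 2 / sqrt 2 ^ r"
  have c: "0 \<le> c" "c \<le> 1/2"
  proof -
    have "5/4 / sqrt 2 \<le> 1" 
    proof -
      have "5/4 \<le> sqrt 2" by (rule real_le_rsqrt) (simp add: power2_eq_square)
      then show ?thesis by (simp add: divide_le_eq)
    qed
    then have "(5/4 / sqrt 2) ^ r \<le> (5/4 / sqrt 2) ^ 12" using r by (intro power_decreasing) auto
    also have "(5/4 / sqrt 2) ^ 12 = (((5/4 / sqrt 2) ^ 2) ^ 6)" by (simp only: power_mult[symmetric]) simp
    also have "(5/4 / sqrt 2) ^ 2 = 25/32" by (simp add: power_divide)
    also have "(25/32::real) ^ 6 \<le> 1/4" by (simp add: power_divide)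
    finally show "c \<le> 1/2" by (simp add: c_def power_divide)
  qed (simp add: c_def)
  have sum_a: "(\<Sum>j<2 ^ n. a m j) \<le> (z * 2 ^ n) * (1/2) ^ m" for m
  proof -
    have "(\<Sum>j<2 ^ n. W m j) = (\<Sum>l<2 ^ n * 2 ^ m. e m l)"
      unfolding W_def by (rule sum_blocks)
    also have "\<dots> * sqrt (2 ^ m) ^ r = dyadic_mean T r b (n + m) * 2 ^ (n + m)"
      unfolding dyadic_mean_def sum_distrib_right e_def
      by (simp add: power_add real_sqrt_mult power_mult_distrib mult_ac sum_distrib_right)
    also have "\<dots> \<le> z * 2 ^ (n + m)" using z by (intro mult_right_mono) auto
    finally have "(\<Sum>j<2 ^ n. W m j) \<le> z * 2 ^ (n + m) / sqrt (2 ^ m) ^ r"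
      by (simp add: pos_le_divide_eq)
    then have "(\<Sum>j<2 ^ n. a m j) \<le> (5/4) ^ (m * r) * (z * 2 ^ (n + m) / sqrt (2 ^ m) ^ r)"
      unfolding a_def sum_distrib_left[symmetric] by (intro mult_left_mono) auto
    also have "\<dots> = (z * 2 ^ n) * c ^ m"
      unfolding c_def power_divide power_mult_distrib
      by (simp add: power_add real_sqrt_power power_mult[symmetric] mult.commute[of r m])
    also have "\<dots> \<le> (z * 2 ^ n) * (1/2) ^ m"
      using c z0 by (intro mult_left_mono power_mono) auto
    finally show ?thesis .
  qed
  have a_le: "a m j \<le> (z * 2 ^ n) * (1/2) ^ m" if "j < 2 ^ n" for m j
    using member_le_sum[of j "{..<2 ^ n}" "a m"] a0 that sum_a[of m] by auto
  have geo: "(\<lambda>m. (z * 2 ^ n) * (1/2) ^ m) sums ((z * 2 ^ n) * 2)"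
    using sums_mult[OF geometric_sums[of "1/2::real"], of "z * 2 ^ n"] by simp
  have summ: "summable (\<lambda>m. a m j)" if "j < 2 ^ n" for j
    using a0 a_le[OF that] by (intro summable_comparison_test'[OF sums_summable[OF geo], of 0]) auto
  \<comment> \<open>Summability is known for actual cells only; the value zero elsewhere makes the
    witness nonnegative at every index.\<close>
  define Q where "Q j = (if j < 2 ^ n then (\<Sum>m. a m j) else 0)" for j :: nat
  have Q_ge: "a m j \<le> Q j" if "j < 2 ^ n" for m j
    using sum_le_suminf[OF summ[OF that], of "{m}"] a0 that by (simp add: Q_def)
  have Q0: "0 \<le> Q j" for j using Q_ge[of j 0] a0[of 0 j] by (cases "j < 2 ^ n") (auto simp: Q_def)
  have sumQ: "(\<Sum>j<2 ^ n. Q j) \<le> z * 2 ^ n * 2"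
  proof -
    have "(\<Sum>j<2 ^ n. Q j) = (\<Sum>m. \<Sum>j<2 ^ n. a m j)"
      by (subst suminf_sum) (auto simp: Q_def summ)
    also have "\<dots> \<le> (\<Sum>m. (z * 2 ^ n) * (1/2) ^ m)"
      using sum_a by (intro suminf_le summable_sum sums_summable[OF geo] summ) auto
    also have "\<dots> = z * 2 ^ n * 2" using geo by (rule sums_unique[symmetric])
    finally show ?thesis .
  qed
  have r0: "0 < r" using r by simp
  show ?thesis
  proof (intro exI[of _ "\<lambda>j. 5 * root r (Q j)"] conjI allI impI)
    show "0 \<le> 5 * root r (Q j)" for j using Q0[of j] r0 by simp
    have "(\<Sum>j<2 ^ n. (5 * root r (Q j)) ^ r) = 5 ^ r * (\<Sum>j<2 ^ n. Q j)"
      using Q0 r0 by (simp add: power_mult_distrib sum_distrib_left)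
    also have "\<dots> \<le> 5 ^ r * (z * 2 ^ n * 2)" using sumQ by (intro mult_left_mono) auto
    finally show "(\<Sum>j<2 ^ n. (5 * root r (Q j)) ^ r) / 2 ^ n \<le> 2 * 5 ^ r * z"
      by (simp add: field_simps)
    fix j u assume j: "j < 2 ^ n" and u: "T * real j / 2 ^ n \<le> u \<and> u \<le> T * real (Suc j) / 2 ^ n"
    define D where "D = root r (Q j) / sqrt (2 ^ n)"
    have incr: "dyadic_incr T b (n + m) (j * 2 ^ m + i) \<le> (4/5) ^ m * D" if "i < 2 ^ m" for m i
    proof -
      have "e m (j * 2 ^ m + i) \<le> W m j"
        unfolding W_def using that e0 by (intro member_le_sum[of i]) auto
      also have "\<dots> = (4/5) ^ (m * r) * a m j"
        by (simp add: a_def power_mult_distrib[symmetric] mult.assoc[symmetric])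
      also have "\<dots> \<le> (4/5) ^ (m * r) * Q j" using Q_ge[OF j] by (intro mult_left_mono) auto
      also have "\<dots> = ((4/5) ^ m * root r (Q j)) ^ r"
        using Q0 r0 by (simp add: power_mult power_mult_distrib)
      finally have "sqrt (2 ^ n) * dyadic_incr T b (n + m) (j * 2 ^ m + i) \<le> (4/5) ^ m * root r (Q j)"
        unfolding e_def using Q0[of j] r0
        by (subst (asm) power_mono_iff) (auto simp: dyadic_incr_def)
      then show ?thesis by (simp add: D_def field_simps)
    qed
    have "norm (b u - b (T * real j / 2 ^ n)) \<le> 5 * D"
      using chain_cell[OF T b j incr] u by blast
    then show "sqrt (2 ^ n) * norm (b u - b (T * real j / 2 ^ n)) \<le> 5 * root r (Q j)"
      by (simp add: D_def field_simps)
  qed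
qed

section \<open>From cell oscillations to bounds on the noise integral\<close>

lemma continuous_on_norm_powr:
  assumes "p > 0"
  shows "continuous_on UNIV (\<lambda>x::'a::real_normed_vector. norm x powr p)"
  by (rule continuous_on_powr') (use assms in \<open>auto intro: continuous_intros\<close>)

lemma card_nat_between:
  assumes "0 \<le> x" "x \<le> y"
  shows "real (card {j::nat. x < real j + 1 \<and> real j < y}) \<le> y - x + 2"
proof -
  have "{j::nat. x < real j + 1 \<and> real j < y} \<subseteq> {nat \<lfloor>x\<rfloor>..<nat \<lceil>y\<rceil>}"
  proof
    fix j assume "j \<in> {j::nat. x < real j + 1 \<and> real j < y}"
    then have "x < real j + 1" "real j < y" by auto
    then have "\<lfloor>x\<rfloor> \<le> int j" "int j < \<lceil>y\<rceil>" by linarith+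
    then show "j \<in> {nat \<lfloor>x\<rfloor>..<nat \<lceil>y\<rceil>}" using assms by auto
  qed
  then have "card {j::nat. x < real j + 1 \<and> real j < y} \<le> nat \<lceil>y\<rceil> - nat \<lfloor>x\<rfloor>"
    using card_mono[of "{nat \<lfloor>x\<rfloor>..<nat \<lceil>y\<rceil>}"] by simp
  then have "real (card {j::nat. x < real j + 1 \<and> real j < y}) \<le> real (nat \<lceil>y\<rceil> - nat \<lfloor>x\<rfloor>)"
    by (simp only: of_nat_le_iff)
  also have "\<dots> \<le> y - x + 2"
    using assms by (cases "nat \<lfloor>x\<rfloor> \<le> nat \<lceil>y\<rceil>") (auto simp: of_nat_diff, linarith+)
  finally show ?thesis .
qed

lemma set_integral_sum:
  fixes g :: "real \<Rightarrow> real"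
  assumes g: "set_integrable lborel {c 0..c N} g" and "mono c"
  shows "(LINT r:{c 0..c N}|lborel. g r) = (\<Sum>j<N. LINT r:{c j..c (Suc j)}|lborel. g r)"
proof -
  have "(LINT r:{c 0..c n}|lborel. g r) = (\<Sum>j<n. LINT r:{c j..c (Suc j)}|lborel. g r)" if "n \<le> N" for n
    using that
  proof (induction n)
    case (Suc n)
    have le: "c 0 \<le> c n" "c n \<le> c (Suc n)" "c (Suc n) \<le> c N"
      using Suc.prems \<open>mono c\<close> by (auto simp: mono_def)
    have "(LINT r:{c 0..c (Suc n)}|lborel. g r) = (LINT r:{c 0..c n}|lborel. g r) + (LINT r:{c n..c (Suc n)}|lborel. g r)"
      using le set_integrable_subset[OF g, of "{c 0..c (Suc n)}"] by (intro set_integral_combine) auto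
    with Suc show ?case by simp
  qed simp
  then show ?thesis by simp
qed

text \<open>At the threshold \<open>y = x powr (q' - 1)\<close> both powers equal the product; on
  either side of it one of them alone dominates. The sharp constants of Young's inequality do not
  matter here.\<close>

lemma young_powr:
  fixes x y :: real
  assumes "q > 1" "q' = q / (q - 1)" "0 \<le> x" "0 \<le> y"
  shows "x * y \<le> x powr q' + y powr q"
proof (cases "y \<le> x powr (q' - 1)")
  case True
  have q': "q' > 1" using assms(1,2) by (simp add: pos_less_divide_eq)
  have "x * y \<le> x * x powr (q' - 1)" using True assms by (intro mult_left_mono) auto
  also have "\<dots> = x powr q'" using assms(3) q' by (cases "x = 0") (auto simp: powr_diff)
  finally show ?thesis by (simp add: add_increasing2)
next
  case False
  have q': "(q' - 1) * (q - 1) = 1" "q > 1" using assms by (auto simp: field_simps)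
  have "y > 0" using False assms by (smt (verit) powr_ge_zero)
  have "x = (x powr (q' - 1)) powr (q - 1)" using assms(3) q' by (simp add: powr_powr)
  also have "\<dots> \<le> y powr (q - 1)" using False q' by (intro powr_mono2) auto
  finally have "x * y \<le> y powr (q - 1) * y" using assms by (intro mult_right_mono) auto
  also have "\<dots> = y powr q" using \<open>y > 0\<close> by (simp add: powr_diff)
  finally show ?thesis by (simp add: add_increasing)
qed

text \<open>On each cell \<open>path_integral_bound\<close> gives one term
  \<open>\<sigma> * X j\<close> and one with \<open>\<Lambda>\<close> and the integral of
  \<open>norm (v u) * X j\<close>. Young's inequality splits the latter into energy and
  \<open>X j powr q\<close>, and \<open>q \<le> r\<close> puts this below
  \<open>1 + X j ^ r\<close>, so the mean of \<open>X j ^ r\<close> is all that is needed. The level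
  \<open>n\<close> is left free: a finer grid enlarges the \<open>\<sigma>\<close> term and reduces
  the \<open>\<Lambda>\<close> term.\<close>

lemma noise_bound_level:
  fixes b :: "real \<Rightarrow> real^'m" and \<gamma> v :: "real \<Rightarrow> real^'d"
  assumes T: "T > 0" and b: "continuous_on {0..T} b" and r: "12 \<le> r" "q \<le> real r"
    and q: "q > 1" "q' = q / (q - 1)"
    and z: "\<forall>k\<ge>n. dyadic_mean T r b k \<le> z"
    and f: "f \<in> Fclass \<sigma> \<Lambda>" and \<gamma>: "W1inf \<alpha> \<beta> \<gamma> v"
    and I: "0 \<le> \<alpha>" "\<alpha> < \<beta>" "\<beta> \<le> T" and n: "T / 2 ^ n \<le> \<beta> - \<alpha>"
  shows "\<bar>path_integral f b \<alpha> \<beta> \<gamma> v\<bar> \<le>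
      2 * \<sigma> * sqrt (2 ^ n) * (\<beta> - \<alpha>) powr (1 - 1 / r) * (3 / T + 2 * 5 ^ r * z) +
      \<Lambda> / sqrt (2 ^ n) * ((LINT u:{\<alpha>..\<beta>}|lborel. norm (v u) powr q') + T + T * (2 * 5 ^ r * z))"
proof -
  note fC = Fclass_C1b[OF f]
  have \<sigma>0: "0 \<le> \<sigma>" "0 \<le> \<Lambda>" using Fclass_bounds[OF f] by (auto intro: order_trans[OF norm_ge_zero])
  have q'1: "q' > 1" using q by (simp add: pos_less_divide_eq)
  obtain X where X: "\<forall>j. 0 \<le> X j"
    "\<forall>j<2 ^ n. \<forall>u. T * real j / 2 ^ n \<le> u \<and> u \<le> T * real (Suc j) / 2 ^ n \<longrightarrow>
        sqrt (2 ^ n) * norm (b u - b (T * real j / 2 ^ n)) \<le> X j"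
    and Xsum: "(\<Sum>j<2 ^ n. X j ^ r) / 2 ^ n \<le> 2 * 5 ^ r * z"
    using dyadic_oscillation[OF T b r(1) z] by (elim exE conjE)
  have X0: "0 \<le> X j" for j using X(1) by simp
  have Xosc: "sqrt (2 ^ n) * norm (b u - b (T * real j / 2 ^ n)) \<le> X j"
    if "j < 2 ^ n" "T * real j / 2 ^ n \<le> u" "u \<le> T * real (Suc j) / 2 ^ n" for j u
    using X(2) that by simp
  define len where "len = \<beta> - \<alpha>"
  define N where "N = (LINT u:{\<alpha>..\<beta>}|lborel. norm (v u) powr q')"
  define g where "g j = T * real j / 2 ^ n" for j
  \<comment> \<open>Grid points clamped to the interval: cells that do not meet its interior
    collapse to points and contribute nothing, so sums may run over all \<open>2 ^ n\<close>
    indices.\<close>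
  define c where "c j = max \<alpha> (min \<beta> (g j))" for j
  define S where "S = (\<Sum>j<2 ^ n. X j ^ r)"
  have S: "0 \<le> S" "S \<le> 2 ^ n * (2 * 5 ^ r * z)"
    using Xsum X0 by (auto simp: S_def field_simps intro!: sum_nonneg)
  have len: "len > 0" "len \<le> T" using I by (auto simp: len_def)
  have g_mono: "g i \<le> g j" if "i \<le> j" for i j
    unfolding g_def using T that by (intro divide_right_mono mult_left_mono) auto
  have c_mono: "mono c" unfolding c_def
    by (intro monoI max.mono min.mono order_refl g_mono)
  have c0: "c 0 = \<alpha>" and cN: "c (2 ^ n) = \<beta>" using I T by (auto simp: c_def g_def)
  have c_in: "\<alpha> \<le> c j" "c j \<le> \<beta>" for j using I by (auto simp: c_def)
  have c_step: "c j \<le> c (Suc j)" for j using c_mono by (simp add: mono_def)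
  have active: "g j \<le> c j" "c (Suc j) \<le> g (Suc j)" "g j < \<beta>" "\<alpha> < g (Suc j)" if "c j < c (Suc j)" for j
    using that g_mono[of j "Suc j"] I by (auto simp: c_def max_def min_def split: if_splits)
  have c_len: "c (Suc j) - c j \<le> T / 2 ^ n" for j
  proof (cases "c j < c (Suc j)")
    case True
    have "g (Suc j) - g j = T / 2 ^ n" by (simp add: g_def field_simps)
    with active(1,2)[OF True] show ?thesis by linarith
  qed (use T c_step[of j] in auto)
  have sub: "W1inf (c j) (c (Suc j)) \<gamma> v" for j
    by (rule W1inf_subinterval[OF \<gamma>]) (use c_in c_step in auto)
  have bsub: "continuous_on {c j..c (Suc j)} b" for j
    using c_in[of j] c_in[of "Suc j"] I by (intro continuous_on_subset[OF b]) auto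
  have Ni: "set_integrable lborel {\<alpha>..\<beta>} (\<lambda>u. norm (v u) powr q')"
    by (rule W1inf_compose_integrable[OF \<gamma>]) (use q'1 in \<open>auto intro: continuous_on_norm_powr\<close>)
  \<comment> \<open>The cells that do not collapse. Their number is at most
    \<open>2 ^ n * len / T + 2\<close>, and the 2 is absorbed because the interval is no shorter
    than one cell.\<close>
  define J where "J = {j. j < 2 ^ n \<and> c j < c (Suc j)}"
  have J: "real (card J) \<le> 3 * (2 ^ n * len / T)"
  proof -
    have "J \<subseteq> {j::nat. \<alpha> * 2 ^ n / T < real j + 1 \<and> real j < \<beta> * 2 ^ n / T}"
    proof
      fix j assume "j \<in> J"
      then have "c j < c (Suc j)" by (simp add: J_def)
      from active(3,4)[OF this] T show "j \<in> {j::nat. \<alpha> * 2 ^ n / T < real j + 1 \<and> real j < \<beta> * 2 ^ n / T}"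
        by (auto simp: g_def field_simps)
    qed
    moreover have "finite {j::nat. \<alpha> * 2 ^ n / T < real j + 1 \<and> real j < \<beta> * 2 ^ n / T}"
    proof (rule finite_subset)
      show "{j::nat. \<alpha> * 2 ^ n / T < real j + 1 \<and> real j < \<beta> * 2 ^ n / T} \<subseteq> {..<nat \<lceil>\<beta> * 2 ^ n / T\<rceil>}"
        by auto linarith
    qed simp
    ultimately have "real (card J) \<le> real (card {j::nat. \<alpha> * 2 ^ n / T < real j + 1 \<and> real j < \<beta> * 2 ^ n / T})"
      by (simp only: of_nat_le_iff card_mono)
    also have "\<dots> \<le> \<beta> * 2 ^ n / T - \<alpha> * 2 ^ n / T + 2"
      using I T by (intro card_nat_between) (auto intro!: divide_right_mono)
    also have "\<beta> * 2 ^ n / T - \<alpha> * 2 ^ n / T = 2 ^ n * len / T"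
      by (simp add: len_def diff_divide_distrib algebra_simps)
    finally have "real (card J) \<le> 2 ^ n * len / T + 2" .
    moreover have "1 \<le> 2 ^ n * len / T" using n T by (simp add: len_def field_simps)
    ultimately show ?thesis by linarith
  qed
  \<comment> \<open>This localises to short intervals: only the sum of \<open>X j ^ r\<close> over
    all cells is controlled, so \<open>X j\<close> is rescaled by \<open>len powr (1 / r)\<close>,
    after which the number of active cells and the global sum both contribute in proportion to
    \<open>len\<close>. The price is the loss of \<open>1 / r\<close> in the exponent.\<close>
  have X_le: "X j \<le> (1 + len * X j ^ r) / len powr (1 / r)" for j
  proof -
    have *: "y \<le> 1 + y ^ r" if "0 \<le> y" for y :: real
    proof (cases "y \<le> 1")
      case False
      then have "y ^ 1 \<le> y ^ r" using r by (intro power_increasing) auto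
      then show ?thesis by simp
    qed (use that in \<open>simp add: add_increasing2\<close>)
    have "(len powr (1 / r) * X j) ^ r = len * X j ^ r"
      using len r by (simp add: power_mult_distrib powr_realpow[symmetric] powr_powr)
    with *[of "len powr (1 / r) * X j"] X0[of j] have "len powr (1 / r) * X j \<le> 1 + len * X j ^ r" by simp
    then show ?thesis using len by (simp add: field_simps)
  qed
  have Xq: "X j powr q \<le> 1 + X j ^ r" for j
  proof (cases "X j \<le> 1")
    case True
    then have "X j powr q \<le> 1 powr q" using X0 q by (intro powr_mono2) auto
    then show ?thesis using X0[of j] by (simp add: add_increasing2)
  next
    case False
    then have "X j powr q \<le> X j powr real r" using r by (intro powr_mono) auto
    then show ?thesis using False by (simp add: powr_realpow)
  qed
  have piece: "\<bar>path_integral f b (c j) (c (Suc j)) \<gamma> v\<bar> \<le>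
      (if j \<in> J then 2 * \<sigma> / sqrt (2 ^ n) * X j else 0) +
      \<Lambda> / sqrt (2 ^ n) * ((LINT u:{c j..c (Suc j)}|lborel. norm (v u) powr q') +
         ((c (Suc j) - c j) + T / 2 ^ n * X j ^ r))" (is "_ \<le> ?first j + \<Lambda> / sqrt (2 ^ n) * ?second j")
    if j: "j < 2 ^ n" for j
  proof (cases "j \<in> J")
    case False
    with j c_step[of j] have "c (Suc j) = c j" by (auto simp: J_def)
    moreover have "0 \<le> ?second j"
      using T X0 c_step by (intro add_nonneg_nonneg set_integral_nonneg_Icc mult_nonneg_nonneg) auto
    then have "0 \<le> \<Lambda> / sqrt (2 ^ n) * ?second j" using \<sigma>0 by (intro mult_nonneg_nonneg) auto
    ultimately show ?thesis using False by (simp only: path_integral_point if_False)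
  next
    case True
    then have lt: "c j < c (Suc j)" by (simp add: J_def)
    have Nj: "set_integrable lborel {c j..c (Suc j)} (\<lambda>u. norm (v u) powr q')"
      by (rule set_integrable_subset[OF Ni]) (use c_in[of j] c_in[of "Suc j"] in auto)
    \<comment> \<open>The path is recentred at the left end of the full grid cell, even where that
      point lies outside the interval.\<close>
    have "norm (b u - b (g j)) \<le> X j / sqrt (2 ^ n)" if "u \<in> {c j..c (Suc j)}" for u
    proof -
      have "g j \<le> u" "u \<le> g (Suc j)" using active(1,2)[OF lt] that by auto
      then show ?thesis using Xosc[OF j, of u] by (simp add: g_def pos_le_divide_eq mult.commute)
    qed
    from path_integral_bound[OF f sub[of j] c_step bsub this]
    have B: "\<bar>path_integral f b (c j) (c (Suc j)) \<gamma> v\<bar> \<le> 2 * \<sigma> / sqrt (2 ^ n) * X j +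
        \<Lambda> / sqrt (2 ^ n) * (LINT u:{c j..c (Suc j)}|lborel. norm (v u) * X j)"
      by (simp add: mult_ac)
    have "(LINT u:{c j..c (Suc j)}|lborel. norm (v u) * X j) \<le>
        (LINT u:{c j..c (Suc j)}|lborel. norm (v u) powr q' + X j powr q)"
    proof (rule set_integral_mono)
      show "set_integrable lborel {c j..c (Suc j)} (\<lambda>u. norm (v u) * X j)"
        by (rule W1inf_compose_integrable[OF sub]) (intro continuous_intros)
    qed (use Nj young_powr[OF q] X0 in auto)
    also have "\<dots> = (LINT u:{c j..c (Suc j)}|lborel. norm (v u) powr q') + (c (Suc j) - c j) * X j powr q"
      using Nj c_step[of j] by (simp add: set_integral_const_Icc)
    also have "\<dots> \<le> ?second j"
    proof -
      have "(c (Suc j) - c j) * X j powr q \<le> (c (Suc j) - c j) * (1 + X j ^ r)"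
        using Xq c_step[of j] by (intro mult_left_mono) auto
      also have "\<dots> \<le> (c (Suc j) - c j) + T / 2 ^ n * X j ^ r"
        using mult_right_mono[OF c_len[of j], of "X j ^ r"] X0[of j] by (simp add: algebra_simps)
      finally show ?thesis by simp
    qed
    finally have "\<Lambda> / sqrt (2 ^ n) * (LINT u:{c j..c (Suc j)}|lborel. norm (v u) * X j) \<le> \<Lambda> / sqrt (2 ^ n) * ?second j"
      using \<sigma>0 by (intro mult_left_mono) auto
    with B show ?thesis using True by (simp only: if_True)
  qed
  have "(\<Sum>j\<in>J. X j) \<le> (\<Sum>j\<in>J. (1 + len * X j ^ r) / len powr (1 / r))"
    by (intro sum_mono X_le)
  also have "\<dots> = (real (card J) + len * (\<Sum>j\<in>J. X j ^ r)) / len powr (1 / r)"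
    by (simp add: sum_divide_distrib[symmetric] sum.distrib sum_distrib_left)
  also have "\<dots> \<le> (3 * (2 ^ n * len / T) + len * (2 ^ n * (2 * 5 ^ r * z))) / len powr (1 / r)"
  proof -
    have "(\<Sum>j\<in>J. X j ^ r) \<le> S" unfolding S_def using X0 by (intro sum_mono2) (auto simp: J_def)
    with S J len show ?thesis by (intro divide_right_mono add_mono mult_left_mono) auto
  qed
  also have "\<dots> = 2 ^ n * (len powr (1 - 1 / r) * (3 / T + 2 * 5 ^ r * z))"
    using len by (simp add: powr_diff add_divide_distrib algebra_simps)
  finally have "2 * \<sigma> / sqrt (2 ^ n) * (\<Sum>j\<in>J. X j) \<le>
      2 * \<sigma> / sqrt (2 ^ n) * (2 ^ n * (len powr (1 - 1 / r) * (3 / T + 2 * 5 ^ r * z)))"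
    using \<sigma>0 by (intro mult_left_mono) auto
  also have "\<dots> = 2 * \<sigma> * sqrt (2 ^ n) * len powr (1 - 1 / r) * (3 / T + 2 * 5 ^ r * z)"
  proof -
    have *: "(2::real) ^ n / sqrt (2 ^ n) = sqrt (2 ^ n)" by (rule real_div_sqrt) simp
    have "2 * \<sigma> / sqrt (2 ^ n) * (2 ^ n * y) = 2 * \<sigma> * (2 ^ n / sqrt (2 ^ n)) * y" for y by simp
    then show ?thesis unfolding * by (simp only: mult.assoc)
  qed
  finally have first: "2 * \<sigma> / sqrt (2 ^ n) * (\<Sum>j\<in>J. X j) \<le> \<dots>" .
  have "(\<Sum>j<2 ^ n. LINT u:{c j..c (Suc j)}|lborel. norm (v u) powr q') = N"
    using set_integral_sum[of c "2 ^ n" "\<lambda>u. norm (v u) powr q'"] Ni c_mono by (simp add: c0 cN N_def)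
  moreover have "(\<Sum>j<2 ^ n. c (Suc j) - c j) = len"
    by (simp add: sum_lessThan_telescope c0 cN len_def)
  ultimately have "(\<Sum>j<2 ^ n. ?second j) = N + (len + T / 2 ^ n * S)"
    by (simp only: sum.distrib S_def sum_distrib_left)
  also have "\<dots> \<le> N + T + T * (2 * 5 ^ r * z)"
    using len mult_left_mono[OF S(2), of "T / 2 ^ n"] T by simp
  finally have second: "\<Lambda> / sqrt (2 ^ n) * (\<Sum>j<2 ^ n. ?second j) \<le> \<Lambda> / sqrt (2 ^ n) * (N + T + T * (2 * 5 ^ r * z))"
    using \<sigma>0 by (intro mult_left_mono) auto
  have "path_integral f b (c 0) (c (2 ^ n)) \<gamma> v = (\<Sum>j<2 ^ n. path_integral f b (c j) (c (Suc j)) \<gamma> v)"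
    by (rule path_integral_sum[OF fC _ _ c_mono]) (use \<gamma> I in \<open>auto simp: c0 cN intro: continuous_on_subset[OF b]\<close>)
  then have "\<bar>path_integral f b \<alpha> \<beta> \<gamma> v\<bar> \<le> (\<Sum>j<2 ^ n. \<bar>path_integral f b (c j) (c (Suc j)) \<gamma> v\<bar>)"
    by (simp add: c0 cN sum_abs)
  also have "\<dots> \<le> (\<Sum>j<2 ^ n. ?first j + \<Lambda> / sqrt (2 ^ n) * ?second j)"
    using piece by (intro sum_mono) auto
  also have "\<dots> = (\<Sum>j<2 ^ n. ?first j) + \<Lambda> / sqrt (2 ^ n) * (\<Sum>j<2 ^ n. ?second j)"
    by (subst sum.distrib) (simp only: sum_distrib_left)
  also have "(\<Sum>j<2 ^ n. ?first j) = 2 * \<sigma> / sqrt (2 ^ n) * (\<Sum>j\<in>J. X j)"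
  proof -
    have "{..<2 ^ n} \<inter> {j. j \<in> J} = J" by (auto simp: J_def)
    then show ?thesis by (simp add: sum.If_cases sum_distrib_left)
  qed
  finally show ?thesis using first second by (simp only: N_def len_def)
qed


lemma dyadic_level:
  fixes x :: real
  assumes "0 < x" "x \<le> 1"
  shows "\<exists>n. 1 / 2 ^ n \<le> x \<and> x \<le> 2 / 2 ^ n"
proof -
  obtain k where k: "1 / 2 ^ k \<le> x"
    using real_arch_pow_inv[of x "1/2"] assms by (auto simp: power_one_over intro: less_imp_le)
  define n where "n = (LEAST k. 1 / 2 ^ k \<le> x)"
  have n: "1 / 2 ^ n \<le> x" unfolding n_def by (rule LeastI) (rule k)
  have "x \<le> 2 / 2 ^ n"
  proof (cases n)
    case (Suc m)
    then have "\<not> 1 / 2 ^ m \<le> x" unfolding n_def using not_less_Least by (metis lessI)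
    then show ?thesis using Suc by simp
  qed (use assms in simp)
  with n show ?thesis by blast
qed

text \<open>The energy term has two duties. Its factor \<open>sqrt ((t - s) / T)\<close> is at most
  one, so \<open>\<kappa>\<close> below the coercivity constant lets the Lagrangian absorb the
  noise; on short windows the same factor makes the term small, which the endpoint corrections
  need.\<close>

definition noise_controlled :: "real \<Rightarrow> real \<Rightarrow> real \<Rightarrow> real \<Rightarrow> real \<Rightarrow> (real^'d \<Rightarrow> real^'m) \<Rightarrow> (real \<Rightarrow> real^'m) \<Rightarrow> bool" where
  "noise_controlled T q' \<beta> \<kappa> Y f b \<longleftrightarrow>
     (\<forall>s t \<gamma> v. 0 \<le> s \<and> s \<le> t \<and> t \<le> T \<and> W1inf s t \<gamma> v \<longrightarrow>
        \<bar>path_integral f b s t \<gamma> v\<bar> \<le> Y * (t - s) powr \<beta> +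
          \<kappa> * sqrt ((t - s) / T) * (LINT u:{s..t}|lborel. norm (v u) powr q'))"

text \<open>The grid of mesh proportional to \<open>\<sigma>\<^sup>2 (t - s)\<close> balances the two contributions in
  \<open>noise_bound_level\<close>; the result is uniform as \<open>\<sigma> \<rightarrow> 0\<close> because \<open>\<sigma> \<Lambda> = K\<close>.\<close>

lemma noise_bound:
  fixes T \<sigma>\<^sub>0 K \<kappa> q q' :: real
  assumes T: "T > 0" and pos: "\<sigma>\<^sub>0 > 0" "K > 0" "\<kappa> > 0" and r: "12 \<le> r" "q \<le> real r"
    and q: "q > 1" "q' = q / (q - 1)"
  shows "\<exists>A\<ge>1. \<forall>\<sigma> \<Lambda>. 0 < \<sigma> \<and> \<sigma> < \<sigma>\<^sub>0 \<and> \<sigma> * \<Lambda> = K \<longrightarrow>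
    (\<exists>n\<^sub>0. 1 / 2 ^ n\<^sub>0 \<le> A * \<sigma>\<^sup>2 \<and>
      (\<forall>z (b :: real \<Rightarrow> real^'m) (f :: real^'d \<Rightarrow> real^'m).
         continuous_on {0..T} b \<and> f \<in> Fclass \<sigma> \<Lambda> \<and> (\<forall>k\<ge>n\<^sub>0. dyadic_mean T r b k \<le> z) \<longrightarrow>
         noise_controlled T q' (1/2 - 1 / r) \<kappa> (A * (1 + z)) f b))"
proof -
  \<comment> \<open>The first bound gives \<open>\<eta> * \<sigma>\<^sup>2 \<le> 1\<close>, so that
    a dyadic level of this size exists; the second gives
    \<open>K * sqrt \<eta> \<le> \<kappa>\<close>, the coefficient wanted in front of the
    energy.\<close>
  define \<eta> where "\<eta> = min (1 / \<sigma>\<^sub>0\<^sup>2) ((\<kappa> / K)\<^sup>2)"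
  define c :: real where "c = 2 * 5 ^ r"
  define A1 where "A1 = 4 * sqrt (T / \<eta>) * (3 / T + c)"
  define A2 where "A2 = \<kappa> * T powr (1 / r) / sqrt T * (T + T * c)"
  define A where "A = 1 + \<eta> + A1 + A2"
  have \<eta>: "\<eta> > 0" using pos by (simp add: \<eta>_def)
  have "A1 \<ge> 0" "A2 \<ge> 0" "c \<ge> 0" using T pos \<eta> by (auto simp: A1_def A2_def c_def)
  show ?thesis
  proof (intro exI[of _ A] conjI allI impI)
    show "1 \<le> A" using \<open>A1 \<ge> 0\<close> \<open>A2 \<ge> 0\<close> \<eta> by (simp add: A_def)
    fix \<sigma> \<Lambda> assume \<sigma>: "0 < \<sigma> \<and> \<sigma> < \<sigma>\<^sub>0 \<and> \<sigma> * \<Lambda> = K"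
    have "\<eta> * \<sigma>\<^sup>2 \<le> 1 / \<sigma>\<^sub>0\<^sup>2 * \<sigma>\<^sub>0\<^sup>2"
      using \<sigma> \<eta> by (intro mult_mono power_mono) (auto simp: \<eta>_def)
    also have "\<dots> = 1" using pos by simp
    finally obtain n\<^sub>0 where n0: "1 / 2 ^ n\<^sub>0 \<le> \<eta> * \<sigma>\<^sup>2" "\<eta> * \<sigma>\<^sup>2 \<le> 2 / 2 ^ n\<^sub>0"
      using dyadic_level[of "\<eta> * \<sigma>\<^sup>2"] \<eta> \<sigma> by auto
    have "1 / 2 ^ n\<^sub>0 \<le> A * \<sigma>\<^sup>2"
      using n0(1) \<open>A1 \<ge> 0\<close> \<open>A2 \<ge> 0\<close> mult_right_mono[of \<eta> A "\<sigma>\<^sup>2"] by (simp add: A_def)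
    moreover have "noise_controlled T q' (1/2 - 1 / r) \<kappa> (A * (1 + z)) f b"
      if H: "continuous_on {0..T} b" "f \<in> Fclass \<sigma> \<Lambda>" "\<forall>k\<ge>n\<^sub>0. dyadic_mean T r b k \<le> z"
      for z and b :: "real \<Rightarrow> real^'m" and f :: "real^'d \<Rightarrow> real^'m"
      unfolding noise_controlled_def
    proof (intro allI impI, elim conjE)
      fix s t :: real and \<gamma> v :: "real \<Rightarrow> real^'d"
      assume I: "0 \<le> s" "s \<le> t" "t \<le> T" and \<gamma>: "W1inf s t \<gamma> v"
      define len where "len = t - s"
      define N where "N = (LINT u:{s..t}|lborel. norm (v u) powr q')"
      have N0: "0 \<le> N" unfolding N_def by (intro set_integral_nonneg_Icc) auto
      have z0: "0 \<le> z" using H(3) dyadic_mean_nonneg[of T r b n\<^sub>0] by (auto intro: order_trans)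
      show "\<bar>path_integral f b s t \<gamma> v\<bar> \<le> A * (1 + z) * (t - s) powr (1/2 - 1 / r) +
          \<kappa> * sqrt ((t - s) / T) * (LINT u:{s..t}|lborel. norm (v u) powr q')"
      proof (cases "s = t")
        case False
        then have len: "0 < len" "len \<le> T" using I by (auto simp: len_def)
        then obtain m where m: "1 / 2 ^ m \<le> len / T" "len / T \<le> 2 / 2 ^ m"
          using dyadic_level[of "len / T"] T by auto
        \<comment> \<open>A relative mesh of order
          \<open>\<eta> * \<sigma>\<^sup>2 * (len / T)\<close>. Then
          \<open>\<sigma> * sqrt (2 ^ n)\<close> is of order \<open>1 / sqrt len\<close>, and
          \<open>\<Lambda> / sqrt (2 ^ n)\<close> is at most
          \<open>\<kappa> * sqrt (len / T)\<close>, both free of \<open>\<sigma>\<close>. Since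
          \<open>n\<close> is at least \<open>n\<^sub>0\<close>, the assumption on the means applies
          on all levels used.\<close>
        define n where "n = n\<^sub>0 + m"
        have n_le: "1 / 2 ^ n \<le> \<eta> * \<sigma>\<^sup>2 * (len / T)"
          using mult_mono[OF n0(1) m(1)] \<eta> by (simp add: n_def power_add)
        have n_ge: "\<eta> * \<sigma>\<^sup>2 * (len / T) \<le> 4 / 2 ^ n"
          using mult_mono[OF n0(2) m(2)] len T by (simp add: n_def power_add)
        have "(1::real) / 2 ^ n \<le> 1 / 2 ^ m" by (intro divide_left_mono power_increasing) (auto simp: n_def)
        with m(1) have "1 / 2 ^ n \<le> len / T" by linarith
        then have "T / 2 ^ n \<le> t - s" using T by (simp add: field_simps len_def)
        moreover have "\<forall>k\<ge>n. dyadic_mean T r b k \<le> z" using H(3) by (simp add: n_def)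
        ultimately have bound: "\<bar>path_integral f b s t \<gamma> v\<bar> \<le>
            2 * \<sigma> * sqrt (2 ^ n) * len powr (1 - 1 / r) * (3 / T + c * z) +
            \<Lambda> / sqrt (2 ^ n) * (N + T + T * (c * z))"
          using noise_bound_level[OF T H(1) r q _ H(2) \<gamma>] I False unfolding N_def len_def c_def by simp
        have "sqrt (2 ^ n) \<le> sqrt (4 / (\<eta> * \<sigma>\<^sup>2 * (len / T)))"
          using n_ge \<eta> \<sigma> len T by (intro real_sqrt_le_mono) (simp add: field_simps)
        also have "\<dots> = 2 * sqrt (T / \<eta>) / (\<sigma> * sqrt len)"
          using \<sigma> by (simp add: real_sqrt_divide real_sqrt_mult)
        finally have "\<sigma> * sqrt (2 ^ n) \<le> \<sigma> * (2 * sqrt (T / \<eta>) / (\<sigma> * sqrt len))"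
          using \<sigma> by (intro mult_left_mono) auto
        also have "\<dots> = 2 * sqrt (T / \<eta>) / sqrt len" using \<sigma> by simp
        finally have sn: "\<sigma> * sqrt (2 ^ n) \<le> 2 * sqrt (T / \<eta>) / sqrt len" .
        have "d + c * z \<le> (d + c) * (1 + z)" if "0 \<le> d" for d
          using z0 \<open>c \<ge> 0\<close> that by (simp add: algebra_simps)
        from sn this[of "3 / T"] have "\<sigma> * sqrt (2 ^ n) * (2 * len powr (1 - 1 / r) * (3 / T + c * z)) \<le>
            2 * sqrt (T / \<eta>) / sqrt len * (2 * len powr (1 - 1 / r) * ((3 / T + c) * (1 + z)))"
          using z0 \<open>c \<ge> 0\<close> T \<sigma> \<eta> len by (intro mult_mono) auto
        also have "\<dots> = A1 * (1 + z) * (len powr (1 - 1 / r) / sqrt len)"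
          by (simp add: A1_def)
        also have "len powr (1 - 1 / r) / sqrt len = len powr (1/2 - 1 / r)"
          using len by (simp add: powr_half_sqrt[symmetric] powr_diff[symmetric])
        finally have first: "2 * \<sigma> * sqrt (2 ^ n) * len powr (1 - 1 / r) * (3 / T + c * z)
            \<le> A1 * (1 + z) * len powr (1/2 - 1 / r)" by (simp add: mult_ac)
        have "\<Lambda> = K / \<sigma>" using \<sigma> by (auto simp: field_simps)
        then have "\<Lambda> / sqrt (2 ^ n) = K / \<sigma> * sqrt (1 / 2 ^ n)" by (simp add: real_sqrt_divide)
        also have "\<dots> \<le> K / \<sigma> * sqrt (\<eta> * \<sigma>\<^sup>2 * (len / T))"
          using n_le \<sigma> pos by (intro mult_left_mono real_sqrt_le_mono) auto
        also have "\<dots> = K * sqrt \<eta> * sqrt (len / T)"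
        proof -
          have "sqrt (\<eta> * \<sigma>\<^sup>2 * (len / T)) = sqrt \<eta> * \<sigma> * sqrt (len / T)"
            using \<sigma> by (simp only: real_sqrt_mult real_sqrt_abs abs_of_pos)
          then show ?thesis using \<sigma> by (simp only:) (simp add: field_simps)
        qed
        also have "\<dots> \<le> \<kappa> * sqrt (len / T)"
        proof -
          have "sqrt \<eta> \<le> sqrt ((\<kappa> / K)\<^sup>2)" by (intro real_sqrt_le_mono) (simp add: \<eta>_def)
          also have "sqrt ((\<kappa> / K)\<^sup>2) = \<kappa> / K" using pos by simp
          finally have "K * sqrt \<eta> \<le> \<kappa>" using pos by (simp add: pos_le_divide_eq mult.commute)
          then show ?thesis using len T by (intro mult_right_mono) auto
        qed
        finally have \<Lambda>: "\<Lambda> / sqrt (2 ^ n) \<le> \<kappa> * sqrt (len / T)" .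
        have "\<Lambda> / sqrt (2 ^ n) * (N + T + T * (c * z)) \<le> \<kappa> * sqrt (len / T) * (N + T + T * (c * z))"
          using \<Lambda> N0 T z0 \<open>c \<ge> 0\<close> by (intro mult_right_mono) auto
        also have "\<dots> = \<kappa> * sqrt (len / T) * N + \<kappa> * sqrt (len / T) * (T + T * (c * z))"
          by (simp add: algebra_simps)
        also have "\<kappa> * sqrt (len / T) * (T + T * (c * z)) \<le> A2 * (1 + z) * len powr (1/2 - 1 / r)"
        proof -
          have "sqrt len = len powr (1/2 - 1 / r) * len powr (1 / r)"
            using len by (simp add: powr_half_sqrt[symmetric] powr_add[symmetric])
          also have "\<dots> \<le> len powr (1/2 - 1 / r) * T powr (1 / r)"
            using len by (intro mult_left_mono powr_mono2) auto
          finally have "sqrt (len / T) \<le> len powr (1/2 - 1 / r) * T powr (1 / r) / sqrt T"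
            using T by (simp add: real_sqrt_divide divide_right_mono)
          moreover have "T + T * (c * z) \<le> (T + T * c) * (1 + z)"
            using z0 \<open>c \<ge> 0\<close> T by (simp add: algebra_simps)
          ultimately have "\<kappa> * sqrt (len / T) * (T + T * (c * z)) \<le>
              \<kappa> * (len powr (1/2 - 1 / r) * T powr (1 / r) / sqrt T) * ((T + T * c) * (1 + z))"
            using pos T z0 \<open>c \<ge> 0\<close> len by (intro mult_mono mult_left_mono) auto
          then show ?thesis by (simp add: A2_def mult_ac)
        qed
        finally have second: "\<Lambda> / sqrt (2 ^ n) * (N + T + T * (c * z)) \<le>
            \<kappa> * sqrt (len / T) * N + A2 * (1 + z) * len powr (1/2 - 1 / r)" by simp
        have "(A1 + A2) * ((1 + z) * len powr (1/2 - 1 / r)) \<le> A * ((1 + z) * len powr (1/2 - 1 / r))"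
          using z0 \<eta> by (intro mult_right_mono) (auto simp: A_def)
        then show ?thesis
          using bound first second unfolding len_def[symmetric] N_def[symmetric]
          by (simp add: algebra_simps)
      qed simp
    qed
    ultimately show "\<exists>n\<^sub>0. 1 / 2 ^ n\<^sub>0 \<le> A * \<sigma>\<^sup>2 \<and>
      (\<forall>z (b :: real \<Rightarrow> real^'m) (f :: real^'d \<Rightarrow> real^'m).
         continuous_on {0..T} b \<and> f \<in> Fclass \<sigma> \<Lambda> \<and> (\<forall>k\<ge>n\<^sub>0. dyadic_mean T r b k \<le> z) \<longrightarrow>
         noise_controlled T q' (1/2 - 1 / r) \<kappa> (A * (1 + z)) f b)"
      by blast
  qed
qed

section \<open>Growth of the Legendre transform\<close>

lemma powr_add_le:
  fixes x y p :: real
  assumes "0 \<le> x" "0 \<le> y" "0 \<le> p"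
  shows "(x + y) powr p \<le> 2 powr p * (x powr p + y powr p)"
proof -
  have "(x + y) powr p \<le> (2 * max x y) powr p"
    using assms by (intro powr_mono2) auto
  also have "\<dots> = 2 powr p * max x y powr p" using assms by (simp add: powr_mult)
  also have "max x y powr p \<le> x powr p + y powr p" by (simp add: max_def)
  finally show ?thesis by (simp add: mult_left_mono)
qed

text \<open>The supremum is tested at one multiple of \<open>v\<close>, of the length that makes the
  upper growth bound of \<open>H\<close> cost half of the product
  \<open>p \<bullet> v\<close>.\<close>

lemma legendre_lower:
  fixes H :: "real^'d \<Rightarrow> real"
  assumes q: "q > 1" "q' = q / (q - 1)" and c: "c > 1"
    and growth: "\<And>p. norm p powr q / c - c \<le> H p" "\<And>p. H p \<le> c * (norm p powr q + 1)"
  shows "1 / (2 * (2 * c) powr (q' - 1)) * norm v powr q' - c \<le> legendre H v"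
proof -
  have q1: "q' - 1 = 1 / (q - 1)" "(q' - 1) * (q - 1) = 1" "q' - 1 > 0"
    unfolding q(2) using q(1) by (auto simp: field_simps)
  \<comment> \<open>A real \<open>SUP\<close> dominates its values only over a set bounded above, so
    finiteness comes first. Either \<open>norm p powr (q - 1) \<le> c * norm v\<close>, which bounds
    \<open>p\<close>, or \<open>norm p powr q / c\<close> outweighs the product.\<close>
  have bdd: "bdd_above (range (\<lambda>p. p \<bullet> v - H p))"
  proof (rule bdd_aboveI2)
    fix p :: "real^'d"
    let ?B = "(c * norm v) powr (q' - 1) * norm v + c"
    have "p \<bullet> v - H p \<le> norm p * norm v - norm p powr q / c + c"
      using norm_cauchy_schwarz[of p v] growth(1)[of p] by simp
    also have "\<dots> \<le> ?B"
    proof (cases "norm p powr (q - 1) \<le> c * norm v")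
      case True
      have "norm p = (norm p powr (q - 1)) powr (q' - 1)"
        using q q1 by (simp add: powr_powr mult.commute)
      also have "\<dots> \<le> (c * norm v) powr (q' - 1)"
        using True q1 by (intro powr_mono2) auto
      finally have "norm p * norm v \<le> (c * norm v) powr (q' - 1) * norm v" by (intro mult_right_mono) auto
      moreover have "0 \<le> norm p powr q / c" using c by auto
      ultimately show ?thesis by linarith
    next
      case False
      then have "norm p * norm v \<le> norm p * (norm p powr (q - 1) / c)"
        using c by (intro mult_left_mono) (auto simp: pos_le_divide_eq mult.commute)
      also have "\<dots> = norm p powr q / c" by (cases "p = 0") (auto simp: powr_diff)
      finally have "norm p * norm v \<le> norm p powr q / c" .
      moreover have "0 \<le> (c * norm v) powr (q' - 1) * norm v" by simp
      ultimately show ?thesis by linarith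
    qed
    finally show "p \<bullet> v - H p \<le> ?B" .
  qed
  show ?thesis
  proof (cases "v = 0")
    case True
    have "0 \<bullet> v - H 0 \<le> legendre H v"
      unfolding legendre_def by (rule cSUP_upper[OF _ bdd]) simp
    then show ?thesis using True growth(2)[of 0] q by simp
  next
    case False
    \<comment> \<open>The solution of \<open>\<rho> powr (q - 1) = norm v / (2 * c)\<close>, that
      is, \<open>c * \<rho> powr q = \<rho> * norm v / 2\<close>.\<close>
    define \<rho> where "\<rho> = (norm v / (2 * c)) powr (q' - 1)"
    define p where "p = (\<rho> / norm v) *\<^sub>R v"
    have \<rho>: "\<rho> > 0" using False c by (simp add: \<rho>_def)
    have np: "norm p = \<rho>" using False \<rho> by (simp add: p_def)
    have "\<rho> powr (q - 1) = norm v / (2 * c)"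
      unfolding \<rho>_def powr_powr using q1 False c by simp
    then have "\<rho> powr q = \<rho> * (norm v / (2 * c))"
      using \<rho> by (simp add: powr_diff field_simps)
    moreover have "p \<bullet> v = \<rho> * norm v"
      by (simp add: p_def dot_square_norm power2_eq_square)
    ultimately have "\<rho> * norm v / 2 - c \<le> p \<bullet> v - H p"
      using growth(2)[of p] c by (simp add: np field_simps)
    also have "\<dots> \<le> legendre H v"
      unfolding legendre_def by (rule cSUP_upper[OF _ bdd]) simp
    also have "\<rho> * norm v / 2 = 1 / (2 * (2 * c) powr (q' - 1)) * norm v powr q'"
      using False c by (simp add: \<rho>_def powr_divide powr_diff)
    finally show ?thesis .
  qed
qed

locale lagrangian =
  fixes H :: "real^'d \<Rightarrow> real" and q q' c\<^sub>1 c\<^sub>2 c\<^sub>3 :: real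
  assumes q: "q > 1" "q' = q / (q - 1)"
    and cpos: "c\<^sub>1 > 0" "c\<^sub>2 > 0" "c\<^sub>3 > 0"
    and lower: "c\<^sub>1 * norm v powr q' - c\<^sub>2 \<le> legendre H v"
    and upper: "legendre H v \<le> c\<^sub>2 * (norm v powr q' + 1)"
    and lip: "\<bar>legendre H v - legendre H w\<bar> \<le> c\<^sub>3 * (1 + norm v powr (q' - 1) + norm w powr (q' - 1)) * norm (v - w)"

text \<open>The lower growth bound is \<open>legendre_lower\<close>; the upper one follows from the
  Lipschitz bound with \<open>w = 0\<close>, since both \<open>norm v\<close> and
  \<open>norm v powr q'\<close> are at most \<open>1 + norm v powr q'\<close>.\<close>

lemma lagrangian_exists:
  fixes H :: "real^'d \<Rightarrow> real"
  assumes q: "q > 1" "q' = q / (q - 1)"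
    and growth: "\<exists>c>1. \<forall>p. norm p powr q / c - c \<le> H p \<and> H p \<le> c * (norm p powr q + 1)"
    and lip: "\<exists>c>0. \<forall>v w. \<bar>legendre H v - legendre H w\<bar> \<le>
           c * (1 + norm v powr (q' - 1) + norm w powr (q' - 1)) * norm (v - w)"
  shows "\<exists>c\<^sub>1 c\<^sub>2 c\<^sub>3. lagrangian H q q' c\<^sub>1 c\<^sub>2 c\<^sub>3"
proof -
  obtain c where c: "c > 1" "\<And>p. norm p powr q / c - c \<le> H p" "\<And>p. H p \<le> c * (norm p powr q + 1)"
    using growth by auto
  obtain c' where c': "c' > 0" "\<And>v w. \<bar>legendre H v - legendre H w\<bar> \<le>
           c' * (1 + norm v powr (q' - 1) + norm w powr (q' - 1)) * norm (v - w)"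
    using lip by auto
  have q1: "q' > 1" using q by (simp add: pos_less_divide_eq)
  define c1 where "c1 = 1 / (2 * (2 * c) powr (q' - 1))"
  define c2 where "c2 = max c (\<bar>legendre H 0\<bar> + 2 * c')"
  have "lagrangian H q q' c1 c2 c'"
  proof
    show "c1 > 0" "c2 > 0" using c by (auto simp: c1_def c2_def)
    show "c1 * norm v powr q' - c2 \<le> legendre H v" for v
      using legendre_lower[OF q c, of v] by (simp add: c1_def c2_def)
    show "legendre H v \<le> c2 * (norm v powr q' + 1)" for v
    proof -
      have *: "norm v powr (q' - 1) * norm v = norm v powr q'" by (cases "v = 0") (auto simp: powr_diff)
      have "norm v \<le> 1 + norm v powr q'"
      proof (cases "norm v \<le> 1")
        case False
        then have "norm v powr 1 \<le> norm v powr q'" using q1 by (intro powr_mono) auto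
        then show ?thesis using False by simp
      qed (simp add: add_increasing2)
      then have "c' * (norm v + norm v powr q') \<le> c' * (2 * (1 + norm v powr q'))"
        using c'(1) by (intro mult_left_mono) auto
      moreover have "legendre H v \<le> \<bar>legendre H 0\<bar> + c' * (norm v + norm v powr q')"
        using c'(2)[of v 0] * by (simp add: algebra_simps)
      moreover have "(\<bar>legendre H 0\<bar> + 2 * c') * (1 + norm v powr q') \<le> c2 * (1 + norm v powr q')"
        by (intro mult_right_mono) (auto simp: c2_def)
      moreover have "0 \<le> \<bar>legendre H 0\<bar> * norm v powr q'" by simp
      ultimately show ?thesis unfolding ring_distribs by linarith
    qed
  qed (use q c' in auto)
  then show ?thesis by blast
qed

section \<open>Energy and action of a single curve\<close>

context lagrangian
begin

lemma q'_gt_1: "q' > 1" using q by (simp add: pos_less_divide_eq)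

lemma conjugate: "1 / q' = 1 - 1 / q" "q' / q = q' - 1"
  unfolding q(2) using q(1) by (auto simp: field_simps)

lemma legendre_continuous: "continuous_on UNIV (legendre H)"
proof -
  have "(legendre H \<longlongrightarrow> legendre H v) (at v)" for v
  proof (rule LIM_zero_cancel, rule Lim_null_comparison)
    let ?g = "\<lambda>w. c\<^sub>3 * (1 + norm w powr (q' - 1) + norm v powr (q' - 1)) * norm (w - v)"
    show "\<forall>\<^sub>F w in at v. norm (legendre H w - legendre H v) \<le> ?g w"
      using lip by (intro always_eventually) auto
    have "continuous_on UNIV ?g"
      using q'_gt_1 by (intro continuous_intros continuous_on_norm_powr) auto
    then have "isCont ?g v" by (simp add: continuous_on_eq_continuous_at)
    then have "(?g \<longlongrightarrow> ?g v) (at v)" by (simp only: isCont_def)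
    then show "(?g \<longlongrightarrow> 0) (at v)" by simp
  qed
  then show ?thesis by (auto simp: continuous_on_def)
qed

lemma legendre_integrable: "W1inf s t \<gamma> v \<Longrightarrow> set_integrable lborel {s..t} (\<lambda>r. legendre H (v r))"
  by (rule W1inf_compose_integrable[OF _ legendre_continuous])

lemma energy_integrable: "W1inf s t \<gamma> v \<Longrightarrow> set_integrable lborel {s..t} (\<lambda>r. norm (v r) powr q')"
  by (rule W1inf_compose_integrable[OF _ continuous_on_norm_powr]) (use q'_gt_1 in auto)

definition energy :: "real \<Rightarrow> real \<Rightarrow> (real \<Rightarrow> real^'d) \<Rightarrow> real" where
  "energy s t v = (LINT r:{s..t}|lborel. norm (v r) powr q')"

definition action :: "(real^'d \<Rightarrow> real^'m) \<Rightarrow> (real \<Rightarrow> real^'m) \<Rightarrow> real \<Rightarrow> real \<Rightarrow>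
    (real \<Rightarrow> real^'d) \<Rightarrow> (real \<Rightarrow> real^'d) \<Rightarrow> real" where
  "action f b s t \<gamma> v = (LINT r:{s..t}|lborel. legendre H (v r)) + path_integral f b s t \<gamma> v"

lemma energy_nonneg: "0 \<le> energy s t v"
  unfolding energy_def by (intro set_integral_nonneg_Icc) auto

lemma energy_mono:
  assumes "W1inf s t \<gamma> v" "s \<le> a" "b \<le> t"
  shows "energy a b v \<le> energy s t v"
  unfolding energy_def using assms energy_integrable by (intro set_integral_mono_Icc) auto

lemma action_combine:
  assumes "f \<in> C1b" "W1inf s t \<gamma> v" "continuous_on {s..t} b" "s \<le> u" "u \<le> t"
  shows "action f b s t \<gamma> v = action f b s u \<gamma> v + action f b u t \<gamma> v"
  unfolding action_def path_integral_combine[OF assms]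
  using set_integral_combine[OF assms(4,5) legendre_integrable[OF assms(2)]] by simp

lemma legendre_integral_bounds:
  assumes "W1inf s t \<gamma> v" "s \<le> t"
  shows "c\<^sub>1 * energy s t v - c\<^sub>2 * (t - s) \<le> (LINT r:{s..t}|lborel. legendre H (v r))"
    and "(LINT r:{s..t}|lborel. legendre H (v r)) \<le> c\<^sub>2 * energy s t v + c\<^sub>2 * (t - s)"
proof -
  note [simp] = legendre_integrable[OF assms(1)] energy_integrable[OF assms(1)]
  have "c\<^sub>1 * energy s t v - c\<^sub>2 * (t - s) = (LINT r:{s..t}|lborel. c\<^sub>1 * norm (v r) powr q' - c\<^sub>2)"
    using assms(2) by (simp add: energy_def set_integral_const_Icc mult.commute)
  also have "\<dots> \<le> (LINT r:{s..t}|lborel. legendre H (v r))"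
    using lower by (intro set_integral_mono) auto
  finally show "c\<^sub>1 * energy s t v - c\<^sub>2 * (t - s) \<le> (LINT r:{s..t}|lborel. legendre H (v r))" .
  have "(LINT r:{s..t}|lborel. legendre H (v r)) \<le> (LINT r:{s..t}|lborel. c\<^sub>2 * norm (v r) powr q' + c\<^sub>2)"
    using upper by (intro set_integral_mono) (auto simp: algebra_simps)
  also have "\<dots> = c\<^sub>2 * energy s t v + c\<^sub>2 * (t - s)"
    using assms(2) by (simp add: energy_def set_integral_const_Icc mult.commute)
  finally show "(LINT r:{s..t}|lborel. legendre H (v r)) \<le> c\<^sub>2 * energy s t v + c\<^sub>2 * (t - s)" .
qed

text \<open>The value \<open>c\<^sub>1 / 2\<close> of the noise coefficient is chosen for this: the
  noise consumes at most half of the coercive term \<open>c\<^sub>1 * energy s t v\<close>, and the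
  other half survives in the lower bound.\<close>

lemma action_bounds:
  assumes nc: "noise_controlled T q' \<beta> (c\<^sub>1 / 2) Y f b" and \<gamma>: "W1inf s t \<gamma> v"
    and I: "0 \<le> s" "s \<le> t" "t \<le> T" "0 < T"
  shows "c\<^sub>1 / 2 * energy s t v - c\<^sub>2 * (t - s) - Y * (t - s) powr \<beta> \<le> action f b s t \<gamma> v"
    and "action f b s t \<gamma> v \<le> (c\<^sub>1 + c\<^sub>2) * energy s t v + c\<^sub>2 * (t - s) + Y * (t - s) powr \<beta>"
proof -
  have "\<bar>path_integral f b s t \<gamma> v\<bar> \<le> Y * (t - s) powr \<beta> + c\<^sub>1 / 2 * sqrt ((t - s) / T) * energy s t v"
    using nc \<gamma> I unfolding noise_controlled_def energy_def by blast
  also have "c\<^sub>1 / 2 * sqrt ((t - s) / T) * energy s t v \<le> c\<^sub>1 / 2 * 1 * energy s t v"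
    using I cpos energy_nonneg by (intro mult_right_mono mult_left_mono) auto
  finally have *: "\<bar>path_integral f b s t \<gamma> v\<bar> \<le> Y * (t - s) powr \<beta> + c\<^sub>1 / 2 * energy s t v" by simp
  note L = legendre_integral_bounds[OF \<gamma> I(2)]
  show "c\<^sub>1 / 2 * energy s t v - c\<^sub>2 * (t - s) - Y * (t - s) powr \<beta> \<le> action f b s t \<gamma> v"
    using * L(1) by (simp add: action_def)
  have "c\<^sub>1 / 2 * energy s t v \<le> c\<^sub>1 * energy s t v"
    using cpos energy_nonneg[of s t v] by (intro mult_right_mono) auto
  then show "action f b s t \<gamma> v \<le> (c\<^sub>1 + c\<^sub>2) * energy s t v + c\<^sub>2 * (t - s) + Y * (t - s) powr \<beta>"
    using * L(2) by (simp add: action_def algebra_simps)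
qed

definition action_values :: "(real^'d \<Rightarrow> real^'m) \<Rightarrow> (real \<Rightarrow> real^'m) \<Rightarrow> real^'d \<Rightarrow> real^'d \<Rightarrow> real \<Rightarrow> real \<Rightarrow> real set" where
  "action_values f b x y s t = {action f b s t \<gamma> v | \<gamma> v. W1inf s t \<gamma> v \<and> \<gamma> s = x \<and> \<gamma> t = y}"

lemma Lfun_eq: "Lfun H f b (x, y, s, t) = Inf (action_values f b x y s t)"
  by (simp add: Lfun_def action_values_def action_def)

lemma straight_line:
  fixes x y :: "real^'d"
  assumes "s < t"
  shows "\<exists>\<gamma>. W1inf s t \<gamma> (\<lambda>_. (y - x) /\<^sub>R (t - s)) \<and> \<gamma> s = x \<and> \<gamma> t = y"
proof (intro exI conjI)
  let ?v = "\<lambda>_::real. (y - x) /\<^sub>R (t - s)"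
  let ?\<gamma> = "\<lambda>r. x + (LINT u:{s..r}|lborel. ?v u)"
  show W: "W1inf s t ?\<gamma> ?v"
    by (rule W1inf_primitive[where K = "norm ((y - x) /\<^sub>R (t - s))"]) auto
  show "?\<gamma> s = x" by simp
  have "(LINT u:{s..t}|lborel. ?v u) = (t - s) *\<^sub>R ((y - x) /\<^sub>R (t - s))"
    using assms by (simp add: set_lebesgue_integral_def)
  then show "?\<gamma> t = y" using assms by simp
qed

end

section \<open>Hoelder estimate for the value function\<close>

context lagrangian
begin

text \<open>A real \<open>Inf\<close> behaves as intended only on nonempty sets bounded below. The
  lower bound \<open>C\<close> stays a hypothesis in this group of lemmas because it depends on the
  path; it comes from \<open>action_bounds\<close> in the Hoelder estimate and from a cruder bound
  in the measurability part.\<close>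

lemma action_values_bdd_below:
  assumes "\<And>\<gamma> v. W1inf s t \<gamma> v \<Longrightarrow> C \<le> action f b s t \<gamma> v"
  shows "bdd_below (action_values f b x y s t)"
  by (rule bdd_belowI[of _ C]) (use assms in \<open>auto simp: action_values_def\<close>)

lemma Lfun_le_action:
  assumes "\<And>\<gamma> v. W1inf s t \<gamma> v \<Longrightarrow> C \<le> action f b s t \<gamma> v" and "W1inf s t \<gamma> v" "\<gamma> s = x" "\<gamma> t = y"
  shows "Lfun H f b (x, y, s, t) \<le> action f b s t \<gamma> v"
  unfolding Lfun_eq
  by (rule cInf_lower[OF _ action_values_bdd_below[OF assms(1)]])
     (use assms in \<open>auto simp: action_values_def\<close>)

lemma action_values_nonempty:
  assumes "s < t"
  shows "action_values f b x y s t \<noteq> {}"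
proof -
  obtain \<gamma> where \<gamma>: "W1inf s t \<gamma> (\<lambda>_. (y - x) /\<^sub>R (t - s))" "\<gamma> s = x" "\<gamma> t = y"
    using straight_line[OF assms, where x = x and y = y] by (elim exE conjE)
  have "action f b s t \<gamma> (\<lambda>_. (y - x) /\<^sub>R (t - s)) \<in> action_values f b x y s t"
    unfolding action_values_def 
    by (intro CollectI exI[of _ \<gamma>] exI[of _ "\<lambda>_. (y - x) /\<^sub>R (t - s)"] conjI refl \<gamma>)
  then show ?thesis by (metis empty_iff)
qed

lemma Lfun_ge:
  assumes "\<And>\<gamma> v. W1inf s t \<gamma> v \<Longrightarrow> C \<le> action f b s t \<gamma> v" and "s < t"
  shows "C \<le> Lfun H f b (x, y, s, t)"
proof -
  have "action_values f b x y s t \<noteq> {}"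
    by (rule action_values_nonempty) fact
  then show ?thesis
    unfolding Lfun_eq using assms(1) by (intro cInf_greatest) (auto simp: action_values_def)
qed

lemma Lfun_near_minimizer:
  assumes "\<And>\<gamma> v. W1inf s t \<gamma> v \<Longrightarrow> C \<le> action f b s t \<gamma> v" and "s < t" "e > 0"
  shows "\<exists>\<gamma> v. W1inf s t \<gamma> v \<and> \<gamma> s = x \<and> \<gamma> t = y \<and> action f b s t \<gamma> v < Lfun H f b (x, y, s, t) + e"
proof -
  have "action_values f b x y s t \<noteq> {}"
    by (rule action_values_nonempty) fact
  from cInf_lessD[OF this, of "Lfun H f b (x, y, s, t) + e"] assms(3) show ?thesis
    unfolding Lfun_eq[symmetric] by (auto simp: action_values_def)
qed

text \<open>Hoelder's inequality in additive form. The speed is at most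
  \<open>\<mu> + \<mu> powr (1 - q') * norm (v r) powr q'\<close> for any threshold
  \<open>\<mu> > 0\<close>, and \<open>\<mu> = \<kappa> powr (- 1 / q')\<close> gives both terms the
  factor \<open>\<kappa> powr (1 / q)\<close>. This is what turns the space exponent
  \<open>\<theta>\<close> into the time exponent \<open>\<theta> / q\<close>.\<close>

lemma displacement_bound:
  assumes \<gamma>: "W1inf s t \<gamma> v" and I: "s \<le> a" "a \<le> b" "b \<le> t" and \<kappa>: "b - a \<le> \<kappa>"
  shows "norm (\<gamma> b - \<gamma> a) \<le> \<kappa> powr (1 / q) * (1 + energy s t v)"
proof (cases "a = b")
  case False
  with I \<kappa> have \<kappa>0: "\<kappa> > 0" by linarith
  define \<mu> where "\<mu> = \<kappa> powr (- 1 / q')"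
  have \<mu>: "\<mu> > 0" using \<kappa>0 by (simp add: \<mu>_def)
  have sub: "W1inf a b \<gamma> v" by (rule W1inf_subinterval[OF \<gamma> I])
  have ptw: "n \<le> \<mu> + \<mu> powr (1 - q') * n powr q'" if "0 \<le> n" for n
  proof (cases "n \<le> \<mu>")
    case False
    then have "\<mu> powr (q' - 1) \<le> n powr (q' - 1)" using \<mu> q'_gt_1 by (intro powr_mono2) auto
    then have "\<mu> powr (1 - q') * \<mu> powr (q' - 1) \<le> \<mu> powr (1 - q') * n powr (q' - 1)"
      by (intro mult_left_mono) auto
    then have "1 \<le> \<mu> powr (1 - q') * n powr (q' - 1)"
      using \<mu> by (simp add: powr_add[symmetric])
    then have "n * 1 \<le> n * (\<mu> powr (1 - q') * n powr (q' - 1))" using that by (intro mult_left_mono) auto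
    also have "\<dots> = \<mu> powr (1 - q') * n powr q'"
      using False \<mu> by (simp add: powr_diff)
    finally show ?thesis using \<mu> by simp
  qed (simp add: add_increasing2)
  have "norm (\<gamma> b - \<gamma> a) \<le> (LINT r:{a..b}|lborel. norm (v r))"
    by (rule W1inf_norm_diff[OF \<gamma> I])
  also have "\<dots> \<le> (LINT r:{a..b}|lborel. \<mu> + \<mu> powr (1 - q') * norm (v r) powr q')"
    using ptw energy_integrable[OF sub]
    by (intro set_integral_mono W1inf_compose_integrable[OF sub, of norm]) (auto intro: continuous_intros)
  also have "\<dots> = (b - a) * \<mu> + \<mu> powr (1 - q') * energy a b v"
    using energy_integrable[OF sub] I by (simp add: energy_def set_integral_const_Icc)
  also have "\<dots> \<le> \<kappa> * \<mu> + \<mu> powr (1 - q') * energy s t v"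
    using \<kappa> \<mu> energy_mono[OF \<gamma>] I by (intro add_mono mult_right_mono mult_left_mono) auto
  also have "\<kappa> * \<mu> = \<kappa> powr (1 / q)"
  proof -
    have "\<kappa> * \<mu> = \<kappa> powr 1 * \<kappa> powr (- 1 / q')" using \<kappa>0 by (simp add: \<mu>_def)
    also have "\<dots> = \<kappa> powr (1 + (- 1 / q'))" by (simp only: powr_add)
    also have "1 + (- 1 / q') = 1 / q" using conjugate(1) by simp
    finally show ?thesis .
  qed
  also have "\<mu> powr (1 - q') = \<kappa> powr (1 / q)"
  proof -
    have "(- 1 / q') * (1 - q') = 1 / q" using conjugate(1) q'_gt_1 by (simp add: field_simps)
    then show ?thesis by (simp only: \<mu>_def powr_powr)
  qed
  finally show ?thesis by (simp add: algebra_simps)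
qed (use energy_nonneg[of s t v] in simp)

lemma shifted_velocity_increment:
  assumes \<gamma>: "W1inf a b \<gamma> v" and \<eta>: "W1inf a b \<eta> u" and "a \<le> b"
    and u: "AE r in lborel. r \<in> {a..b} \<longrightarrow> u r = v r + w"
  shows "\<eta> b - \<eta> a = \<gamma> b - \<gamma> a + (b - a) *\<^sub>R w"
proof -
  have [measurable]: "u \<in> borel_measurable borel" "v \<in> borel_measurable borel"
    using W1inf_measurable[OF \<gamma>] W1inf_measurable[OF \<eta>] by auto
  have "(LINT r:{a..b}|lborel. u r) = (LINT r:{a..b}|lborel. v r + w)"
    by (intro set_lebesgue_integral_cong_AE u) auto
  also have "\<dots> = (LINT r:{a..b}|lborel. v r) + (LINT r:{a..b}|lborel. w)"
    by (rule set_integral_add(2)[OF W1inf_integrable[OF \<gamma>]]) simp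
  also have "(LINT r:{a..b}|lborel. w) = (b - a) *\<^sub>R w"
    using \<open>a \<le> b\<close> by (simp add: set_lebesgue_integral_def)
  finally show ?thesis
    using W1inf_diff[OF \<gamma>, of a b] W1inf_diff[OF \<eta>, of a b] \<open>a \<le> b\<close> by simp
qed

lemma energy_shift:
  assumes \<gamma>: "W1inf a b \<gamma> v" and \<eta>: "W1inf a b \<eta> u" and "a \<le> b"
    and u: "AE r in lborel. r \<in> {a..b} \<longrightarrow> u r = v r + w"
  shows "energy a b u \<le> 2 powr q' * (energy a b v + (b - a) * norm w powr q')"
proof -
  have "energy a b u \<le> (LINT r:{a..b}|lborel. 2 powr q' * (norm (v r) powr q' + norm w powr q'))"
    unfolding energy_def
  proof (rule set_integral_mono_AE)
    show "AE r\<in>{a..b} in lborel. norm (u r) powr q' \<le> 2 powr q' * (norm (v r) powr q' + norm w powr q')"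
      using u
    proof eventually_elim
      case (elim r)
      have "norm (v r + w) powr q' \<le> (norm (v r) + norm w) powr q'"
        using q'_gt_1 by (intro powr_mono2 norm_triangle_ineq) auto
      also have "\<dots> \<le> 2 powr q' * (norm (v r) powr q' + norm w powr q')"
        using q'_gt_1 by (intro powr_add_le) auto
      finally show ?case using elim by auto
    qed
  qed (use energy_integrable[OF \<gamma>] energy_integrable[OF \<eta>] in auto)
  also have "\<dots> = 2 powr q' * (energy a b v + (b - a) * norm w powr q')"
    using energy_integrable[OF \<gamma>] \<open>a \<le> b\<close> by (simp add: energy_def set_integral_const_Icc)
  finally show ?thesis .
qed

text \<open>The Lipschitz bound of the Lagrangian is integrated over the window. All main terms are
  powers of \<open>D * len powr (- 1 / q)\<close>, the quantity to be balanced against the noise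
  when the window length is chosen.\<close>

lemma legendre_shift:
  assumes \<gamma>: "W1inf a b \<gamma> v" and \<eta>: "W1inf a b \<eta> u" and len: "b - a = len" "len > 0"
    and u: "AE r in lborel. r \<in> {a..b} \<longrightarrow> u r = v r + w"
    and w: "norm w \<le> D / len"
  shows "(LINT r:{a..b}|lborel. legendre H (u r)) - (LINT r:{a..b}|lborel. legendre H (v r)) \<le>
     c\<^sub>3 * (1 + 2 powr (q' - 1)) *
       (D + D * len powr (- 1 / q) * (1 + energy a b v) + (D * len powr (- 1 / q)) powr q')"
proof -
  define \<omega> where "\<omega> = D / len"
  define \<rho> where "\<rho> = q' - 1"
  define C where "C = c\<^sub>3 * (1 + 2 powr \<rho>)"
  define B where "B = len powr (- 1 / q) + 1 + \<omega> powr \<rho>"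
  have C: "C \<ge> 0" using cpos by (simp add: C_def)
  have \<rho>: "\<rho> > 0" using q'_gt_1 by (simp add: \<rho>_def)
  have \<omega>: "norm w \<le> \<omega>" "0 \<le> \<omega>" using w by (auto simp: \<omega>_def intro: order_trans[OF norm_ge_zero])
  have D1: "D = \<omega> * len" using len by (simp add: \<omega>_def)
  moreover have "0 \<le> D" unfolding D1 using len \<omega> by (intro mult_nonneg_nonneg) auto
  ultimately have D: "D = \<omega> * len" "0 \<le> D" by auto
  \<comment> \<open>The power \<open>q' - 1\<close> of the speed is not the one the energy controls;
    splitting at \<open>n = len powr (- 1 / q')\<close> trades it for the energy density. After
    integration over the window both terms carry \<open>len powr (1 / q')\<close>.\<close>
  have ptw: "n powr \<rho> \<le> len powr (1 / q') * n powr q' + len powr (- 1 / q)" if "0 \<le> n" for n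
  proof (cases "n \<le> len powr (- 1 / q')")
    case True
    then have "n powr \<rho> \<le> (len powr (- 1 / q')) powr \<rho>" using that \<rho> by (intro powr_mono2) auto
    also have "(- 1 / q') * \<rho> = - 1 / q"
      using conjugate q'_gt_1 by (simp add: \<rho>_def field_simps)
    then have "(len powr (- 1 / q')) powr \<rho> = len powr (- 1 / q)" by (simp only: powr_powr)
    finally show ?thesis by (simp add: add_increasing)
  next
    case False
    then have n: "n > 0" using that by (smt (verit) powr_ge_zero)
    have "len powr (1 / q') * len powr (- 1 / q') \<le> len powr (1 / q') * n"
      using False by (intro mult_left_mono) auto
    then have "1 \<le> len powr (1 / q') * n" using len by (simp add: powr_add[symmetric])
    then have "1 * n powr \<rho> \<le> len powr (1 / q') * n * n powr \<rho>" by (intro mult_right_mono) auto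
    also have "\<dots> = len powr (1 / q') * n powr q'" using n by (simp add: \<rho>_def powr_diff)
    finally show ?thesis by (simp add: add_increasing2)
  qed
  have Lint: "set_integrable lborel {a..b} (\<lambda>r. legendre H (u r))" "set_integrable lborel {a..b} (\<lambda>r. legendre H (v r))"
    using legendre_integrable \<gamma> \<eta> by auto
  have "(LINT r:{a..b}|lborel. legendre H (u r)) - (LINT r:{a..b}|lborel. legendre H (v r))
      = (LINT r:{a..b}|lborel. legendre H (u r) - legendre H (v r))"
    using Lint by simp
  also have "\<dots> \<le> (LINT r:{a..b}|lborel. C * \<omega> * (len powr (1 / q') * norm (v r) powr q' + B))"
  proof (rule set_integral_mono_AE)
    show "AE r\<in>{a..b} in lborel. legendre H (u r) - legendre H (v r)
        \<le> C * \<omega> * (len powr (1 / q') * norm (v r) powr q' + B)"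
      using u
    proof eventually_elim
      case (elim r)
      have "norm (v r + w) powr \<rho> \<le> (norm (v r) + \<omega>) powr \<rho>"
        using \<rho> \<omega> by (intro powr_mono2 order_trans[OF norm_triangle_ineq]) auto
      also have "\<dots> \<le> 2 powr \<rho> * (norm (v r) powr \<rho> + \<omega> powr \<rho>)"
        using \<rho> \<omega> by (intro powr_add_le) auto
      finally have "1 + norm (v r + w) powr \<rho> + norm (v r) powr \<rho> \<le>
          1 + 2 powr \<rho> * (norm (v r) powr \<rho> + \<omega> powr \<rho>) + norm (v r) powr \<rho>" by simp
      also have "\<dots> \<le> (1 + 2 powr \<rho>) * (1 + norm (v r) powr \<rho> + \<omega> powr \<rho>)"
        by (simp add: algebra_simps)
      also have "\<dots> \<le> (1 + 2 powr \<rho>) * (len powr (1 / q') * norm (v r) powr q' + B)"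
        using ptw[of "norm (v r)"] by (intro mult_left_mono) (auto simp: B_def)
      finally have le: "1 + norm (v r + w) powr \<rho> + norm (v r) powr \<rho> \<le>
          (1 + 2 powr \<rho>) * (len powr (1 / q') * norm (v r) powr q' + B)" .
      have "legendre H (v r + w) - legendre H (v r) \<le>
          c\<^sub>3 * (1 + norm (v r + w) powr \<rho> + norm (v r) powr \<rho>) * norm w"
        using lip[of "v r + w" "v r"] by (simp add: \<rho>_def)
      also have "\<dots> \<le> c\<^sub>3 * ((1 + 2 powr \<rho>) * (len powr (1 / q') * norm (v r) powr q' + B)) * \<omega>"
        using le \<omega> cpos by (intro mult_mono mult_left_mono) (auto simp: B_def)
      finally show ?case using elim by (auto simp: C_def mult_ac)
    qed
  qed (use Lint energy_integrable[OF \<gamma>] in auto)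
  also have "\<dots> = C * (\<omega> * (len powr (1 / q') * energy a b v + len * B))"
    using energy_integrable[OF \<gamma>] len by (simp add: energy_def set_integral_const_Icc)
  also have "\<omega> * (len powr (1 / q') * energy a b v + len * B) =
      D + D * len powr (- 1 / q) * (1 + energy a b v) + (D * len powr (- 1 / q)) powr q'"
  proof -
    have "len powr (1 / q') = len * len powr (- 1 / q)"
    proof -
      have "len powr (1 / q') = len powr (1 + (- 1 / q))" using conjugate(1) by simp
      also have "\<dots> = len powr 1 * len powr (- 1 / q)" by (simp only: powr_add)
      finally show ?thesis using len by simp
    qed
    then have "\<omega> * (len powr (1 / q') * energy a b v) = D * len powr (- 1 / q) * energy a b v"
      by (simp add: D mult_ac)
    moreover have "\<omega> * (len * \<omega> powr \<rho>) = (D * len powr (- 1 / q)) powr q'"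
    proof -
      have "(D * len powr (- 1 / q)) powr q' = \<omega> powr q' * (len powr q' * len powr (- 1 / q * q'))"
        using D len \<omega> by (simp add: powr_mult powr_powr)
      also have "len powr q' * len powr (- 1 / q * q') = len powr (q' + (- 1 / q * q'))"
        by (simp only: powr_add)
      also have "q' + (- 1 / q * q') = 1" using conjugate(2) by simp
      also have "\<omega> powr q' = \<omega> * \<omega> powr \<rho>"
        using \<omega> q'_gt_1 by (cases "\<omega> = 0") (auto simp: \<rho>_def powr_diff)
      finally show ?thesis using len by simp
    qed
    ultimately show ?thesis by (simp add: B_def D algebra_simps)
  qed
  finally show ?thesis by (simp add: C_def \<rho>_def mult.assoc)
qed


text \<open>The window length makes three exponents at least \<open>\<theta>\<close>:
  \<open>a * \<beta>\<close> for the noise constant, \<open>a / 2\<close> for its energy factor, and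
  \<open>1 - a / q\<close> for the Lagrangian. As \<open>D \<le> 1\<close>, all costs are then
  bounded by \<open>D powr \<theta>\<close>. The constant \<open>G\<close> is uniform in
  \<open>Y\<close>, \<open>f\<close> and the path.\<close>

lemma action_shift:
  fixes T \<tau> \<theta> \<beta> :: real
  assumes T: "0 < \<tau>" "\<tau> < T" and \<theta>: "0 < \<theta>" "\<theta> < q / (2 + q)"
    and \<beta>: "0 < \<beta>" "\<beta> \<le> 1/2" "\<theta> \<le> 2 * q / (2 + q) * \<beta>"
  shows "\<exists>G\<ge>0. \<forall>Y (f :: real^'d \<Rightarrow> real^'m) b \<alpha> \<omega> \<gamma> v \<eta> u w D.
    1 \<le> Y \<and> noise_controlled T q' \<beta> (c\<^sub>1 / 2) Y f b \<and> 0 \<le> \<alpha> \<and> \<omega> \<le> T \<and> 0 < D \<and> D \<le> 1 \<and>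
    \<omega> - \<alpha> = \<tau> / 4 * D powr (2 * q / (2 + q)) \<and> W1inf \<alpha> \<omega> \<gamma> v \<and> W1inf \<alpha> \<omega> \<eta> u \<and>
    (AE r in lborel. r \<in> {\<alpha>..\<omega>} \<longrightarrow> u r = v r + w) \<and> norm w \<le> D / (\<omega> - \<alpha>) \<longrightarrow>
    action f b \<alpha> \<omega> \<eta> u - action f b \<alpha> \<omega> \<gamma> v \<le> G * Y * (1 + energy \<alpha> \<omega> v) * D powr \<theta>"
proof -
  define a where "a = 2 * q / (2 + q)"
  define E where "E = (\<tau> / 4) powr (- 1 / q)"
  define C where "C = c\<^sub>3 * (1 + 2 powr (q' - 1))"
  define G1 where "G1 = C * (1 + E + E powr q')"
  define G2 where "G2 = 2 * T powr \<beta> + c\<^sub>1 / 2 * (1 + 2 powr q' * (1 + E powr q'))"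
  have nonneg: "0 \<le> C" "0 \<le> E" "0 \<le> E powr q'" "0 \<le> G1" "0 \<le> G2"
    using cpos T by (auto simp: C_def E_def G1_def G2_def)
  have "a / q = 2 / (2 + q)" using q(1) by (simp add: a_def)
  then have aq: "1 - a / q = q / (2 + q)" using q(1) by (simp add: field_simps)
  have a: "0 < a" "\<theta> \<le> a * \<beta>" "\<theta> \<le> a / 2" "\<theta> \<le> 1 - a / q"
  proof -
    show "0 < a" using q by (simp add: a_def)
    show 1: "\<theta> \<le> a * \<beta>" using \<beta> by (simp add: a_def)
    have "a * \<beta> \<le> a * (1/2)" using \<open>0 < a\<close> \<beta> by (intro mult_left_mono) auto
    with 1 show "\<theta> \<le> a / 2" by simp
    show "\<theta> \<le> 1 - a / q" using \<theta> by (simp add: aq)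
  qed
  show ?thesis
  proof (intro exI[of _ "G1 + G2"] conjI allI impI, goal_cases)
    case 1
    show ?case using nonneg by simp
  next
    case H: (2 Y f b \<alpha> \<omega> \<gamma> v \<eta> u w D)
    define len where "len = \<omega> - \<alpha>"
    have wD: "norm w \<le> D / len" unfolding len_def using H by blast
    define N where "N = energy \<alpha> \<omega> v"
    define e where "e = D * len powr (- 1 / q)"
    have N: "0 \<le> N" by (simp add: N_def energy_nonneg)
    have Y: "1 \<le> Y" and D: "0 < D" "D \<le> 1" using H by auto
    have len: "len = \<tau> / 4 * D powr a" using H by (simp add: len_def a_def)
    moreover have "0 < \<tau> / 4 * D powr a" using T D by simp
    ultimately have len: "len = \<tau> / 4 * D powr a" "0 < len" by auto
    have D\<theta>: "D powr p \<le> D powr \<theta>" if "\<theta> \<le> p" for p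
      using that D by (intro powr_mono') auto
    have e_eq: "e = E * D powr (1 - a / q)"
    proof -
      have "len powr (- 1 / q) = E * D powr (a * (- 1 / q))"
        using D T by (simp only: len(1) E_def powr_mult powr_powr)
      moreover have "D * D powr (a * (- 1 / q)) = D powr (1 + a * (- 1 / q))"
        using D by (simp only: powr_add powr_one less_imp_le)
      moreover have "1 + a * (- 1 / q) = 1 - a / q" by simp
      ultimately show ?thesis unfolding e_def by (metis mult.left_commute)
    qed
    then have e: "e \<le> E * D powr \<theta>" "0 \<le> e" using D\<theta>[OF a(4)] nonneg by (auto intro: mult_left_mono)
    have eq': "e powr q' \<le> E powr q' * D powr \<theta>"
    proof -
      have "e powr q' = E powr q' * D powr ((1 - a / q) * q')"
        using nonneg D by (simp add: e_eq powr_mult powr_powr)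
      moreover have "\<theta> * 1 \<le> (1 - a / q) * q'" using a q'_gt_1 \<theta> by (intro mult_mono) auto
      ultimately show ?thesis using D\<theta>[of "(1 - a / q) * q'"] nonneg by (auto intro: mult_left_mono)
    qed
    have Dth: "D powr \<theta> \<le> 1" using D \<theta> by (simp add: powr_le_one_le powr_mono2[of \<theta> D 1, simplified])
    \<comment> \<open>The energy of the correction itself, \<open>len * (D / len) powr q'\<close>,
      equals \<open>e powr q'\<close> and stays bounded, so the corrected piece has energy at most a
      multiple of \<open>1 + N\<close>.\<close>
    have wq: "len * norm w powr q' \<le> E powr q'"
    proof -
      have "norm w powr q' \<le> (D / len) powr q'" using wD q'_gt_1 by (intro powr_mono2) auto
      then have "len * norm w powr q' \<le> len * (D / len) powr q'" using len(2) by (intro mult_left_mono) auto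
      also have "\<dots> = D powr q' * (len powr 1 * len powr (- q'))"
        using len(2) D by (simp add: powr_divide powr_minus field_simps)
      also have "len powr 1 * len powr (- q') = len powr (- 1 / q * q')"
      proof -
        have "1 + (- q') = - 1 / q * q'" using conjugate(2) by simp
        then show ?thesis by (simp only: powr_add[symmetric])
      qed
      also have "D powr q' * len powr (- 1 / q * q') = e powr q'"
        using D len(2) by (simp add: e_def powr_mult powr_powr)
      also have "\<dots> \<le> E powr q' * 1"
        using eq' Dth nonneg by (meson mult_left_mono order_trans)
      finally show ?thesis by simp
    qed
    have I: "0 \<le> \<alpha>" "\<alpha> \<le> \<omega>" "\<omega> \<le> T" using H len(2) by (auto simp: len_def)
    have \<gamma>: "W1inf \<alpha> \<omega> \<gamma> v" and \<eta>: "W1inf \<alpha> \<omega> \<eta> u"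
      and u: "AE r in lborel. r \<in> {\<alpha>..\<omega>} \<longrightarrow> u r = v r + w" using H by auto
    have "energy \<alpha> \<omega> u \<le> 2 powr q' * (N + len * norm w powr q')"
      using energy_shift[OF \<gamma> \<eta> I(2) u] by (simp add: N_def len_def)
    also have "\<dots> \<le> 2 powr q' * (N + E powr q')" using wq by (intro mult_left_mono add_left_mono) auto
    also have "\<dots> \<le> 2 powr q' * ((1 + E powr q') * (1 + N))"
      using N nonneg by (intro mult_left_mono) (auto simp: algebra_simps)
    finally have Nu: "energy \<alpha> \<omega> u \<le> 2 powr q' * (1 + E powr q') * (1 + N)" by (simp add: mult.assoc)
    have len_\<beta>: "len powr \<beta> \<le> T powr \<beta> * D powr \<theta>"
    proof -
      have "len powr \<beta> \<le> (T * D powr a) powr \<beta>"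
        unfolding len(1) using T D \<beta> by (intro powr_mono2 mult_right_mono) auto
      also have "\<dots> = T powr \<beta> * D powr (a * \<beta>)" using T D by (simp add: powr_mult powr_powr)
      also have "\<dots> \<le> T powr \<beta> * D powr \<theta>" using D\<theta>[OF a(2)] by (intro mult_left_mono) auto
      finally show ?thesis .
    qed
    have sqrt_len: "sqrt (len / T) \<le> D powr \<theta>"
    proof -
      have "len / T \<le> D powr a" unfolding len(1) using T mult_right_mono[of "\<tau> / 4" T "D powr a"]
        by (simp add: divide_le_eq mult_ac)
      then have "sqrt (len / T) \<le> sqrt (D powr a)" by (rule real_sqrt_le_mono)
      also have "\<dots> = D powr (a / 2)" using D by (simp add: powr_half_sqrt[symmetric] powr_powr)
      also have "\<dots> \<le> D powr \<theta>" by (rule D\<theta>[OF a(3)])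
      finally show ?thesis .
    qed
    have PI: "\<bar>path_integral f b \<alpha> \<omega> \<zeta> x\<bar> \<le> Y * (T powr \<beta> * D powr \<theta>) + c\<^sub>1 / 2 * D powr \<theta> * energy \<alpha> \<omega> x"
      if "W1inf \<alpha> \<omega> \<zeta> x" for \<zeta> x
    proof -
      have "\<bar>path_integral f b \<alpha> \<omega> \<zeta> x\<bar> \<le> Y * len powr \<beta> + c\<^sub>1 / 2 * sqrt (len / T) * energy \<alpha> \<omega> x"
        using H that I unfolding noise_controlled_def energy_def len_def by blast
      also have "\<dots> \<le> Y * (T powr \<beta> * D powr \<theta>) + c\<^sub>1 / 2 * D powr \<theta> * energy \<alpha> \<omega> x"
        using len_\<beta> sqrt_len Y cpos energy_nonneg
        by (intro add_mono mult_left_mono mult_right_mono) auto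
      finally show ?thesis .
    qed
    have "(LINT r:{\<alpha>..\<omega>}|lborel. legendre H (u r)) - (LINT r:{\<alpha>..\<omega>}|lborel. legendre H (v r)) \<le>
        C * (D + e * (1 + N) + e powr q')"
      using legendre_shift[OF \<gamma> \<eta> len_def[symmetric] len(2) u wD]
      by (simp only: C_def e_def N_def)
    also have "\<dots> \<le> C * (D powr \<theta> * (1 + N) + E * D powr \<theta> * (1 + N) + E powr q' * D powr \<theta> * (1 + N))"
    proof -
      have "\<theta> \<le> 1" using a(1,4) q(1) divide_pos_pos[of a q] by linarith
      then have "D \<le> D powr \<theta>" using D\<theta>[of 1] D by simp
      also have "\<dots> \<le> D powr \<theta> * (1 + N)" using N by (simp add: mult_left_mono algebra_simps)
      finally have "D \<le> D powr \<theta> * (1 + N)" .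
      moreover have "e powr q' \<le> E powr q' * D powr \<theta> * (1 + N)"
        using eq' N mult_left_mono[of 1 "1 + N" "E powr q' * D powr \<theta>"] nonneg by simp
      moreover have "e * (1 + N) \<le> E * D powr \<theta> * (1 + N)" using e N by (intro mult_right_mono) auto
      ultimately show ?thesis using nonneg by (intro mult_left_mono add_mono) auto
    qed
    also have "\<dots> = G1 * ((1 + N) * D powr \<theta>)" by (simp add: G1_def algebra_simps)
    also have "\<dots> \<le> G1 * (Y * ((1 + N) * D powr \<theta>))"
      using Y N nonneg mult_right_mono[of 1 Y "(1 + N) * D powr \<theta>"] by (intro mult_left_mono) auto
    finally have Ldiff: "(LINT r:{\<alpha>..\<omega>}|lborel. legendre H (u r)) - (LINT r:{\<alpha>..\<omega>}|lborel. legendre H (v r))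
        \<le> G1 * (Y * ((1 + N) * D powr \<theta>))" .
    have "path_integral f b \<alpha> \<omega> \<eta> u - path_integral f b \<alpha> \<omega> \<gamma> v \<le>
        2 * (Y * (T powr \<beta> * D powr \<theta>)) + c\<^sub>1 / 2 * D powr \<theta> * (N + energy \<alpha> \<omega> u)"
      using PI[OF \<gamma>] PI[OF \<eta>] by (simp add: N_def algebra_simps)
    also have "\<dots> \<le> 2 * (Y * (T powr \<beta> * D powr \<theta>)) * (1 + N) +
        c\<^sub>1 / 2 * D powr \<theta> * ((1 + 2 powr q' * (1 + E powr q')) * (1 + N)) * Y"
    proof (rule add_mono)
      show "2 * (Y * (T powr \<beta> * D powr \<theta>)) \<le> 2 * (Y * (T powr \<beta> * D powr \<theta>)) * (1 + N)"
        using N Y mult_left_mono[of 1 "1 + N" "2 * (Y * (T powr \<beta> * D powr \<theta>))"] by simp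
      have "c\<^sub>1 / 2 * D powr \<theta> * (N + energy \<alpha> \<omega> u) \<le> c\<^sub>1 / 2 * D powr \<theta> * ((1 + 2 powr q' * (1 + E powr q')) * (1 + N))"
        using Nu N cpos by (intro mult_left_mono) (auto simp: algebra_simps)
      also have "\<dots> \<le> c\<^sub>1 / 2 * D powr \<theta> * ((1 + 2 powr q' * (1 + E powr q')) * (1 + N)) * Y"
      proof -
        have "0 \<le> c\<^sub>1 / 2 * D powr \<theta> * ((1 + 2 powr q' * (1 + E powr q')) * (1 + N))"
          using cpos N nonneg by (intro mult_nonneg_nonneg add_nonneg_nonneg) auto
        from mult_left_mono[OF Y this] show ?thesis by simp
      qed
      finally show "c\<^sub>1 / 2 * D powr \<theta> * (N + energy \<alpha> \<omega> u) \<le> c\<^sub>1 / 2 * D powr \<theta> * ((1 + 2 powr q' * (1 + E powr q')) * (1 + N)) * Y" .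
    qed
    also have "\<dots> = G2 * (Y * ((1 + N) * D powr \<theta>))" by (simp add: G2_def algebra_simps)
    finally show ?case
      using Ldiff unfolding action_def N_def[symmetric] by (simp add: algebra_simps)
  qed
qed


text \<open>The competitor rests at \<open>x\<^sub>1\<close> and \<open>y\<^sub>1\<close> outside the common time interval, follows \<open>\<gamma>\<close> in
  its interior, and is joined to it by affine corrections on the two windows of length \<open>len\<close>.\<close>

lemma competitor:
  fixes f :: "real^'d \<Rightarrow> real^'m" and \<gamma> :: "real \<Rightarrow> real^'d"
  assumes nc: "noise_controlled T q' \<beta> (c\<^sub>1 / 2) Y f b" and f: "f \<in> C1b" and b: "continuous_on {0..T} b"
    and Y: "0 \<le> Y" and \<beta>: "0 \<le> \<beta>"
    and shift: "\<forall>\<alpha> \<omega> \<gamma> v \<eta> u w. 0 \<le> \<alpha> \<and> \<omega> \<le> T \<and> \<omega> - \<alpha> = len \<and> W1inf \<alpha> \<omega> \<gamma> v \<and> W1inf \<alpha> \<omega> \<eta> u \<and>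
        (AE r in lborel. r \<in> {\<alpha>..\<omega>} \<longrightarrow> u r = v r + w) \<and> norm w \<le> D / len \<longrightarrow>
        action f b \<alpha> \<omega> \<eta> u - action f b \<alpha> \<omega> \<gamma> v \<le> B * (1 + energy \<alpha> \<omega> v)"
    and B: "0 \<le> B"
    and I: "0 \<le> s" "t \<le> T" "0 \<le> s\<^sub>1" "t\<^sub>1 \<le> T" "0 < T"
    and \<gamma>: "W1inf s t \<gamma> v"
    and \<alpha>: "\<alpha> = max s s\<^sub>1" and \<omega>: "\<omega> = min t t\<^sub>1" and len: "0 < len" "2 * len \<le> \<omega> - \<alpha>"
    and D: "norm (\<gamma> \<alpha> - x\<^sub>1) \<le> D" "norm (y\<^sub>1 - \<gamma> \<omega>) \<le> D"
    and \<kappa>: "\<bar>s - s\<^sub>1\<bar> \<le> \<kappa>" "\<bar>t - t\<^sub>1\<bar> \<le> \<kappa>"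
  shows "\<exists>\<eta> u. W1inf s\<^sub>1 t\<^sub>1 \<eta> u \<and> \<eta> s\<^sub>1 = x\<^sub>1 \<and> \<eta> t\<^sub>1 = y\<^sub>1 \<and>
     action f b s\<^sub>1 t\<^sub>1 \<eta> u \<le> action f b s t \<gamma> v + 4 * (c\<^sub>2 * \<kappa> + Y * \<kappa> powr \<beta>) + 2 * (B * (1 + energy s t v))"
proof -
  define w1 where "w1 = (\<gamma> \<alpha> - x\<^sub>1) /\<^sub>R len"
  define w2 where "w2 = (y\<^sub>1 - \<gamma> \<omega>) /\<^sub>R len"
  define a where "a = \<alpha> + len"
  define d where "d = \<omega> - len"
  define u where "u r = (if a \<le> r \<and> r \<le> d then v r else if \<alpha> \<le> r \<and> r < a then v r + w1
      else if d < r \<and> r \<le> \<omega> then v r + w2 else 0)" for r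
  define \<eta> where "\<eta> r = x\<^sub>1 + (LINT z:{s\<^sub>1..r}|lborel. u z)" for r
  have ord: "s \<le> \<alpha>" "s\<^sub>1 \<le> \<alpha>" "\<alpha> \<le> a" "a \<le> d" "d \<le> \<omega>" "\<omega> \<le> t" "\<omega> \<le> t\<^sub>1" "s \<le> t"
    using len by (auto simp: \<alpha> \<omega> a_def d_def)
  have [measurable]: "v \<in> borel_measurable borel" by (rule W1inf_measurable[OF \<gamma>])
  obtain K where K: "AE r in lborel. r \<in> {s..t} \<longrightarrow> norm (v r) \<le> K"
    using \<gamma> by (auto simp: W1inf_def)
  have u_meas: "u \<in> borel_measurable borel" unfolding u_def by measurable
  have u_bound: "AE r in lborel. r \<in> {s\<^sub>1..t\<^sub>1} \<longrightarrow> norm (u r) \<le> \<bar>K\<bar> + norm w1 + norm w2"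
    using K
  proof eventually_elim
    case (elim r)
    have "norm (v r + w1) \<le> norm (v r) + norm w1" "norm (v r + w2) \<le> norm (v r) + norm w2"
      by (rule norm_triangle_ineq)+
    moreover have "norm (v r) \<le> \<bar>K\<bar>" if "\<alpha> \<le> r" "r \<le> \<omega>" using elim that ord by auto
    moreover have "0 \<le> norm w1" "0 \<le> norm w2" by auto
    ultimately show ?case using ord unfolding u_def by (smt (verit) norm_zero)
  qed
  have \<eta>: "W1inf s\<^sub>1 t\<^sub>1 \<eta> u"
    using W1inf_primitive[OF u_meas u_bound] unfolding \<eta>_def .
  have \<eta>s: "\<eta> s\<^sub>1 = x\<^sub>1" by (simp add: \<eta>_def)
  \<comment> \<open>At the junction points \<open>u\<close> can take only one of the two adjacent
    values, so the descriptions on closed subintervals hold up to a null set.\<close>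
  have AE_ne: "AE r in lborel. r \<noteq> a \<and> r \<noteq> d \<and> r \<noteq> \<alpha> \<and> r \<noteq> \<omega>"
    by (intro AE_conjI AE_lborel_singleton)
  have u1: "AE r in lborel. r \<in> {\<alpha>..a} \<longrightarrow> u r = v r + w1"
    using AE_ne by eventually_elim (auto simp: u_def)
  have u2: "AE r in lborel. r \<in> {d..\<omega>} \<longrightarrow> u r = v r + w2"
    using AE_ne by eventually_elim (use ord in \<open>auto simp: u_def\<close>)
  have u0: "AE r in lborel. r \<in> {s\<^sub>1..\<alpha>} \<longrightarrow> u r = 0"
    using AE_ne by eventually_elim (use ord in \<open>auto simp: u_def\<close>)
  have u3: "AE r in lborel. r \<in> {\<omega>..t\<^sub>1} \<longrightarrow> u r = 0"
    using AE_ne by eventually_elim (use ord in \<open>auto simp: u_def\<close>)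
  note sub\<gamma> = W1inf_subinterval[OF \<gamma>] and sub\<eta> = W1inf_subinterval[OF \<eta>]
  \<comment> \<open>A resting piece has zero energy, so only the lower-order terms of the upper
    action bound remain.\<close>
  have rest: "\<eta> e = \<eta> c \<and> action f b c e \<eta> u \<le> c\<^sub>2 * \<kappa> + Y * \<kappa> powr \<beta>"
    if z: "AE r in lborel. r \<in> {c..e} \<longrightarrow> u r = 0" and ce: "s\<^sub>1 \<le> c" "c \<le> e" "e \<le> t\<^sub>1" "e - c \<le> \<kappa>" for c e
  proof -
    have W: "W1inf c e \<eta> u" by (rule sub\<eta>) (use ce in auto)
    have zero: "(LINT r:{c..e}|lborel. g (u r)) = 0" if "g 0 = 0" "g \<in> borel_measurable borel"
      for g :: "real^'d \<Rightarrow> 'z::{banach, second_countable_topology}"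
    proof -
      have [measurable]: "g \<in> borel_measurable borel" "u \<in> borel_measurable borel" by fact+
      have "(LINT r:{c..e}|lborel. g (u r)) = (LINT r:{c..e}|lborel. 0)"
        by (rule set_lebesgue_integral_cong_AE) (use z that in \<open>auto elim!: eventually_mono\<close>)
      then show ?thesis by simp
    qed
    have "\<eta> e - \<eta> c = (LINT r:{c..e}|lborel. u r)"
      using W1inf_diff[OF \<eta>] ce by auto
    also have "\<dots> = 0" using zero[of "\<lambda>x. x"] by simp
    finally have 1: "\<eta> e = \<eta> c" by simp
    have "energy c e u = 0"
      unfolding energy_def
      by (rule zero) (use q'_gt_1 continuous_on_norm_powr in \<open>auto intro!: borel_measurable_continuous_onI\<close>)
    then have "action f b c e \<eta> u \<le> c\<^sub>2 * (e - c) + Y * (e - c) powr \<beta>"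
      using action_bounds(2)[OF nc W] ce I by simp
    also have "\<dots> \<le> c\<^sub>2 * \<kappa> + Y * \<kappa> powr \<beta>"
      using ce Y \<beta> cpos by (intro add_mono mult_left_mono powr_mono2) auto
    finally show ?thesis using 1 by simp
  qed
  \<comment> \<open>Cutting off a piece of \<open>\<gamma>\<close> gains at most the same
    lower-order terms, by coercivity. On each side one of the rest and the cut is trivial, but both
    are charged; this gives the factor 4 in the conclusion.\<close>
  have drop: "- (c\<^sub>2 * \<kappa> + Y * \<kappa> powr \<beta>) \<le> action f b c e \<gamma> v"
    if ce: "s \<le> c" "c \<le> e" "e \<le> t" "e - c \<le> \<kappa>" for c e
  proof -
    have W: "W1inf c e \<gamma> v" by (rule sub\<gamma>) (use ce in auto)
    have "c\<^sub>2 * (e - c) + Y * (e - c) powr \<beta> \<le> c\<^sub>2 * \<kappa> + Y * \<kappa> powr \<beta>"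
      using ce Y \<beta> cpos by (intro add_mono mult_left_mono powr_mono2) auto
    moreover have "c\<^sub>1 / 2 * energy c e v - c\<^sub>2 * (e - c) - Y * (e - c) powr \<beta> \<le> action f b c e \<gamma> v"
      by (rule action_bounds(1)[OF nc W]) (use ce I in auto)
    moreover have "0 \<le> c\<^sub>1 / 2 * energy c e v" using cpos energy_nonneg by (intro mult_nonneg_nonneg) auto
    ultimately show ?thesis by linarith
  qed
  have lens: "\<alpha> - s\<^sub>1 \<le> \<kappa>" "t\<^sub>1 - \<omega> \<le> \<kappa>" "\<alpha> - s \<le> \<kappa>" "t - \<omega> \<le> \<kappa>"
    using \<kappa> by (auto simp: \<alpha> \<omega>)
  have r1: "\<eta> \<alpha> = \<eta> s\<^sub>1" "action f b s\<^sub>1 \<alpha> \<eta> u \<le> c\<^sub>2 * \<kappa> + Y * \<kappa> powr \<beta>"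
    using rest[OF u0] ord lens by auto
  have r2: "\<eta> t\<^sub>1 = \<eta> \<omega>" "action f b \<omega> t\<^sub>1 \<eta> u \<le> c\<^sub>2 * \<kappa> + Y * \<kappa> powr \<beta>"
    using rest[OF u3] ord lens by auto
  have W1: "W1inf \<alpha> a \<gamma> v" "W1inf \<alpha> a \<eta> u" and W2: "W1inf d \<omega> \<gamma> v" "W1inf d \<omega> \<eta> u"
    by (rule sub\<gamma> sub\<eta>; use ord in simp)+
  have \<eta>a: "\<eta> a = \<gamma> a"
  proof -
    have "\<eta> a - \<eta> \<alpha> = \<gamma> a - \<gamma> \<alpha> + (a - \<alpha>) *\<^sub>R w1"
      by (rule shifted_velocity_increment[OF W1 _ u1]) (use ord in simp)
    then show ?thesis using r1(1) \<eta>s len by (simp add: a_def w1_def)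
  qed
  have mid: "\<eta> r = \<gamma> r" if "r \<in> {a..d}" for r
  proof -
    have "\<eta> r - \<eta> a = (LINT z:{a..r}|lborel. u z)"
      by (rule W1inf_diff[OF \<eta>]) (use that ord in auto)
    also have "\<dots> = (LINT z:{a..r}|lborel. v z)"
      using that by (intro set_lebesgue_integral_cong) (auto simp: u_def)
    also have "\<dots> = \<gamma> r - \<gamma> a"
      by (rule W1inf_diff[OF \<gamma>, symmetric]) (use that ord in auto)
    finally show ?thesis using \<eta>a by simp
  qed
  have \<eta>\<omega>: "\<eta> \<omega> = y\<^sub>1"
  proof -
    have "\<eta> \<omega> - \<eta> d = \<gamma> \<omega> - \<gamma> d + (\<omega> - d) *\<^sub>R w2"
      by (rule shifted_velocity_increment[OF W2 _ u2]) (use ord in simp)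
    then show ?thesis using mid[of d] ord len by (simp add: d_def w2_def)
  qed
  have mid_action: "action f b a d \<eta> u = action f b a d \<gamma> v"
  proof -
    have eq: "u r = v r" if "r \<in> {a..d}" for r using that by (simp add: u_def)
    have "(LINT r:{a..d}|lborel. legendre H (u r)) = (LINT r:{a..d}|lborel. legendre H (v r))"
      using eq by (intro set_lebesgue_integral_cong) auto
    moreover have "(LINT r:{a..d}|lborel. blinfun_apply (Dfun f (\<eta> r)) (u r) \<bullet> b r) =
        (LINT r:{a..d}|lborel. blinfun_apply (Dfun f (\<gamma> r)) (v r) \<bullet> b r)"
      using eq mid by (intro set_lebesgue_integral_cong) auto
    ultimately show ?thesis
      using mid[of a] mid[of d] ord by (simp add: action_def path_integral_def)
  qed
  have B_mono: "B * (1 + energy c e v) \<le> B * (1 + energy s t v)" if "s \<le> c" "e \<le> t" for c e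
    using energy_mono[OF \<gamma> that] B by (intro mult_left_mono) auto
  note shift = shift[rule_format, OF conjI, OF _ conjI, OF _ _ conjI, OF _ _ _ conjI, OF _ _ _ _ conjI, OF _ _ _ _ _ conjI]
  have sh1: "action f b \<alpha> a \<eta> u - action f b \<alpha> a \<gamma> v \<le> B * (1 + energy s t v)"
  proof (rule order_trans[OF shift[OF _ _ _ W1 u1] B_mono])
    show "norm w1 \<le> D / len" using D len by (simp add: w1_def inverse_eq_divide divide_right_mono)
  qed (use ord I in \<open>auto simp: a_def \<alpha>\<close>)
  have sh2: "action f b d \<omega> \<eta> u - action f b d \<omega> \<gamma> v \<le> B * (1 + energy s t v)"
  proof (rule order_trans[OF shift[OF _ _ _ W2 u2] B_mono])
    show "norm w2 \<le> D / len" using D len by (simp add: w2_def inverse_eq_divide divide_right_mono)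
    show "0 \<le> d" using ord I by linarith
    show "\<omega> \<le> T" using ord I by linarith
    show "\<omega> - d = len" by (simp add: d_def)
    show "s \<le> d" using ord by linarith
  qed (use ord in simp)
  have split: "action f b p e \<zeta> x = action f b p \<alpha> \<zeta> x + action f b \<alpha> a \<zeta> x + action f b a d \<zeta> x +
      action f b d \<omega> \<zeta> x + action f b \<omega> e \<zeta> x"
    if W: "W1inf p e \<zeta> x" and pe: "0 \<le> p" "p \<le> \<alpha>" "\<omega> \<le> e" "e \<le> T" for p e \<zeta> x
  proof -
    have c: "action f b i k \<zeta> x = action f b i j \<zeta> x + action f b j k \<zeta> x"
      if "p \<le> i" "i \<le> j" "j \<le> k" "k \<le> e" for i j k
      by (rule action_combine[OF f W1inf_subinterval[OF W] continuous_on_subset[OF b]])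
         (use that pe in auto)
    show ?thesis
      using c[of p \<alpha> e] c[of \<alpha> a e] c[of a d e] c[of d \<omega> e] pe ord by simp
  qed
  have "action f b s\<^sub>1 t\<^sub>1 \<eta> u \<le> action f b s t \<gamma> v + 4 * (c\<^sub>2 * \<kappa> + Y * \<kappa> powr \<beta>) + 2 * (B * (1 + energy s t v))"
  proof -
    have d1: "- (c\<^sub>2 * \<kappa> + Y * \<kappa> powr \<beta>) \<le> action f b s \<alpha> \<gamma> v"
      by (rule drop) (use ord lens in auto)
    have d2: "- (c\<^sub>2 * \<kappa> + Y * \<kappa> powr \<beta>) \<le> action f b \<omega> t \<gamma> v"
      by (rule drop) (use ord lens in auto)
    have s1: "action f b s\<^sub>1 t\<^sub>1 \<eta> u = action f b s\<^sub>1 \<alpha> \<eta> u + action f b \<alpha> a \<eta> u + action f b a d \<eta> u +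
      action f b d \<omega> \<eta> u + action f b \<omega> t\<^sub>1 \<eta> u" by (rule split[OF \<eta>]) (use ord I in auto)
    have s2: "action f b s t \<gamma> v = action f b s \<alpha> \<gamma> v + action f b \<alpha> a \<gamma> v + action f b a d \<gamma> v +
      action f b d \<omega> \<gamma> v + action f b \<omega> t \<gamma> v" by (rule split[OF \<gamma>]) (use ord I in auto)
    define k1 where "k1 = c\<^sub>2 * \<kappa> + Y * \<kappa> powr \<beta>"
    define k2 where "k2 = B * (1 + energy s t v)"
    show ?thesis
      using mid_action r1(2) r2(2) d1 d2 sh1 sh2 s1 s2 unfolding k1_def[symmetric] k2_def[symmetric] by linarith
  qed
  moreover have "\<eta> t\<^sub>1 = y\<^sub>1" using r2(1) \<eta>\<omega> by simp
  ultimately show ?thesis using \<eta> \<eta>s by blast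
qed

section \<open>Regularity of the value function in its endpoints\<close>

lemma powr_interpolate:
  fixes \<kappa> T p e :: real
  assumes "0 \<le> \<kappa>" "\<kappa> \<le> T" "0 \<le> e" "e \<le> p"
  shows "\<kappa> powr p \<le> T powr (p - e) * \<kappa> powr e"
proof -
  have "\<kappa> powr p = \<kappa> powr (p - e) * \<kappa> powr e" by (simp add: powr_add[symmetric])
  also have "\<dots> \<le> T powr (p - e) * \<kappa> powr e"
    using assms by (intro mult_right_mono powr_mono2) auto
  finally show ?thesis .
qed

text \<open>A one-sided bound is enough, the two points being interchangeable. The cube of
  \<open>Y\<close> arises from one factor for the noise on the windows, one for the energy
  \<open>1 + N\<close> of a near minimiser in the window cost, and one for \<open>1 + N\<close> in
  \<open>D powr \<theta>\<close>, the distance by which its endpoints have to be moved.\<close>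

theorem Lfun_holder:
  fixes T \<tau> \<theta> \<beta> R :: real
  assumes T: "0 < \<tau>" "\<tau> < T" and R: "0 < R" and \<theta>: "0 < \<theta>" "\<theta> < q / (2 + q)"
    and \<beta>: "0 < \<beta>" "\<beta> \<le> 1/2" "\<theta> \<le> 2 * q / (2 + q) * \<beta>"
  shows "\<exists>M\<ge>1. \<forall>Y (f :: real^'d \<Rightarrow> real^'m) b.
    1 \<le> Y \<and> f \<in> C1b \<and> continuous_on {0..T} b \<and> noise_controlled T q' \<beta> (c\<^sub>1 / 2) Y f b \<longrightarrow>
    (\<forall>x y s t x\<^sub>1 y\<^sub>1 s\<^sub>1 t\<^sub>1. (x, y, s, t) \<in> Udom \<tau> R T \<and> (x\<^sub>1, y\<^sub>1, s\<^sub>1, t\<^sub>1) \<in> Udom \<tau> R T \<and>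
        (x, y, s, t) \<noteq> (x\<^sub>1, y\<^sub>1, s\<^sub>1, t\<^sub>1) \<longrightarrow>
      Lfun H f b (x\<^sub>1, y\<^sub>1, s\<^sub>1, t\<^sub>1) - Lfun H f b (x, y, s, t) \<le>
        M * Y ^ 3 * (norm ((x, y) - (x\<^sub>1, y\<^sub>1)) powr \<theta> + norm ((s, t) - (s\<^sub>1, t\<^sub>1)) powr (\<theta> / q)))"
proof -
  obtain G where G: "0 \<le> G" and shift: "\<forall>Y (f :: real^'d \<Rightarrow> real^'m) b \<alpha> \<omega> \<gamma> v \<eta> u w D.
    1 \<le> Y \<and> noise_controlled T q' \<beta> (c\<^sub>1 / 2) Y f b \<and> 0 \<le> \<alpha> \<and> \<omega> \<le> T \<and> 0 < D \<and> D \<le> 1 \<and>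
    \<omega> - \<alpha> = \<tau> / 4 * D powr (2 * q / (2 + q)) \<and> W1inf \<alpha> \<omega> \<gamma> v \<and> W1inf \<alpha> \<omega> \<eta> u \<and>
    (AE r in lborel. r \<in> {\<alpha>..\<omega>} \<longrightarrow> u r = v r + w) \<and> norm w \<le> D / (\<omega> - \<alpha>) \<longrightarrow>
    action f b \<alpha> \<omega> \<eta> u - action f b \<alpha> \<omega> \<gamma> v \<le> G * Y * (1 + energy \<alpha> \<omega> v) * D powr \<theta>"
    using action_shift[OF T \<theta> \<beta>] by blast
  \<comment> \<open>\<open>G2 * Y\<close> will bound the absolute value of \<open>Lfun\<close> on
    the domain, from above by the straight line, whose speed is at most \<open>R / \<tau>\<close>;
    \<open>G3 * Y\<close> will bound the energy of near minimisers.\<close>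
  define G2 where "G2 = (c\<^sub>1 + c\<^sub>2) * (T * (R / \<tau>) powr q') + c\<^sub>2 * T + T powr \<beta>"
  define G3 where "G3 = 2 / c\<^sub>1 * (2 * G2 + 1)"
  define G4 where "G4 = c\<^sub>2 * T powr (1 - \<theta> / q) + T powr (\<beta> - \<theta> / q)"
  define M1 where "M1 = 2 * G2 / (\<tau> / 4) powr (\<theta> / q)"
  define M2 where "M2 = 4 * G2 * (1 + G3)"
  define M3 where "M3 = 1 + 4 * G4 + 4 * G * (1 + G3) ^ 2"
  define M where "M = M1 + M2 + M3"
  have T0: "0 < T" using T by simp
  have nonneg: "0 \<le> G2" "0 \<le> G3" "0 \<le> G4"
    using cpos T R by (auto simp: G2_def G3_def G4_def intro!: add_nonneg_nonneg mult_nonneg_nonneg)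
  then have Ms: "0 \<le> M1" "0 \<le> M2" "1 \<le> M3"
    using T G by (auto simp: M1_def M2_def M3_def intro!: add_nonneg_nonneg mult_nonneg_nonneg)
  have exps: "0 \<le> \<theta> / q" "\<theta> / q \<le> 1" "\<theta> / q \<le> \<beta>" "0 \<le> \<beta>" "\<theta> \<le> 1"
  proof -
    have "q / (2 + q) \<le> 1" using q(1) by simp
    then show "\<theta> \<le> 1" using \<theta> by simp
    show "0 \<le> \<theta> / q" using \<theta> q(1) by simp
    show "\<theta> / q \<le> 1" using \<open>\<theta> \<le> 1\<close> q(1) by (simp add: divide_le_eq)
    have "\<theta> / q \<le> (2 * q / (2 + q) * \<beta>) / q" using \<beta> q(1) by (intro divide_right_mono) auto
    also have "\<dots> = 2 / (2 + q) * \<beta>" using q(1) by simp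
    also have "\<dots> \<le> 1 * \<beta>" using q(1) \<beta> by (intro mult_right_mono) auto
    finally show "\<theta> / q \<le> \<beta>" by simp
  qed (use \<beta> in simp)
  show ?thesis
  proof (intro exI[of _ M] conjI allI impI, goal_cases)
    case 1
    show ?case using Ms by (simp add: M_def)
  next
    case (2 Y f b x y s t x1 y1 s1 t1)
    then have Y: "1 \<le> Y" and f: "f \<in> C1b" and b: "continuous_on {0..T} b"
      and nc: "noise_controlled T q' \<beta> (c\<^sub>1 / 2) Y f b"
      and U: "(x, y, s, t) \<in> Udom \<tau> R T" "(x1, y1, s1, t1) \<in> Udom \<tau> R T"
      and ne: "(x, y, s, t) \<noteq> (x1, y1, s1, t1)" by auto
    have lower_action: "- (c\<^sub>2 * T + Y * T powr \<beta>) \<le> action f b s t \<gamma> v - c\<^sub>1 / 2 * energy s t v"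
      if W: "W1inf s t \<gamma> v" and st: "0 \<le> s" "s \<le> t" "t \<le> T" for s t \<gamma> v
    proof -
      have "c\<^sub>2 * (t - s) + Y * (t - s) powr \<beta> \<le> c\<^sub>2 * T + Y * T powr \<beta>"
        using st Y \<beta> cpos by (intro add_mono mult_left_mono powr_mono2) auto
      then show ?thesis using action_bounds(1)[OF nc W st T0] by linarith
    qed
    have lower_action': "- (c\<^sub>2 * T + Y * T powr \<beta>) \<le> action f b s t \<gamma> v"
      if W: "W1inf s t \<gamma> v" and st: "0 \<le> s" "s \<le> t" "t \<le> T" for s t \<gamma> v
    proof -
      have "0 \<le> c\<^sub>1 / 2 * energy s t v" using cpos energy_nonneg by (intro mult_nonneg_nonneg) auto
      then show ?thesis using lower_action[OF that] by linarith
    qed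
    have cTY: "c\<^sub>2 * T + Y * T powr \<beta> \<le> G2 * Y"
    proof -
      have "c\<^sub>2 * T + Y * T powr \<beta> \<le> c\<^sub>2 * T * Y + T powr \<beta> * Y"
        using Y cpos T0 mult_left_mono[of 1 Y "c\<^sub>2 * T"] by simp
      also have "\<dots> = (c\<^sub>2 * T + T powr \<beta>) * Y" by (simp add: algebra_simps)
      also have "\<dots> \<le> G2 * Y" unfolding G2_def using cpos T0 Y R T
        by (intro mult_right_mono) auto
      finally show ?thesis .
    qed
    have L_lower: "- (G2 * Y) \<le> Lfun H f b (x, y, s, t)" if "(x, y, s, t) \<in> Udom \<tau> R T" for x y s t
      using Lfun_ge[OF lower_action', of s t x y] that cTY T by (force simp: Udom_def)
    have L_upper: "Lfun H f b (x, y, s, t) \<le> G2 * Y" if u: "(x, y, s, t) \<in> Udom \<tau> R T" for x y s t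
    proof -
      have st: "0 \<le> s" "t \<le> T" "\<tau> < t - s" "t - s < T" "norm (y - x) \<le> R"
        using u by (auto simp: Udom_def norm_minus_commute)
      have lt: "s < t" using st T by linarith
      define w where "w = (y - x) /\<^sub>R (t - s)"
      obtain \<gamma> where W: "W1inf s t \<gamma> (\<lambda>_. w)" and e: "\<gamma> s = x" "\<gamma> t = y"
        using straight_line[OF lt, where x = x and y = y] unfolding w_def by (elim exE conjE)
      have "norm w = norm (y - x) / (t - s)" using lt by (simp add: w_def divide_inverse)
      also have "\<dots> \<le> R / \<tau>" using st T R by (intro frac_le) auto
      finally have "norm w powr q' \<le> (R / \<tau>) powr q'" using q'_gt_1 by (intro powr_mono2) auto
      then have en: "energy s t (\<lambda>_. w) \<le> T * (R / \<tau>) powr q'"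
        unfolding energy_def using lt st T0 by (simp add: set_integral_const_Icc mult_mono)
      have "Lfun H f b (x, y, s, t) \<le> action f b s t \<gamma> (\<lambda>_. w)"
        by (rule Lfun_le_action[OF lower_action' W e]) (use lt st in auto)
      also have "\<dots> \<le> (c\<^sub>1 + c\<^sub>2) * energy s t (\<lambda>_. w) + c\<^sub>2 * (t - s) + Y * (t - s) powr \<beta>"
        by (rule action_bounds(2)[OF nc W]) (use lt st T0 in auto)
      also have "\<dots> \<le> (c\<^sub>1 + c\<^sub>2) * (T * (R / \<tau>) powr q') + c\<^sub>2 * T + Y * T powr \<beta>"
        using en st lt cpos Y \<beta> by (intro add_mono mult_left_mono powr_mono2) auto
      also have "\<dots> \<le> G2 * Y"
      proof -
        have "0 \<le> (c\<^sub>1 + c\<^sub>2) * (T * (R / \<tau>) powr q') + c\<^sub>2 * T" using cpos T0 by simp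
        from mult_left_mono[OF Y this] show ?thesis by (simp add: G2_def algebra_simps)
      qed
      finally show ?thesis .
    qed
    define \<delta> where "\<delta> = norm ((x, y) - (x1, y1))"
    define \<kappa> where "\<kappa> = norm ((s, t) - (s1, t1))"
    define \<Delta> where "\<Delta> = \<delta> powr \<theta> + \<kappa> powr (\<theta> / q)"
    have \<delta>\<kappa>0: "0 \<le> \<delta>" "0 \<le> \<kappa>" "\<delta> > 0 \<or> \<kappa> > 0" using ne by (auto simp: \<delta>_def \<kappa>_def zero_prod_def)
    have \<Delta>0: "\<Delta> > 0" using \<delta>\<kappa>0 by (auto simp: \<Delta>_def intro: add_pos_nonneg add_nonneg_pos)
    have Y3: "Y \<le> Y ^ 3" "Y ^ 2 \<le> Y ^ 3" using Y power_increasing[of 1 3 Y] power_increasing[of 2 3 Y] by auto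
    have st: "0 \<le> s" "t \<le> T" "\<tau> < t - s" "s < t" "0 \<le> s1" "t1 \<le> T" "\<tau> < t1 - s1" "s1 < t1"
      using U T by (auto simp: Udom_def)
    have claim: "Lfun H f b (x1, y1, s1, t1) - Lfun H f b (x, y, s, t) \<le> M * Y ^ 3 * \<Delta>"
      if "Lfun H f b (x1, y1, s1, t1) - Lfun H f b (x, y, s, t) \<le> m * (z * \<Delta>)" "m \<in> {M1, M2, M3}" "z \<in> {Y, Y ^ 2, Y ^ 3}"
      for m z
    proof -
      have "m * (z * \<Delta>) \<le> M * (Y ^ 3 * \<Delta>)"
        using that(2,3) Ms Y3 \<Delta>0 Y by (intro mult_mono mult_right_mono) (auto simp: M_def)
      then show ?thesis using that(1) by (simp add: mult.assoc)
    qed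
    \<comment> \<open>The tolerance 1 suffices for the energy bound; the tolerance
      \<open>\<Delta>\<close> is of the size of the claimed estimate, so no limit over near
      minimisers is needed.\<close>
    obtain \<gamma> v where \<gamma>: "W1inf s t \<gamma> v" and e: "\<gamma> s = x" "\<gamma> t = y"
      and near: "action f b s t \<gamma> v < Lfun H f b (x, y, s, t) + min 1 \<Delta>"
      using Lfun_near_minimizer[OF lower_action' st(4), of "min 1 \<Delta>" x y] st \<Delta>0 by auto
    define N where "N = energy s t v"
    have N0: "0 \<le> N" by (simp add: N_def energy_nonneg)
    have N: "N \<le> G3 * Y"
    proof -
      have "c\<^sub>1 / 2 * N \<le> action f b s t \<gamma> v + (c\<^sub>2 * T + Y * T powr \<beta>)"
        using lower_action[OF \<gamma>] st unfolding N_def by simp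
      also have "\<dots> \<le> G2 * Y + 1 + G2 * Y" using near L_upper[OF U(1)] cTY by linarith
      also have "\<dots> \<le> (2 * G2 + 1) * Y" using Y by (simp add: algebra_simps)
      finally show ?thesis using cpos by (simp add: G3_def field_simps)
    qed
    have N1: "1 + N \<le> (1 + G3) * Y" using N Y by (simp add: algebra_simps)
    \<comment> \<open>The distance to be corrected at each end: the shift in space, plus the
      displacement of \<open>\<gamma>\<close> over the time cut off at that end.\<close>
    define D where "D = \<delta> + \<kappa> powr (1 / q) * (1 + N)"
    have D0: "0 < D" using \<delta>\<kappa>0 N0 by (auto simp: D_def intro: add_pos_nonneg add_nonneg_pos)
    have D\<theta>: "D powr \<theta> \<le> 2 * (1 + N) * \<Delta>"
    proof -
      have "D powr \<theta> \<le> 2 powr \<theta> * (\<delta> powr \<theta> + (\<kappa> powr (1 / q) * (1 + N)) powr \<theta>)"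
        unfolding D_def using \<delta>\<kappa>0 N0 \<theta> by (intro powr_add_le) auto
      also have "\<dots> = 2 powr \<theta> * (\<delta> powr \<theta> + \<kappa> powr (\<theta> / q) * (1 + N) powr \<theta>)"
        using \<delta>\<kappa>0 N0 by (simp add: powr_mult powr_powr)
      also have "\<dots> \<le> 2 * (\<delta> powr \<theta> * (1 + N) + \<kappa> powr (\<theta> / q) * (1 + N))"
      proof (intro mult_mono add_mono)
        show "2 powr \<theta> \<le> (2::real)" using powr_mono[of \<theta> 1 2] exps by simp
        show "\<delta> powr \<theta> \<le> \<delta> powr \<theta> * (1 + N)" using N0 mult_left_mono[of 1 "1 + N" "\<delta> powr \<theta>"] by simp
        show "(1 + N) powr \<theta> \<le> 1 + N" using powr_mono[of \<theta> 1 "1 + N"] exps N0 by simp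
      qed (use N0 in auto)
      also have "\<dots> = 2 * (1 + N) * \<Delta>" by (simp add: \<Delta>_def algebra_simps)
      finally show ?thesis .
    qed
    have triv: "Lfun H f b (x1, y1, s1, t1) - Lfun H f b (x, y, s, t) \<le> 2 * G2 * Y"
      using L_upper[OF U(2)] L_lower[OF U(1)] by linarith
    have "Lfun H f b (x1, y1, s1, t1) - Lfun H f b (x, y, s, t) \<le> M * Y ^ 3 * \<Delta>"
    proof -
      \<comment> \<open>If the time shift or \<open>D\<close> is not small, \<open>\<Delta>\<close>
        is bounded below (in terms of \<open>Y\<close> for \<open>D\<close>) and boundedness of
        \<open>Lfun\<close> suffices. Only the third case needs a competitor.\<close>
      consider "\<tau> / 4 < \<kappa>" | "1 \<le> D" | "\<kappa> \<le> \<tau> / 4" "D < 1" by linarith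
      then show ?thesis
      proof cases
        case 1
        then have "(\<tau> / 4) powr (\<theta> / q) \<le> \<kappa> powr (\<theta> / q)" using T exps by (intro powr_mono2) auto
        then have "(\<tau> / 4) powr (\<theta> / q) \<le> \<Delta>" by (simp add: \<Delta>_def add_increasing)
        then have "1 \<le> \<Delta> / (\<tau> / 4) powr (\<theta> / q)" using T by (simp add: pos_le_divide_eq)
        then have "2 * G2 * Y * 1 \<le> 2 * G2 * Y * (\<Delta> / (\<tau> / 4) powr (\<theta> / q))"
          using nonneg Y by (intro mult_left_mono) auto
        then show ?thesis using triv by (intro claim[of M1 Y]) (auto simp: M1_def mult_ac)
      next
        case 2
        then have "1 \<le> D powr \<theta>" using powr_mono2[of \<theta> 1 D] \<theta> by simp
        also have "\<dots> \<le> 2 * (1 + N) * \<Delta>" by (rule D\<theta>)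
        also have "\<dots> \<le> 2 * ((1 + G3) * Y) * \<Delta>" using N1 \<Delta>0 by (intro mult_right_mono mult_left_mono) auto
        finally have "2 * G2 * Y * 1 \<le> 2 * G2 * Y * (2 * ((1 + G3) * Y) * \<Delta>)"
          using nonneg Y by (intro mult_left_mono) auto
        then show ?thesis using triv by (intro claim[of M2 "Y ^ 2"]) (auto simp: M2_def mult_ac power2_eq_square)
      next
        case 3
        define len where "len = \<tau> / 4 * D powr (2 * q / (2 + q))"
        define \<alpha> where "\<alpha> = max s s1"
        define \<omega> where "\<omega> = min t t1"
        have D1: "D powr (2 * q / (2 + q)) \<le> 1" using D0 3 q(1) powr_mono2[of "2 * q / (2 + q)" D 1] by simp
        have len: "0 < len" "len \<le> \<tau> / 4"
          using T D0 D1 mult_left_mono[OF D1, of "\<tau> / 4"] by (auto simp: len_def)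
        have k: "\<bar>s - s1\<bar> \<le> \<kappa>" "\<bar>t - t1\<bar> \<le> \<kappa>"
          using norm_fst_le[of "s - s1" "t - t1"] norm_snd_le[of "t - t1" "s - s1"] by (auto simp: \<kappa>_def)
        have dl: "norm (x - x1) \<le> \<delta>" "norm (y - y1) \<le> \<delta>"
          using norm_fst_le[of "x - x1" "y - y1"] norm_snd_le[of "y - y1" "x - x1"] by (auto simp: \<delta>_def)
        \<comment> \<open>The time shifts remove at most \<open>\<tau> / 4\<close> at each end of an
          interval longer than \<open>\<tau>\<close>, and the two windows together have length at
          most \<open>\<tau> / 2\<close>.\<close>
        have len2: "2 * len \<le> \<omega> - \<alpha>" using len k 3 st by (auto simp: \<alpha>_def \<omega>_def)
        have ord: "s \<le> \<alpha>" "\<alpha> \<le> t" "s \<le> \<omega>" "\<omega> \<le> t" "\<alpha> \<le> \<omega>"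
          using len len2 st by (auto simp: \<alpha>_def \<omega>_def)
        have "norm (\<gamma> \<alpha> - \<gamma> s) \<le> \<kappa> powr (1 / q) * (1 + N)"
          unfolding N_def by (rule displacement_bound[OF \<gamma>]) (use ord k in \<open>auto simp: \<alpha>_def\<close>)
        then have Dx: "norm (\<gamma> \<alpha> - x1) \<le> D"
          using norm_triangle_ineq[of "\<gamma> \<alpha> - x" "x - x1"] dl by (simp add: D_def e)
        have "norm (\<gamma> t - \<gamma> \<omega>) \<le> \<kappa> powr (1 / q) * (1 + N)"
          unfolding N_def by (rule displacement_bound[OF \<gamma>]) (use ord k in \<open>auto simp: \<omega>_def\<close>)
        then have Dy: "norm (y1 - \<gamma> \<omega>) \<le> D"
          using norm_triangle_ineq[of "y1 - y" "y - \<gamma> \<omega>"] dl by (simp add: D_def e norm_minus_commute)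
        define B where "B = G * Y * D powr \<theta>"
        have B: "0 \<le> B" using G Y by (simp add: B_def)
        have sh: "\<forall>\<alpha> \<omega> \<gamma> v \<eta> u w. 0 \<le> \<alpha> \<and> \<omega> \<le> T \<and> \<omega> - \<alpha> = len \<and> W1inf \<alpha> \<omega> \<gamma> v \<and> W1inf \<alpha> \<omega> \<eta> u \<and>
            (AE r in lborel. r \<in> {\<alpha>..\<omega>} \<longrightarrow> u r = v r + w) \<and> norm w \<le> D / len \<longrightarrow>
            action f b \<alpha> \<omega> \<eta> u - action f b \<alpha> \<omega> \<gamma> v \<le> B * (1 + energy \<alpha> \<omega> v)"
        proof (intro allI impI, elim conjE)
          fix \<alpha> \<omega> :: real and \<gamma> v \<eta> u :: "real \<Rightarrow> real^'d" and w
          assume h: "0 \<le> \<alpha>" "\<omega> \<le> T" "\<omega> - \<alpha> = len" "W1inf \<alpha> \<omega> \<gamma> v" "W1inf \<alpha> \<omega> \<eta> u"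
            "AE r in lborel. r \<in> {\<alpha>..\<omega>} \<longrightarrow> u r = v r + w" "norm w \<le> D / len"
          have "norm w \<le> D / (\<omega> - \<alpha>)" using h(7) unfolding h(3) .
          moreover have "\<omega> - \<alpha> = \<tau> / 4 * D powr (2 * q / (2 + q))" unfolding h(3) len_def ..
          ultimately have "action f b \<alpha> \<omega> \<eta> u - action f b \<alpha> \<omega> \<gamma> v \<le> G * Y * (1 + energy \<alpha> \<omega> v) * D powr \<theta>"
            using h D0 Y nc 3
            by (intro shift[THEN spec[of _ Y], THEN spec[of _ f], THEN spec[of _ b], THEN spec[of _ \<alpha>], THEN spec[of _ \<omega>], THEN spec[of _ \<gamma>], THEN spec[of _ v], THEN spec[of _ \<eta>], THEN spec[of _ u], THEN spec[of _ w], THEN spec[of _ D], THEN mp]) simp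
          then show "action f b \<alpha> \<omega> \<eta> u - action f b \<alpha> \<omega> \<gamma> v \<le> B * (1 + energy \<alpha> \<omega> v)"
            by (simp add: B_def mult_ac)
        qed
        have Y0: "0 \<le> Y" using Y by simp
        obtain \<eta> u where \<eta>: "W1inf s1 t1 \<eta> u" "\<eta> s1 = x1" "\<eta> t1 = y1"
          and le: "action f b s1 t1 \<eta> u \<le> action f b s t \<gamma> v + 4 * (c\<^sub>2 * \<kappa> + Y * \<kappa> powr \<beta>) + 2 * (B * (1 + energy s t v))"
          using competitor[OF nc f b Y0 exps(4) sh B st(1,2,5,6) T0 \<gamma> \<alpha>_def \<omega>_def len(1) len2 Dx Dy k]
          by (elim exE conjE)
        have combine: "L1 - L0 \<le> P + 4 * g + 2 * h" if "c \<le> g'" "B' \<le> h" "L1 \<le> A1" "m \<le> P" "g' \<le> g"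
            "A1 \<le> A0 + 4 * c + 2 * B'" "A0 < L0 + m" for L1 L0 P g h c g' B' A1 m A0 :: real
          using that by linarith
        have "c\<^sub>2 * \<kappa> + Y * \<kappa> powr \<beta> \<le> G4 * (Y * \<Delta>)"
        proof -
          have \<kappa>T: "\<kappa> \<le> T" using 3 T by simp
          have "\<kappa> powr 1 \<le> T powr (1 - \<theta> / q) * \<kappa> powr (\<theta> / q)"
            using \<delta>\<kappa>0 \<kappa>T exps by (intro powr_interpolate) auto
          then have "c\<^sub>2 * \<kappa> \<le> c\<^sub>2 * (T powr (1 - \<theta> / q) * \<kappa> powr (\<theta> / q))"
            using cpos \<delta>\<kappa>0 by (intro mult_left_mono) auto
          also have "\<dots> \<le> Y * (c\<^sub>2 * (T powr (1 - \<theta> / q) * \<kappa> powr (\<theta> / q)))"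
            using Y cpos mult_right_mono[of 1 Y "c\<^sub>2 * (T powr (1 - \<theta> / q) * \<kappa> powr (\<theta> / q))"] by simp
          finally have "c\<^sub>2 * \<kappa> \<le> Y * (c\<^sub>2 * (T powr (1 - \<theta> / q) * \<kappa> powr (\<theta> / q)))" .
          moreover have "\<kappa> powr \<beta> \<le> T powr (\<beta> - \<theta> / q) * \<kappa> powr (\<theta> / q)"
            using \<delta>\<kappa>0 \<kappa>T exps by (intro powr_interpolate) auto
          then have "Y * \<kappa> powr \<beta> \<le> Y * (T powr (\<beta> - \<theta> / q) * \<kappa> powr (\<theta> / q))"
            using Y by (intro mult_left_mono) auto
          ultimately have "c\<^sub>2 * \<kappa> + Y * \<kappa> powr \<beta> \<le> G4 * (Y * \<kappa> powr (\<theta> / q))"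
            by (simp add: G4_def algebra_simps)
          also have "\<dots> \<le> G4 * (Y * \<Delta>)" using nonneg Y by (intro mult_left_mono) (auto simp: \<Delta>_def)
          finally show ?thesis .
        qed
        moreover have "B * (1 + energy s t v) \<le> 2 * G * (1 + G3) ^ 2 * (Y ^ 3 * \<Delta>)"
        proof -
          have "B * (1 + energy s t v) \<le> G * Y * (2 * (1 + N) * \<Delta>) * (1 + N)"
            unfolding B_def N_def[symmetric] using D\<theta> G Y N0 by (intro mult_right_mono mult_left_mono) auto
          also have "\<dots> = 2 * G * Y * \<Delta> * ((1 + N) * (1 + N))" by (simp add: mult_ac)
          also have "\<dots> \<le> 2 * G * Y * \<Delta> * (((1 + G3) * Y) * ((1 + G3) * Y))"
            using N1 N0 G Y \<Delta>0 nonneg by (intro mult_left_mono mult_mono) auto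
          also have "\<dots> = 2 * G * (1 + G3) ^ 2 * (Y ^ 3 * \<Delta>)"
            by (simp add: power2_eq_square power3_eq_cube mult_ac)
          finally show ?thesis .
        qed
        moreover have "Lfun H f b (x1, y1, s1, t1) \<le> action f b s1 t1 \<eta> u"
          by (rule Lfun_le_action[OF lower_action' \<eta>]) (use st in auto)
        moreover have "min 1 \<Delta> \<le> Y ^ 3 * \<Delta>"
          using mult_right_mono[of 1 "Y ^ 3" \<Delta>] \<Delta>0 Y by (simp add: min_le_iff_disj)
        moreover have "G4 * (Y * \<Delta>) \<le> G4 * (Y ^ 3 * \<Delta>)"
          using Y3 nonneg \<Delta>0 by (intro mult_left_mono mult_right_mono) auto
        ultimately have "Lfun H f b (x1, y1, s1, t1) - Lfun H f b (x, y, s, t) \<le>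
            Y ^ 3 * \<Delta> + 4 * (G4 * (Y ^ 3 * \<Delta>)) + 2 * (2 * G * (1 + G3) ^ 2 * (Y ^ 3 * \<Delta>))"
          using le near by (rule combine)
        also have "\<dots> = M3 * (Y ^ 3 * \<Delta>)" by (simp add: M3_def algebra_simps)
        finally show ?thesis by (intro claim[of M3 "Y ^ 3"]) auto
      qed
    qed
    then show ?case by (simp add: \<Delta>_def \<delta>_def \<kappa>_def)
  qed
qed

end

section \<open>Dyadic means of Brownian motion\<close>

lemma power_fact_le_exp:
  fixes x :: real
  assumes "0 \<le> x"
  shows "x ^ n / fact n \<le> exp x"
proof -
  have "(\<Sum>k\<in>{n}. x ^ k /\<^sub>R fact k) \<le> (\<Sum>k. x ^ k /\<^sub>R fact k)"
    using assms by (intro sum_le_suminf summable_exp_generic) auto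
  then show ?thesis by (simp add: exp_def divide_inverse mult.commute)
qed

text \<open>Truncating the summands at \<open>sqrt (N * u)\<close> makes a Chernoff bound with parameter
  \<open>1 / sqrt (N * u)\<close> available, although \<open>Y i\<close> has polynomial moments only.\<close>

lemma (in prob_space) mean_tail:
  fixes Y :: "nat \<Rightarrow> 'a \<Rightarrow> real"
  assumes indep: "indep_vars (\<lambda>_. borel) Y {..<N}" and N: "0 < N" and u: "1 \<le> u"
    and Y0: "\<And>i \<omega>. 0 \<le> Y i \<omega>"
    and m1: "\<And>i. i < N \<Longrightarrow> integrable M (Y i)" "\<And>i. i < N \<Longrightarrow> expectation (Y i) \<le> m"
    and m2: "\<And>i. i < N \<Longrightarrow> integrable M (\<lambda>\<omega>. Y i \<omega> ^ (2 * k + 2))"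
      "\<And>i. i < N \<Longrightarrow> expectation (\<lambda>\<omega>. Y i \<omega> ^ (2 * k + 2)) \<le> \<mu>"
  shows "prob {\<omega> \<in> space M. 2 * m + u < (\<Sum>i<N. Y i \<omega>) / N} \<le> (\<mu> + fact (2 * k)) / (N * u) ^ k"
proof -
  define L where "L = sqrt (N * u)"
  have Nu: "1 \<le> N * u" using N u by (metis One_nat_def Suc_leI mult_mono mult_1 of_nat_1 of_nat_le_iff of_nat_0_le_iff zero_le_one)
  then have L: "1 \<le> L" "L ^ 2 = N * u" by (auto simp: L_def)
  have Y_meas [measurable]: "Y i \<in> borel_measurable M" if "i < N" for i
    using m1(1)[OF that] by auto
  have "0 \<le> expectation (\<lambda>\<omega>. Y 0 \<omega> ^ (2 * k + 2))"
    by (intro integral_nonneg_AE AE_I2 zero_le_power Y0)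
  then have \<mu>0: "0 \<le> \<mu>" using m2(2)[of 0] N by linarith
  define Z where "Z i \<omega> = exp (min (Y i \<omega>) L / L)" for i \<omega>
  have Z_bound: "1 \<le> Z i \<omega>" "Z i \<omega> \<le> exp 1" "Z i \<omega> \<le> 1 + 2 * (Y i \<omega> / L)" for i \<omega>
  proof -
    have x: "0 \<le> min (Y i \<omega>) L / L" "min (Y i \<omega>) L / L \<le> 1" "min (Y i \<omega>) L / L \<le> Y i \<omega> / L"
      using L Y0[of i \<omega>] by (auto simp: divide_right_mono)
    then show "1 \<le> Z i \<omega>" "Z i \<omega> \<le> exp 1" by (auto simp: Z_def)
    \<comment> \<open>The inequality \<open>exp x \<le> 1 + 2 * x\<close> on the unit interval is
      why the deviation is measured from \<open>2 * m\<close> instead of \<open>m\<close>.\<close>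
    have "Z i \<omega> \<le> 1 + min (Y i \<omega>) L / L + (min (Y i \<omega>) L / L)\<^sup>2"
      unfolding Z_def using x by (intro exp_bound) auto
    also have "(min (Y i \<omega>) L / L)\<^sup>2 \<le> min (Y i \<omega>) L / L"
      using x mult_left_le[of "min (Y i \<omega>) L / L" "min (Y i \<omega>) L / L"] by (simp add: power2_eq_square)
    finally show "Z i \<omega> \<le> 1 + 2 * (Y i \<omega> / L)" using x(3) by linarith
  qed
  have Z_int: "integrable M (Z i)" if "i < N" for i
  proof (rule integrable_const_bound[of _ "exp 1"])
    show "AE \<omega> in M. norm (Z i \<omega>) \<le> exp 1"
      using Z_bound by (intro AE_I2) (smt (verit) real_norm_def)
    show "Z i \<in> borel_measurable M" unfolding Z_def using that by measurable
  qed
  have Z_exp: "expectation (Z i) \<le> exp (2 * m / L)" if "i < N" for i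
  proof -
    have "expectation (Z i) \<le> expectation (\<lambda>\<omega>. 1 + 2 * (Y i \<omega> / L))"
      using that Z_bound
      by (intro integral_mono Z_int Bochner_Integration.integrable_add integrable_const
          integrable_mult_right integrable_divide m1) auto
    also have "\<dots> = 1 + 2 * (expectation (Y i) / L)"
      using m1(1)[OF that] by (simp add: prob_space)
    also have "\<dots> \<le> 1 + 2 * (m / L)" using m1(2)[OF that] L by (simp add: divide_right_mono)
    also have "\<dots> \<le> exp (2 * m / L)" using exp_ge_add_one_self[of "2 * m / L"] by simp
    finally show ?thesis .
  qed
  have Zind: "indep_vars (\<lambda>_. borel) Z {..<N}"
    unfolding Z_def[abs_def] by (rule indep_vars_compose2[OF indep]) simp
  have prod_exp: "expectation (\<lambda>\<omega>. \<Prod>i<N. Z i \<omega>) \<le> exp (2 * m / L) ^ N"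
  proof -
    have "expectation (\<lambda>\<omega>. \<Prod>i<N. Z i \<omega>) = (\<Prod>i<N. expectation (Z i))"
      by (rule indep_vars_lebesgue_integral[OF _ Zind Z_int]) auto
    also have "\<dots> \<le> (\<Prod>i<N. exp (2 * m / L))"
    proof (rule prod_mono)
      fix i assume "i \<in> {..<N}"
      moreover have "0 \<le> expectation (Z i)" using Z_bound(1)[of i] by (intro integral_nonneg_AE AE_I2) (smt (verit))
      ultimately show "0 \<le> expectation (Z i) \<and> expectation (Z i) \<le> exp (2 * m / L)" using Z_exp by auto
    qed
    finally show ?thesis by simp
  qed
  have prod_int: "integrable M (\<lambda>\<omega>. \<Prod>i<N. Z i \<omega>)"
    by (rule indep_vars_integrable[OF _ Zind Z_int]) auto
  define c where "c = exp (N * (2 * m + u) / L)"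
  define A where "A i = {\<omega> \<in> space M. L ^ (2 * k + 2) \<le> Y i \<omega> ^ (2 * k + 2)}" for i
  define A' where "A' = {\<omega> \<in> space M. c \<le> (\<Prod>i<N. Z i \<omega>)}"
  have A_sets: "A i \<in> events" if "i < N" for i unfolding A_def using that by measurable
  have A'_sets: "A' \<in> events" unfolding A'_def using borel_measurable_integrable[OF prod_int] by measurable
  have "{\<omega> \<in> space M. 2 * m + u < (\<Sum>i<N. Y i \<omega>) / N} \<subseteq> (\<Union>i<N. A i) \<union> A'"
  proof
    fix \<omega> assume \<omega>: "\<omega> \<in> {\<omega> \<in> space M. 2 * m + u < (\<Sum>i<N. Y i \<omega>) / N}"
    show "\<omega> \<in> (\<Union>i<N. A i) \<union> A'"
    proof (cases "\<exists>i<N. L \<le> Y i \<omega>")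
      case True
      then obtain i where i: "i < N" "L \<le> Y i \<omega>" by blast
      have "L ^ (2 * k + 2) \<le> Y i \<omega> ^ (2 * k + 2)" using i L by (intro power_mono) auto
      then show ?thesis using \<omega> i(1) by (auto simp: A_def)
    next
      case False
      then have "(\<Prod>i<N. Z i \<omega>) = (\<Prod>i<N. exp (Y i \<omega> / L))"
        by (intro prod.cong) (auto simp: Z_def min_def)
      also have "\<dots> = exp ((\<Sum>i<N. Y i \<omega>) / L)" by (simp add: exp_sum sum_divide_distrib)
      finally have "(\<Prod>i<N. Z i \<omega>) = exp ((\<Sum>i<N. Y i \<omega>) / L)" .
      moreover have "N * (2 * m + u) \<le> (\<Sum>i<N. Y i \<omega>)" using \<omega> N by (simp add: field_simps)
      then have "N * (2 * m + u) / L \<le> (\<Sum>i<N. Y i \<omega>) / L" using L by (intro divide_right_mono) auto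
      ultimately show ?thesis using \<omega> by (auto simp: A'_def c_def)
    qed
  qed
  then have "prob {\<omega> \<in> space M. 2 * m + u < (\<Sum>i<N. Y i \<omega>) / N} \<le> prob ((\<Union>i<N. A i) \<union> A')"
    using A_sets A'_sets by (intro finite_measure_mono) auto
  also have "\<dots> \<le> prob (\<Union>i<N. A i) + prob A'" using A_sets A'_sets by (intro measure_Un_le) auto
  also have "prob (\<Union>i<N. A i) \<le> (\<Sum>i<N. prob (A i))"
    using A_sets by (intro finite_measure_subadditive_finite) auto
  also have "\<dots> \<le> (\<Sum>i<N. \<mu> / L ^ (2 * k + 2))"
  proof (rule sum_mono)
    fix i assume i: "i \<in> {..<N}"
    have "prob (A i) \<le> expectation (\<lambda>\<omega>. Y i \<omega> ^ (2 * k + 2)) / L ^ (2 * k + 2)"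
      unfolding A_def using i L Y0 by (intro integral_Markov_inequality_measure[of _ _ "{}"] m2) auto
    also have "\<dots> \<le> \<mu> / L ^ (2 * k + 2)" using i L m2(2) by (intro divide_right_mono) auto
    finally show "prob (A i) \<le> \<mu> / L ^ (2 * k + 2)" .
  qed
  \<comment> \<open>The moment of order \<open>2 * k + 2\<close> yields
    \<open>(N * u) ^ (k + 1)\<close> in the denominator; the extra factor \<open>N\<close> pays for
    the union over the \<open>N\<close> summands.\<close>
  also have "\<dots> \<le> \<mu> / (N * u) ^ k"
  proof -
    have "L ^ (2 * k + 2) = (L ^ 2) ^ k * L ^ 2" by (simp only: power_add power_mult)
    then have "L ^ (2 * k + 2) = (N * u) ^ k * (N * u)" by (simp only: L(2))
    then have "(\<Sum>i<N. \<mu> / L ^ (2 * k + 2)) = \<mu> / (N * u) ^ k * (1 / u)" using N by simp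
    also have "\<dots> \<le> \<mu> / (N * u) ^ k * 1" using u \<mu>0 Nu by (intro mult_left_mono) auto
    finally show ?thesis by simp
  qed
  also have "prob A' \<le> fact (2 * k) / (N * u) ^ k"
  proof -
    have "prob A' \<le> expectation (\<lambda>\<omega>. \<Prod>i<N. Z i \<omega>) / c"
      unfolding A'_def
    proof (rule integral_Markov_inequality_measure[of _ _ "{}"])
      show "AE \<omega> in M. 0 \<le> (\<Prod>i<N. Z i \<omega>)" by (intro AE_I2 prod_nonneg) (auto simp: Z_def)
    qed (use prod_int in \<open>auto simp: c_def\<close>)
    also have "\<dots> \<le> exp (2 * m / L) ^ N / c" using prod_exp by (intro divide_right_mono) (auto simp: c_def)
    also have "\<dots> = exp (- L)"
    proof -
      have "exp (2 * m / L) ^ N = exp (N * (2 * m / L))" by (rule exp_of_nat_mult[symmetric])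
      then have "exp (2 * m / L) ^ N / c = exp (N * (2 * m / L) - N * (2 * m + u) / L)"
        by (simp add: c_def exp_diff)
      also have "N * (2 * m / L) - N * (2 * m + u) / L = - (N * u / L)"
        by (simp add: diff_divide_distrib[symmetric] algebra_simps)
      also have "N * u / L = L" using L by (simp add: power2_eq_square field_simps)
      finally show ?thesis .
    qed
    \<comment> \<open>The exponential decay is weakened to the polynomial rate already imposed by
      the truncation.\<close>
    also have "\<dots> \<le> fact (2 * k) / L ^ (2 * k)"
      using power_fact_le_exp[of L "2 * k"] L by (simp add: exp_minus field_simps)
    also have "L ^ (2 * k) = (N * u) ^ k" by (simp only: power_mult L(2))
    finally show ?thesis .
  qed
  finally show ?thesis by (simp add: add_divide_distrib)
qed

text \<open>Half of the Gaussian exponent absorbs the power of the norm, by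
  \<open>y ^ j * exp (- y) \<le> fact j\<close>; what is left is a multiple of the density with
  doubled variance. Moments are thus bounded without evaluating a Gaussian integral.\<close>

lemma gaussian_density_moment:
  fixes z :: "real^'m" and u :: real
  assumes u: "0 < u"
  shows "(\<Prod>i\<in>UNIV. normal_density 0 (sqrt u) (z $ i)) * norm z ^ (2 * j) \<le>
    sqrt 2 ^ CARD('m) * fact j * (4 * u) ^ j * (\<Prod>i\<in>UNIV. normal_density 0 (sqrt (2 * u)) (z $ i))"
proof -
  have one: "normal_density 0 (sqrt u) x = sqrt 2 * exp (- x\<^sup>2 / (4 * u)) * normal_density 0 (sqrt (2 * u)) x" for x :: real
  proof -
    have "exp (- x\<^sup>2 / (2 * u)) = exp (- x\<^sup>2 / (4 * u)) * exp (- x\<^sup>2 / (4 * u))"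
      by (simp add: exp_add[symmetric])
    then show ?thesis using u by (simp add: normal_density_def real_sqrt_mult field_simps)
  qed
  define y where "y = (norm z)\<^sup>2 / (4 * u)"
  have sq: "(\<Sum>i\<in>UNIV. (z $ i)\<^sup>2) = (norm z)\<^sup>2"
    by (simp add: norm_vec_def L2_set_def sum_nonneg)
  have "(\<Prod>i\<in>UNIV. normal_density 0 (sqrt u) (z $ i)) =
      sqrt 2 ^ CARD('m) * exp (- y) * (\<Prod>i\<in>UNIV. normal_density 0 (sqrt (2 * u)) (z $ i))"
  proof -
    have "(\<Prod>i\<in>UNIV. exp (- (z $ i)\<^sup>2 / (4 * u))) = exp (\<Sum>i\<in>UNIV. - (z $ i)\<^sup>2 / (4 * u))"
      by (simp add: exp_sum)
    also have "(\<Sum>i\<in>UNIV. - (z $ i)\<^sup>2 / (4 * u)) = - y"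
      unfolding y_def sq[symmetric] by (simp add: sum_negf sum_divide_distrib)
    finally show ?thesis by (subst one) (simp add: prod.distrib)
  qed
  moreover have "exp (- y) * norm z ^ (2 * j) \<le> fact j * (4 * u) ^ j"
  proof -
    have y0: "0 \<le> y" using u by (simp add: y_def)
    have "norm z ^ (2 * j) = (4 * u) ^ j * y ^ j"
      using u by (simp add: y_def power_mult power_divide power_mult_distrib)
    moreover have "exp (- y) * y ^ j \<le> fact j"
      using power_fact_le_exp[OF y0, of j] by (simp add: exp_minus field_simps)
    then have "(4 * u) ^ j * (exp (- y) * y ^ j) \<le> (4 * u) ^ j * fact j"
      using u by (intro mult_left_mono) auto
    ultimately show ?thesis by (simp add: mult_ac)
  qed
  then have "sqrt 2 ^ CARD('m) * (\<Prod>i\<in>UNIV. normal_density 0 (sqrt (2 * u)) (z $ i)) * (exp (- y) * norm z ^ (2 * j)) \<le>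
      sqrt 2 ^ CARD('m) * (\<Prod>i\<in>UNIV. normal_density 0 (sqrt (2 * u)) (z $ i)) * (fact j * (4 * u) ^ j)"
    by (intro mult_left_mono mult_nonneg_nonneg prod_nonneg) auto
  ultimately show ?thesis by (simp add: mult_ac)
qed

lemma brownian_increment_moment:
  fixes B :: "real \<Rightarrow> 'w \<Rightarrow> real^'m"
  assumes B: "standard_brownian_motion P B" and st: "0 \<le> s" "s < t"
  shows "integrable P (\<lambda>\<omega>. norm (B t \<omega> - B s \<omega>) ^ (2 * j))"
    and "(\<integral>\<omega>. norm (B t \<omega> - B s \<omega>) ^ (2 * j) \<partial>P) \<le> sqrt 2 ^ CARD('m) * fact j * (4 * (t - s)) ^ j"
proof -
  define u where "u = t - s"
  have u: "0 < u" using st by (simp add: u_def)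
  define g :: "real \<Rightarrow> real^'m \<Rightarrow> real" where "g v z = (\<Prod>i\<in>UNIV. normal_density 0 (sqrt v) (z $ i))" for v z
  define C where "C = sqrt 2 ^ CARD('m) * fact j * (4 * u) ^ j"
  have C: "0 \<le> C" using u by (simp add: C_def)
  have g0: "0 \<le> g v z" for v z unfolding g_def by (intro prod_nonneg) auto
  interpret prob_space P using B by (simp add: standard_brownian_motion_def)
  have dist: "distributed P lborel (\<lambda>\<omega>. B b \<omega> - B a \<omega>) (\<lambda>z. ennreal (g (b - a) z))" if "0 \<le> a" "a < b" for a b
    using B that by (simp add: standard_brownian_motion_def g_def)
  have [measurable]: "(\<lambda>\<omega>. B t \<omega> - B s \<omega>) \<in> borel_measurable P"
    using distributed_measurable[OF dist[OF st]] by simp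
  have meas [measurable]: "g v \<in> borel_measurable borel" for v
    unfolding g_def by measurable
  \<comment> \<open>The comparison density is itself the density of an increment, over the time
    interval from \<open>0\<close> to \<open>2 * u\<close>, and therefore has mass one.\<close>
  have total: "(\<integral>\<^sup>+z. ennreal (g (2 * u) z) \<partial>lborel) = 1"
    using distributed_nn_integral[OF dist[of 0 "2 * u"], of "\<lambda>_. 1"] u emeasure_space_1 by simp
  have "(\<integral>\<^sup>+\<omega>. ennreal (norm (B t \<omega> - B s \<omega>) ^ (2 * j)) \<partial>P) =
      (\<integral>\<^sup>+z. ennreal (g u z) * ennreal (norm z ^ (2 * j)) \<partial>lborel)"
    using distributed_nn_integral[OF dist[OF st], of "\<lambda>z. ennreal (norm z ^ (2 * j))"] by (simp add: u_def)
  also have "\<dots> \<le> (\<integral>\<^sup>+z. ennreal C * ennreal (g (2 * u) z) \<partial>lborel)"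
    using gaussian_density_moment[OF u] C g0
    by (intro nn_integral_mono) (simp add: ennreal_mult[symmetric] g_def C_def)
  also have "\<dots> = ennreal C" by (simp add: nn_integral_cmult total)
  finally have le: "(\<integral>\<^sup>+\<omega>. ennreal (norm (B t \<omega> - B s \<omega>) ^ (2 * j)) \<partial>P) \<le> ennreal C" .
  show int: "integrable P (\<lambda>\<omega>. norm (B t \<omega> - B s \<omega>) ^ (2 * j))"
    by (rule integrableI_bounded) (use le in \<open>auto intro: le_less_trans\<close>)
  show "(\<integral>\<omega>. norm (B t \<omega> - B s \<omega>) ^ (2 * j) \<partial>P) \<le> sqrt 2 ^ CARD('m) * fact j * (4 * (t - s)) ^ j"
    using le nn_integral_eq_integral[OF int] C by (simp add: C_def u_def)
qed

text \<open>Bounds the moment of order \<open>a\<close>, although its second term belongs to order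
  \<open>2 * a\<close>: only even powers are estimated, and
  \<open>x ^ a \<le> 1 + x ^ (2 * a)\<close> covers the odd ones. The normalisation of the
  increments removes the level.\<close>

definition moment_bound :: "real \<Rightarrow> nat \<Rightarrow> nat \<Rightarrow> real" where
  "moment_bound T d a = 1 + sqrt 2 ^ d * fact a * (4 * T) ^ a"

lemma dyadic_increment_moment:
  fixes B :: "real \<Rightarrow> 'w \<Rightarrow> real^'m" and n j :: nat
  assumes B: "standard_brownian_motion P B" and T: "T > 0"
  defines "X \<equiv> \<lambda>\<omega>. sqrt (2 ^ n) * dyadic_incr T (\<lambda>t. B t \<omega>) n j"
  shows "integrable P (\<lambda>\<omega>. X \<omega> ^ a)" and "(\<integral>\<omega>. X \<omega> ^ a \<partial>P) \<le> moment_bound T CARD('m) a"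
proof -
  interpret prob_space P using B by (simp add: standard_brownian_motion_def)
  define s where "s = T * real j / 2 ^ n"
  define t where "t = T * real (Suc j) / 2 ^ n"
  have st: "0 \<le> s" "s < t" "t - s = T / 2 ^ n"
    using T by (auto simp: s_def t_def field_simps)
  have X: "X \<omega> = sqrt (2 ^ n) * norm (B t \<omega> - B s \<omega>)" for \<omega>
    by (simp add: X_def dyadic_incr_def s_def t_def)
  have X0: "0 \<le> X \<omega>" for \<omega> by (simp add: X)
  have Xpow: "X \<omega> ^ (2 * a) = (2 ^ n) ^ a * norm (B t \<omega> - B s \<omega>) ^ (2 * a)" for \<omega>
    by (simp add: X power_mult_distrib power_mult)
  have int: "integrable P (\<lambda>\<omega>. X \<omega> ^ (2 * a))"
    unfolding Xpow by (intro integrable_mult_right brownian_increment_moment(1)[OF B st(1,2)])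
  have [measurable]: "X \<in> borel_measurable P"
  proof -
    have [measurable]: "B t \<in> borel_measurable P" "B s \<in> borel_measurable P"
      using B st by (simp_all add: standard_brownian_motion_def)
    have "X = (\<lambda>\<omega>. sqrt (2 ^ n) * norm (B t \<omega> - B s \<omega>))" by (rule ext) (rule X)
    then show ?thesis by simp
  qed
  have le: "X \<omega> ^ a \<le> 1 + X \<omega> ^ (2 * a)" for \<omega>
    using zero_le_power2[of "X \<omega> ^ a - 1"] zero_le_power[OF X0, of \<omega> a]
    by (simp add: power2_eq_square power_mult power_even_eq algebra_simps)
  have int1: "integrable P (\<lambda>\<omega>. 1 + X \<omega> ^ (2 * a))" using int by simp
  show int': "integrable P (\<lambda>\<omega>. X \<omega> ^ a)"
    by (rule Bochner_Integration.integrable_bound[OF int1]) (use le X0 in \<open>auto intro!: AE_I2 simp: abs_of_nonneg\<close>)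
  have "(\<integral>\<omega>. X \<omega> ^ a \<partial>P) \<le> (\<integral>\<omega>. 1 + X \<omega> ^ (2 * a) \<partial>P)"
    by (intro integral_mono int1 int' le)
  also have "\<dots> = 1 + (2 ^ n) ^ a * (\<integral>\<omega>. norm (B t \<omega> - B s \<omega>) ^ (2 * a) \<partial>P)"
    using int by (simp add: Xpow prob_space)
  also have "\<dots> \<le> 1 + (2 ^ n) ^ a * (sqrt 2 ^ CARD('m) * fact a * (4 * (T / 2 ^ n)) ^ a)"
    using brownian_increment_moment(2)[OF B st(1,2), of a] unfolding st(3) by (intro add_left_mono mult_left_mono) auto
  also have "\<dots> = moment_bound T CARD('m) a"
    by (simp add: moment_bound_def power_mult_distrib power_divide)
  finally show "(\<integral>\<omega>. X \<omega> ^ a \<partial>P) \<le> moment_bound T CARD('m) a" .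
qed

lemma dyadic_mean_tail:
  fixes B :: "real \<Rightarrow> 'w \<Rightarrow> real^'m"
  assumes B: "standard_brownian_motion P B" and T: "T > 0" and u: "1 \<le> u"
  shows "{\<omega> \<in> space P. 2 * moment_bound T CARD('m) r + u < dyadic_mean T r (\<lambda>t. B t \<omega>) n} \<in> sets P"
    and "measure P {\<omega> \<in> space P. 2 * moment_bound T CARD('m) r + u < dyadic_mean T r (\<lambda>t. B t \<omega>) n} \<le>
      (moment_bound T CARD('m) (r * (2 * k + 2)) + fact (2 * k)) / (2 ^ n * u) ^ k"
proof -
  interpret prob_space P using B by (simp add: standard_brownian_motion_def)
  define Y where "Y j \<omega> = (sqrt (2 ^ n) * dyadic_incr T (\<lambda>t. B t \<omega>) n j) ^ r" for j \<omega>
  define g where "g i = T * real i / 2 ^ n" for i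
  have g: "0 \<le> g 0" "mono g" "\<And>i. 0 \<le> g i"
    using T by (auto simp: g_def mono_def intro!: divide_right_mono)
  have "indep_vars (\<lambda>_. borel) (\<lambda>i \<omega>. B (g (Suc i)) \<omega> - B (g i) \<omega>) {..<2 ^ n}"
    using B g unfolding standard_brownian_motion_def by blast
  from indep_vars_compose2[OF this, of "\<lambda>_ x. (sqrt (2 ^ n) * norm x) ^ r" "\<lambda>_. borel"]
  have indep: "indep_vars (\<lambda>_. borel) Y {..<2 ^ n}"
    by (simp add: Y_def[abs_def] dyadic_incr_def g_def)
  have Ymom: "integrable P (\<lambda>\<omega>. Y j \<omega> ^ a)" "expectation (\<lambda>\<omega>. Y j \<omega> ^ a) \<le> moment_bound T CARD('m) (r * a)" for j a
    using dyadic_increment_moment[OF B T, of n j "r * a"] by (simp_all add: Y_def power_mult)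
  have [measurable]: "Y j \<in> borel_measurable P" for j using Ymom(1)[of j 1] by auto
  have eq: "dyadic_mean T r (\<lambda>t. B t \<omega>) n = (\<Sum>j<2 ^ n. Y j \<omega>) / real (2 ^ n)" for \<omega>
    by (simp add: dyadic_mean_def Y_def)
  show "{\<omega> \<in> space P. 2 * moment_bound T CARD('m) r + u < dyadic_mean T r (\<lambda>t. B t \<omega>) n} \<in> sets P"
    unfolding eq by measurable
  have "prob {\<omega> \<in> space P. 2 * moment_bound T CARD('m) r + u < (\<Sum>j<2 ^ n. Y j \<omega>) / real (2 ^ n)} \<le>
      (moment_bound T CARD('m) (r * (2 * k + 2)) + fact (2 * k)) / (real (2 ^ n) * u) ^ k"
  proof (rule mean_tail[OF indep _ u])
    show "0 \<le> Y i \<omega>" for i \<omega> by (simp add: Y_def dyadic_incr_def)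
    show "integrable P (Y i)" "expectation (Y i) \<le> moment_bound T CARD('m) r" for i
      using Ymom[of i 1] by simp_all
    show "integrable P (\<lambda>\<omega>. Y i \<omega> ^ (2 * k + 2))"
      "expectation (\<lambda>\<omega>. Y i \<omega> ^ (2 * k + 2)) \<le> moment_bound T CARD('m) (r * (2 * k + 2))" for i
      by (rule Ymom)+
  qed simp
  then show "prob {\<omega> \<in> space P. 2 * moment_bound T CARD('m) r + u < dyadic_mean T r (\<lambda>t. B t \<omega>) n} \<le>
      (moment_bound T CARD('m) (r * (2 * k + 2)) + fact (2 * k)) / (2 ^ n * u) ^ k"
    unfolding eq by simp
qed


text \<open>Averaging over \<open>2 ^ n\<close> independent cells makes the tail on level
  \<open>n\<close> decay like \<open>2 ^ n\<close> to the power \<open>- k\<close>, so the union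
  over all levels from \<open>n\<^sub>0\<close> on costs only a factor 2.\<close>

lemma dyadic_means_tail:
  fixes B :: "real \<Rightarrow> 'w \<Rightarrow> real^'m" and n\<^sub>0 r :: nat
  assumes B: "standard_brownian_motion P B" and T: "T > 0" and u: "1 \<le> u" and k: "0 < k"
  defines "E \<equiv> {\<omega> \<in> space P. \<exists>n\<ge>n\<^sub>0. 2 * moment_bound T CARD('m) r + u < dyadic_mean T r (\<lambda>t. B t \<omega>) n}"
  shows "E \<in> sets P"
    and "measure P E \<le> 2 * (moment_bound T CARD('m) (r * (2 * k + 2)) + fact (2 * k)) / (2 ^ n\<^sub>0 * u) ^ k"
proof -
  interpret prob_space P using B by (simp add: standard_brownian_motion_def)
  define A where "A i = {\<omega> \<in> space P. 2 * moment_bound T CARD('m) r + u < dyadic_mean T r (\<lambda>t. B t \<omega>) (n\<^sub>0 + i)}" for i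
  define c where "c = moment_bound T CARD('m) (r * (2 * k + 2)) + fact (2 * k)"
  have c: "0 \<le> c" using T by (simp add: c_def moment_bound_def)
  have A: "A i \<in> sets P" for i unfolding A_def by (rule dyadic_mean_tail[OF B T u])
  have E: "E = (\<Union>i. A i)"
    unfolding E_def A_def by (auto simp: le_iff_add)
  show "E \<in> sets P" unfolding E using A by auto
  have A_le: "prob (A i) \<le> c / (2 ^ n\<^sub>0 * u) ^ k * (1/2) ^ i" for i
  proof -
    have "prob (A i) \<le> c / (2 ^ (n\<^sub>0 + i) * u) ^ k"
      unfolding A_def c_def by (rule dyadic_mean_tail[OF B T u])
    also have "\<dots> = c / (2 ^ n\<^sub>0 * u) ^ k * (1 / 2 ^ i) ^ k"
      by (simp add: power_add power_mult_distrib power_divide mult_ac)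
    also have "(1 / 2 ^ i) ^ k \<le> (1 / 2 ^ i :: real)"
      using k power_decreasing[of 1 k "1 / 2 ^ i :: real"] by simp
    then have "c / (2 ^ n\<^sub>0 * u) ^ k * (1 / 2 ^ i) ^ k \<le> c / (2 ^ n\<^sub>0 * u) ^ k * (1 / 2 ^ i)"
      using c u by (intro mult_left_mono) auto
    finally show ?thesis by (simp add: power_one_over)
  qed
  have geo: "(\<lambda>i. c / (2 ^ n\<^sub>0 * u) ^ k * (1/2) ^ i) sums (c / (2 ^ n\<^sub>0 * u) ^ k * 2)"
    using sums_mult[OF geometric_sums[of "1/2::real"], of "c / (2 ^ n\<^sub>0 * u) ^ k"] by simp
  have summ: "summable (\<lambda>i. prob (A i))"
    using A_le by (intro summable_comparison_test'[OF sums_summable[OF geo], of 0]) auto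
  have "prob E \<le> (\<Sum>i. prob (A i))"
    unfolding E using A summ by (intro finite_measure_subadditive_countably) auto
  also have "\<dots> \<le> (\<Sum>i. c / (2 ^ n\<^sub>0 * u) ^ k * (1/2) ^ i)"
    by (intro suminf_le A_le summ sums_summable[OF geo])
  also have "\<dots> = c / (2 ^ n\<^sub>0 * u) ^ k * 2" using geo by (rule sums_unique[symmetric])
  also have "\<dots> = 2 * c / (2 ^ n\<^sub>0 * u) ^ k" by simp
  finally show "prob E \<le> 2 * (moment_bound T CARD('m) (r * (2 * k + 2)) + fact (2 * k)) / (2 ^ n\<^sub>0 * u) ^ k"
    unfolding c_def .
qed

section \<open>Measurability\<close>

lemma continuous_bound_from_dense:
  fixes g :: "real \<Rightarrow> 'b::real_normed_vector"
  assumes S: "S \<subseteq> {0..T}" "{0..T} \<subseteq> closure S" and g: "continuous_on {0..T} g"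
    and "\<And>r. r \<in> S \<Longrightarrow> norm (g r) \<le> c" and "r \<in> {0..T}"
  shows "norm (g r) \<le> c"
proof -
  have "closure S = {0..T}" using S closure_minimal[OF S(1)] by auto
  then show ?thesis
    using continuous_le_on_closure[of S "\<lambda>r. norm (g r)" r c] g assms(4,5) continuous_on_norm by auto
qed

text \<open>A list of length \<open>n + 1\<close> encodes a step function with \<open>n\<close>
  cells; its last entry is the value at the right end \<open>T\<close>. Lists over a countable dense
  set are countable, which is the form of separability used.\<close>

definition step_path :: "real \<Rightarrow> 'b list \<Rightarrow> real \<Rightarrow> 'b" where
  "step_path T xs r = xs ! nat \<lfloor>r * real (length xs - 1) / T\<rfloor>"

lemma step_path_dense:
  fixes b :: "real \<Rightarrow> 'b::real_normed_vector"
  assumes T: "T > 0" and b: "continuous_on {0..T} b" and e: "e > 0"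
    and D: "\<And>x d. d > 0 \<Longrightarrow> \<exists>y\<in>D. dist x y < d"
  shows "\<exists>xs\<in>lists D. \<forall>r\<in>{0..T}. norm (b r - step_path T xs r) \<le> e"
proof -
  have "uniformly_continuous_on {0..T} b" by (rule compact_uniformly_continuous[OF b]) simp
  then obtain d where d: "d > 0" "\<And>r r'. r \<in> {0..T} \<Longrightarrow> r' \<in> {0..T} \<Longrightarrow> dist r' r < d \<Longrightarrow> dist (b r') (b r) < e / 2"
    using e unfolding uniformly_continuous_on_def by (metis half_gt_zero)
  obtain n where n: "T / d < real n" using reals_Archimedean2 by blast
  have n0: "0 < real n" using n T d by (smt (verit) divide_pos_pos)
  have nd: "T / real n < d" using n n0 d by (simp add: field_simps)
  define y where "y j = (SOME z. z \<in> D \<and> dist (b (real j * T / real n)) z < e / 2)" for j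
  have y: "y j \<in> D" "dist (b (real j * T / real n)) (y j) < e / 2" for j
    using someI_ex[of "\<lambda>z. z \<in> D \<and> dist (b (real j * T / real n)) z < e / 2"]
      D[of "e / 2" "b (real j * T / real n)"] e by (auto simp: y_def)
  define xs where "xs = map y [0..<Suc n]"
  have "norm (b r - step_path T xs r) \<le> e" if r: "r \<in> {0..T}" for r
  proof -
    define j where "j = nat \<lfloor>r * real n / T\<rfloor>"
    have w: "0 \<le> r * real n / T" using r T by auto
    have j: "real j \<le> r * real n / T" "r * real n / T < real j + 1"
      using w by (auto simp: j_def of_nat_nat intro!: floor_correct)
    have "r * real n / T \<le> real n" using r T n0 by (simp add: divide_le_eq mult_mono mult.commute)
    with j(1) have jn: "j \<le> n" by linarith
    define g where "g = real j * T / real n"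
    have g: "g \<le> r" "r - g < d"
    proof -
      show "g \<le> r" using j(1) T n0 by (simp add: g_def field_simps)
      have "r < (real j + 1) * T / real n" using j(2) T n0 by (simp add: field_simps)
      also have "(real j + 1) * T / real n = g + T / real n"
        by (simp add: g_def add_divide_distrib distrib_right)
      finally have "r - g < T / real n" by simp
      then show "r - g < d" using nd by linarith
    qed
    have "0 \<le> g" using T n0 by (simp add: g_def)
    with g r have "dist (b g) (b r) < e / 2" by (intro d) (auto simp: dist_real_def)
    moreover have "dist (b g) (y j) < e / 2" using y(2)[of j] by (simp add: g_def)
    moreover have "step_path T xs r = y j"
      using jn by (simp add: step_path_def xs_def j_def[symmetric] nth_append less_Suc_eq_le del: upt_Suc)
    ultimately show ?thesis
      using dist_triangle3[of "b r" "y j" "b g"] by (simp add: dist_norm)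
  qed
  moreover have "xs \<in> lists D" using y(1) by (auto simp: xs_def)
  ultimately show ?thesis by blast
qed

text \<open>An event that is open for the uniform distance of paths on \<open>[0, T]\<close> is a countable union of
  events involving countably many times, by separability.\<close>

lemma open_path_event_measurable:
  fixes B :: "real \<Rightarrow> 'w \<Rightarrow> 'b::euclidean_space"
  assumes T: "T > 0" and meas: "\<And>t. 0 \<le> t \<Longrightarrow> B t \<in> borel_measurable P"
    and cont: "\<And>\<omega>. \<omega> \<in> space P \<Longrightarrow> continuous_on {0..T} (\<lambda>t. B t \<omega>)"
    and op: "\<And>b. continuous_on {0..T} b \<Longrightarrow> \<Psi> b \<Longrightarrow>
      \<exists>e>0. \<forall>b'. continuous_on {0..T} b' \<and> (\<forall>r\<in>{0..T}. norm (b' r - b r) \<le> e) \<longrightarrow> \<Psi> b'"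
  shows "{\<omega> \<in> space P. \<Psi> (\<lambda>t. B t \<omega>)} \<in> sets P"
proof -
  obtain S where S: "countable S" "S \<subseteq> {0..T}" "{0..T} \<subseteq> closure S"
    using separable[of "{0..T}"] by blast
  obtain D :: "'b set" where D: "countable D" "\<And>X. open X \<Longrightarrow> X \<noteq> {} \<Longrightarrow> \<exists>d\<in>D. d \<in> X"
    using countable_dense_exists by blast
  have Dd: "\<exists>y\<in>D. dist x y < d" if "d > 0" for x :: 'b and d
    using D(2)[of "ball x d"] that by auto
  define Close where "Close xs k b \<longleftrightarrow> (\<forall>r\<in>S. norm (b r - step_path T xs r) \<le> 1 / real (Suc k))"
    for xs :: "'b list" and k :: nat and b :: "real \<Rightarrow> 'b"
  \<comment> \<open>Only those balls around step functions whose continuous members all satisfy the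
    event. Openness will show that these countably many balls exhaust it.\<close>
  define G where "G = {(xs, k). xs \<in> lists D \<and> (\<forall>b. continuous_on {0..T} b \<and> Close xs k b \<longrightarrow> \<Psi> b)}"
  have "countable G"
    by (rule countable_subset[of _ "lists D \<times> UNIV"]) (use D(1) in \<open>auto simp: G_def\<close>)
  moreover have "{\<omega> \<in> space P. Close xs k (\<lambda>t. B t \<omega>)} \<in> sets P" for xs k
  proof -
    have *: "{\<omega> \<in> space P. norm (B r \<omega> - step_path T xs r) \<le> 1 / real (Suc k)} \<in> sets P" if "r \<in> S" for r
    proof -
      have [measurable]: "B r \<in> borel_measurable P" using that S(2) by (intro meas) auto
      show ?thesis by measurable
    qed
    show ?thesis
      unfolding Close_def by (intro sets.sets_Collect_countable_All' * S(1))
  qed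
  ultimately have "(\<Union>(xs, k)\<in>G. {\<omega> \<in> space P. Close xs k (\<lambda>t. B t \<omega>)}) \<in> sets P"
    by (intro sets.countable_UN') auto
  also have "(\<Union>(xs, k)\<in>G. {\<omega> \<in> space P. Close xs k (\<lambda>t. B t \<omega>)}) = {\<omega> \<in> space P. \<Psi> (\<lambda>t. B t \<omega>)}"
  proof (intro equalityI subsetI)
    fix \<omega> assume \<omega>: "\<omega> \<in> {\<omega> \<in> space P. \<Psi> (\<lambda>t. B t \<omega>)}"
    then have c: "continuous_on {0..T} (\<lambda>t. B t \<omega>)" and "\<Psi> (\<lambda>t. B t \<omega>)" using cont by auto
    from op[OF this] obtain e where e: "e > 0"
      "\<And>b'. continuous_on {0..T} b' \<Longrightarrow> (\<forall>r\<in>{0..T}. norm (b' r - B r \<omega>) \<le> e) \<Longrightarrow> \<Psi> b'"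
      by blast
    obtain k where k: "1 / real (Suc k) < e / 2"
      using e(1) by (metis half_gt_zero inverse_eq_divide reals_Archimedean)
    obtain xs where xs: "xs \<in> lists D" "\<forall>r\<in>{0..T}. norm (B r \<omega> - step_path T xs r) \<le> 1 / real (Suc k)"
      using step_path_dense[OF T c, of "1 / real (Suc k)" D] Dd by auto
    have "\<Psi> b" if b: "continuous_on {0..T} b" "Close xs k b" for b
    proof (rule e(2)[OF b(1)], rule ballI)
      fix r assume r: "r \<in> {0..T}"
      show "norm (b r - B r \<omega>) \<le> e"
      \<comment> \<open>\<open>Close\<close> tests the times in \<open>S\<close> only, and the step
        function is not continuous. Passing to the difference of the two paths, at distance at most
        \<open>2 / real (Suc k)\<close> on \<open>S\<close>, restores the continuity needed to reach
        all times.\<close>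
      proof (rule continuous_bound_from_dense[OF S(2,3) _ _ r])
        show "continuous_on {0..T} (\<lambda>r. b r - B r \<omega>)" by (intro continuous_intros b c)
        fix r assume r: "r \<in> S"
        then have "norm (b r - step_path T xs r) \<le> 1 / real (Suc k)"
          "norm (B r \<omega> - step_path T xs r) \<le> 1 / real (Suc k)" using b(2) xs(2) S(2) by (auto simp: Close_def)
        then show "norm (b r - B r \<omega>) \<le> e"
          using k norm_triangle_ineq4[of "b r - step_path T xs r" "B r \<omega> - step_path T xs r"] by simp
      qed
    qed
    then have "(xs, k) \<in> G" using xs(1) by (auto simp: G_def)
    moreover have "Close xs k (\<lambda>t. B t \<omega>)" using xs(2) S(2) by (auto simp: Close_def)
    ultimately show "\<omega> \<in> (\<Union>(xs, k)\<in>G. {\<omega> \<in> space P. Close xs k (\<lambda>t. B t \<omega>)})" using \<omega> by auto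
  qed (use cont in \<open>auto simp: G_def\<close>)
  finally show ?thesis .
qed

section \<open>Dependence of the value function on the driving path\<close>

context lagrangian
begin

text \<open>The action is affine in the path, with slope controlled by the length of the curve, and
  near minimisers for paths bounded by \<open>A\<close> have uniformly bounded energy. As
  \<open>W\<close> may depend on \<open>\<sigma>\<close>, \<open>\<Lambda>\<close> and
  \<open>A\<close>, a crude use of Young's inequality replaces the grid argument.\<close>

lemma Lfun_path_lipschitz:
  fixes f :: "real^'d \<Rightarrow> real^'m"
  assumes f: "f \<in> Fclass \<sigma> \<Lambda>" and I: "0 \<le> s" "s < t" "t \<le> T" and A: "0 \<le> A"
  shows "\<exists>W\<ge>0. \<forall>b b' e. continuous_on {0..T} b \<and> continuous_on {0..T} b' \<and>
     (\<forall>r\<in>{0..T}. norm (b r) \<le> A) \<and> (\<forall>r\<in>{0..T}. norm (b' r) \<le> A) \<and> (\<forall>r\<in>{0..T}. norm (b' r - b r) \<le> e) \<longrightarrow>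
     Lfun H f b' (x, y, s, t) \<le> Lfun H f b (x, y, s, t) + W * e"
proof -
  note fC = Fclass_C1b[OF f]
  have \<sigma>0: "0 \<le> \<sigma>" "0 \<le> \<Lambda>" using Fclass_bounds[OF f] by (auto intro: order_trans[OF norm_ge_zero])
  define len where "len = t - s"
  have len: "0 < len" using I by (simp add: len_def)
  \<comment> \<open>The weight in Young's inequality for which the noise takes exactly half of the
    coercivity.\<close>
  define \<kappa> where "\<kappa> = (c\<^sub>1 / 2) powr (1 / q')"
  have \<kappa>: "0 < \<kappa>" "\<kappa> powr q' = c\<^sub>1 / 2" using cpos q'_gt_1 by (auto simp: \<kappa>_def powr_powr)
  define C where "C = 2 * \<sigma> * A + len * (\<Lambda> * A / \<kappa>) powr q"
  define w where "w = (y - x) /\<^sub>R len"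
  define a0 where "a0 = c\<^sub>2 * energy s t (\<lambda>_. w) + c\<^sub>2 * len + C + c\<^sub>1 / 2 * energy s t (\<lambda>_. w)"
  define E0 where "E0 = 2 / c\<^sub>1 * (a0 + 1 + c\<^sub>2 * len + C)"
  define W where "W = 2 * \<sigma> + \<Lambda> * (max 0 E0 + len)"
  have W: "0 \<le> W" using \<sigma>0 len by (simp add: W_def)
  have young: "n * z \<le> n powr q' + z powr q" if "0 \<le> n" "0 \<le> z" for n z
    by (rule young_powr[OF q that])
  have PI: "\<bar>path_integral f b s t \<gamma> v\<bar> \<le> C + c\<^sub>1 / 2 * energy s t v"
    if \<gamma>: "W1inf s t \<gamma> v" and b: "continuous_on {0..T} b" "\<forall>r\<in>{0..T}. norm (b r) \<le> A" for \<gamma> v b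
  proof -
    have "\<bar>path_integral f b s t \<gamma> v\<bar> \<le> 2 * \<sigma> * A + \<Lambda> * A * (LINT r:{s..t}|lborel. norm (v r))"
      by (rule path_integral_bound[OF f \<gamma>, of b 0]) (use I b in \<open>auto intro: continuous_on_subset[OF b(1)]\<close>)
    also have "\<Lambda> * A * (LINT r:{s..t}|lborel. norm (v r)) = (LINT r:{s..t}|lborel. \<Lambda> * A * norm (v r))"
      by simp
    also have "\<dots> \<le> (LINT r:{s..t}|lborel. c\<^sub>1 / 2 * norm (v r) powr q' + (\<Lambda> * A / \<kappa>) powr q)"
    proof (rule set_integral_mono)
      show "set_integrable lborel {s..t} (\<lambda>r. \<Lambda> * A * norm (v r))"
        by (rule W1inf_compose_integrable[OF \<gamma>]) (intro continuous_intros)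
      show "set_integrable lborel {s..t} (\<lambda>r. c\<^sub>1 / 2 * norm (v r) powr q' + (\<Lambda> * A / \<kappa>) powr q)"
        using energy_integrable[OF \<gamma>] by (intro set_integral_add(1)) auto
      fix r
      have "\<Lambda> * A * norm (v r) = (\<kappa> * norm (v r)) * (\<Lambda> * A / \<kappa>)" using \<kappa> by simp
      also have "\<dots> \<le> (\<kappa> * norm (v r)) powr q' + (\<Lambda> * A / \<kappa>) powr q"
        using \<kappa> \<sigma>0 A by (intro young) auto
      also have "(\<kappa> * norm (v r)) powr q' = c\<^sub>1 / 2 * norm (v r) powr q'"
        using \<kappa> by (simp add: powr_mult)
      finally show "\<Lambda> * A * norm (v r) \<le> c\<^sub>1 / 2 * norm (v r) powr q' + (\<Lambda> * A / \<kappa>) powr q" .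
    qed
    also have "\<dots> = c\<^sub>1 / 2 * energy s t v + len * (\<Lambda> * A / \<kappa>) powr q"
    proof -
      have "set_integrable lborel {s..t} (\<lambda>r. c\<^sub>1 / 2 * norm (v r) powr q')"
        using energy_integrable[OF \<gamma>] by auto
      then show ?thesis using I by (simp add: energy_def set_integral_const_Icc len_def)
    qed
    finally show ?thesis by (simp add: C_def)
  qed
  have lower_action: "c\<^sub>1 / 2 * energy s t v - c\<^sub>2 * len - C \<le> action f b s t \<gamma> v"
    if \<gamma>: "W1inf s t \<gamma> v" and b: "continuous_on {0..T} b" "\<forall>r\<in>{0..T}. norm (b r) \<le> A" for \<gamma> v b
    using PI[OF that] legendre_integral_bounds(1)[OF \<gamma>] I unfolding action_def len_def by simp
  have lower_action': "- (c\<^sub>2 * len + C) \<le> action f b s t \<gamma> v"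
    if \<gamma>: "W1inf s t \<gamma> v" and b: "continuous_on {0..T} b" "\<forall>r\<in>{0..T}. norm (b r) \<le> A" for \<gamma> v b
  proof -
    have "0 \<le> c\<^sub>1 / 2 * energy s t v" using cpos energy_nonneg by (intro mult_nonneg_nonneg) auto
    then show ?thesis using lower_action[OF that] by linarith
  qed
  have "Lfun H f b' (x, y, s, t) \<le> Lfun H f b (x, y, s, t) + W * e"
    if b: "continuous_on {0..T} b" "\<forall>r\<in>{0..T}. norm (b r) \<le> A"
      and b': "continuous_on {0..T} b'" "\<forall>r\<in>{0..T}. norm (b' r) \<le> A"
      and e: "\<forall>r\<in>{0..T}. norm (b' r - b r) \<le> e" for b b' e
  proof (rule field_le_epsilon)
    fix \<epsilon> :: real assume \<epsilon>: "0 < \<epsilon>"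
    obtain \<gamma> v where \<gamma>: "W1inf s t \<gamma> v" "\<gamma> s = x" "\<gamma> t = y"
      and near: "action f b s t \<gamma> v < Lfun H f b (x, y, s, t) + min 1 \<epsilon>"
      using Lfun_near_minimizer[OF lower_action'[OF _ b] I(2), of "min 1 \<epsilon>" x y] \<epsilon> by auto
    obtain \<eta> where \<eta>: "W1inf s t \<eta> (\<lambda>_. w)" "\<eta> s = x" "\<eta> t = y"
      using straight_line[OF I(2), where x = x and y = y] unfolding w_def len_def by (elim exE conjE)
    have "Lfun H f b (x, y, s, t) \<le> action f b s t \<eta> (\<lambda>_. w)"
      by (rule Lfun_le_action[OF lower_action'[OF _ b] \<eta>])
    also have "\<dots> \<le> a0"
      using PI[OF \<eta>(1) b] legendre_integral_bounds(2)[OF \<eta>(1)] I unfolding action_def a0_def len_def by simp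
    finally have "c\<^sub>1 / 2 * energy s t v \<le> a0 + 1 + c\<^sub>2 * len + C"
      using lower_action[OF \<gamma>(1) b] near by linarith
    then have "energy s t v \<le> E0" using cpos by (simp add: E0_def field_simps)
    then have E: "energy s t v \<le> max 0 E0" by simp
    have "(LINT r:{s..t}|lborel. norm (v r)) \<le> (LINT r:{s..t}|lborel. norm (v r) powr q' + 1)"
    proof (rule set_integral_mono)
      show "set_integrable lborel {s..t} (\<lambda>r. norm (v r))"
        by (rule W1inf_compose_integrable[OF \<gamma>(1)]) (intro continuous_intros)
      show "norm (v r) \<le> norm (v r) powr q' + 1" for r using young[of "norm (v r)" 1] by simp
    qed (use energy_integrable[OF \<gamma>(1)] in auto)
    also have "\<dots> = energy s t v + len"
      using energy_integrable[OF \<gamma>(1)] I by (simp add: energy_def set_integral_const_Icc len_def)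
    finally have V: "(LINT r:{s..t}|lborel. norm (v r)) \<le> max 0 E0 + len" using E by linarith
    have "norm (b' s - b s) \<le> e" using e I by simp
    then have e0: "0 \<le> e" by (rule order_trans[OF norm_ge_zero])
    have "path_integral f b' s t \<gamma> v - path_integral f b s t \<gamma> v = path_integral f (\<lambda>r. b' r - b r) s t \<gamma> v"
      using path_integrand_integrable[OF fC \<gamma>(1) continuous_on_subset[OF b(1)]]
        path_integrand_integrable[OF fC \<gamma>(1) continuous_on_subset[OF b'(1)]] I
      unfolding path_integral_def by (simp add: inner_diff_right)
    also have "\<dots> \<le> 2 * \<sigma> * e + \<Lambda> * e * (LINT r:{s..t}|lborel. norm (v r))"
    proof (rule abs_le_D1, rule path_integral_bound[OF f \<gamma>(1), of _ 0])
      show "continuous_on {s..t} (\<lambda>r. b' r - b r)"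
        using I by (intro continuous_intros continuous_on_subset[OF b(1)] continuous_on_subset[OF b'(1)]) auto
    qed (use e I in auto)
    also have "\<dots> \<le> 2 * \<sigma> * e + \<Lambda> * e * (max 0 E0 + len)"
      using V \<sigma>0 e0 by (intro add_left_mono mult_left_mono) auto
    also have "\<dots> = W * e" by (simp add: W_def algebra_simps)
    finally have "action f b' s t \<gamma> v \<le> action f b s t \<gamma> v + W * e" by (simp add: action_def)
    moreover have "Lfun H f b' (x, y, s, t) \<le> action f b' s t \<gamma> v"
      by (rule Lfun_le_action[OF lower_action'[OF _ b'] \<gamma>])
    ultimately show "Lfun H f b' (x, y, s, t) \<le> Lfun H f b (x, y, s, t) + W * e + \<epsilon>" using near by linarith
  qed
  then show ?thesis using W by blast
qed

lemma Lfun_path_continuous: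
  fixes f :: "real^'d \<Rightarrow> real^'m"
  assumes f: "f \<in> Fclass \<sigma> \<Lambda>" and I: "0 \<le> s" "s < t" "t \<le> T" and b: "continuous_on {0..T} b" and "0 < \<epsilon>"
  shows "\<exists>e>0. \<forall>b'. continuous_on {0..T} b' \<and> (\<forall>r\<in>{0..T}. norm (b' r - b r) \<le> e) \<longrightarrow>
     \<bar>Lfun H f b' (x, y, s, t) - Lfun H f b (x, y, s, t)\<bar> < \<epsilon>"
proof -
  have "compact (b ` {0..T})" by (intro compact_continuous_image b) auto
  then obtain A' where A': "\<And>r. r \<in> {0..T} \<Longrightarrow> norm (b r) \<le> A'"
    by (force dest!: compact_imp_bounded simp: bounded_iff)
  define A where "A = max 0 A' + 1"
  have "0 \<le> A" by (simp add: A_def)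
  from Lfun_path_lipschitz[OF f I this, of x y] obtain W where W: "0 \<le> W"
    and lip: "\<And>b b' e. continuous_on {0..T} b \<Longrightarrow> continuous_on {0..T} b' \<Longrightarrow>
     \<forall>r\<in>{0..T}. norm (b r) \<le> A \<Longrightarrow> \<forall>r\<in>{0..T}. norm (b' r) \<le> A \<Longrightarrow> \<forall>r\<in>{0..T}. norm (b' r - b r) \<le> e \<Longrightarrow>
     Lfun H f b' (x, y, s, t) \<le> Lfun H f b (x, y, s, t) + W * e" by blast
  define e where "e = min 1 (\<epsilon> / (2 * (W + 1)))"
  have e: "0 < e" "e \<le> 1" using \<open>0 < \<epsilon>\<close> W by (auto simp: e_def)
  have "W * e \<le> W * (\<epsilon> / (2 * (W + 1)))" using W by (intro mult_left_mono) (auto simp: e_def)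
  also have "\<dots> < \<epsilon>" using W \<open>0 < \<epsilon>\<close> by (simp add: field_simps add_strict_increasing)
  finally have We: "W * e < \<epsilon>" .
  have bA: "\<forall>r\<in>{0..T}. norm (b r) \<le> A" using A' by (force simp: A_def)
  show ?thesis
  proof (intro exI[of _ e] conjI allI impI)
    fix b' assume "continuous_on {0..T} b' \<and> (\<forall>r\<in>{0..T}. norm (b' r - b r) \<le> e)"
    then have b': "continuous_on {0..T} b'" and close: "\<forall>r\<in>{0..T}. norm (b' r - b r) \<le> e" by auto
    have b'A: "\<forall>r\<in>{0..T}. norm (b' r) \<le> A"
    proof
      fix r assume r: "r \<in> {0..T}"
      then show "norm (b' r) \<le> A"
        using A'[OF r] bspec[OF close r] e norm_triangle_sub[of "b' r" "b r"] by (simp add: A_def)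
    qed
    have close': "\<forall>r\<in>{0..T}. norm (b r - b' r) \<le> e" using close by (simp add: norm_minus_commute)
    show "\<bar>Lfun H f b' (x, y, s, t) - Lfun H f b (x, y, s, t)\<bar> < \<epsilon>"
      using lip[OF b b' bA b'A close] lip[OF b' b b'A bA close'] We by linarith
  qed (fact e)
qed

text \<open>A strict lower bound on the supremum is already witnessed by a single \<open>f\<close>
  and a single pair of points, and it survives a small change of the two values of
  \<open>Lfun\<close>. No uniformity over the class is needed.\<close>

lemma holder_sup_open:
  fixes F :: "(real^'d \<Rightarrow> real^'m) set"
  assumes F: "F \<subseteq> Fclass \<sigma> \<Lambda>" and \<tau>: "0 < \<tau>" and b: "continuous_on {0..T} b"
    and gt: "(SUP f\<in>F. holder_seminorm \<theta> \<theta>' (Udom \<tau> R T) (Lfun H f b)) > ereal c"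
  shows "\<exists>e>0. \<forall>b'. continuous_on {0..T} b' \<and> (\<forall>r\<in>{0..T}. norm (b' r - b r) \<le> e) \<longrightarrow>
    (SUP f\<in>F. holder_seminorm \<theta> \<theta>' (Udom \<tau> R T) (Lfun H f b')) > ereal c"
proof -
  obtain f where f: "f \<in> F" "holder_seminorm \<theta> \<theta>' (Udom \<tau> R T) (Lfun H f b) > ereal c"
    using gt by (auto simp: less_SUP_iff)
  define Q where "Q b x y s t x' y' s' t' = \<bar>Lfun H f b (x, y, s, t) - Lfun H f b (x', y', s', t')\<bar> /
                 (norm ((x, y) - (x', y')) powr \<theta> + norm ((s, t) - (s', t')) powr \<theta>')"
    for b x y s t x' y' s' t'
  have f': "f \<in> Fclass \<sigma> \<Lambda>" using F f by auto
  from f(2) obtain x y s t x' y' s' t' where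
    U: "(x, y, s, t) \<in> Udom \<tau> R T" "(x', y', s', t') \<in> Udom \<tau> R T" "(x, y, s, t) \<noteq> (x', y', s', t')"
    and Q: "c < Q b x y s t x' y' s' t'"
    unfolding holder_seminorm_def less_Sup_iff Q_def by auto
  define d where "d = norm ((x, y) - (x', y')) powr \<theta> + norm ((s, t) - (s', t')) powr \<theta>'"
  have d0: "0 < d" using U(3) by (auto simp: d_def zero_prod_def intro: add_pos_nonneg add_nonneg_pos)
  \<comment> \<open>Two values each moving by less than \<open>\<epsilon>\<close> lower the quotient
    by less than \<open>2 * \<epsilon> / d\<close>, which is its excess over
    \<open>c\<close>.\<close>
  define \<epsilon> where "\<epsilon> = (Q b x y s t x' y' s' t' - c) * d / 2"
  have \<epsilon>: "0 < \<epsilon>" using Q d0 by (simp add: \<epsilon>_def)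
  have I: "0 \<le> s" "s < t" "t \<le> T" "0 \<le> s'" "s' < t'" "t' \<le> T" using U \<tau> by (auto simp: Udom_def)
  obtain e1 where e1: "0 < e1" "\<And>b'. continuous_on {0..T} b' \<Longrightarrow> \<forall>r\<in>{0..T}. norm (b' r - b r) \<le> e1 \<Longrightarrow>
     \<bar>Lfun H f b' (x, y, s, t) - Lfun H f b (x, y, s, t)\<bar> < \<epsilon>"
    using Lfun_path_continuous[OF f' I(1-3) b \<epsilon>, of x y] by blast
  obtain e2 where e2: "0 < e2" "\<And>b'. continuous_on {0..T} b' \<Longrightarrow> \<forall>r\<in>{0..T}. norm (b' r - b r) \<le> e2 \<Longrightarrow>
     \<bar>Lfun H f b' (x', y', s', t') - Lfun H f b (x', y', s', t')\<bar> < \<epsilon>"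
    using Lfun_path_continuous[OF f' I(4-6) b \<epsilon>, of x' y'] by blast
  show ?thesis
  proof (intro exI[of _ "min e1 e2"] conjI allI impI, goal_cases)
    case 1
    show ?case using e1 e2 by simp
  next
    case (2 b')
    have "\<bar>Lfun H f b' (x, y, s, t) - Lfun H f b (x, y, s, t)\<bar> < \<epsilon>"
      "\<bar>Lfun H f b' (x', y', s', t') - Lfun H f b (x', y', s', t')\<bar> < \<epsilon>"
      using 2 by (auto intro!: e1(2) e2(2))
    then have "\<bar>Lfun H f b (x, y, s, t) - Lfun H f b (x', y', s', t')\<bar> - 2 * \<epsilon> <
        \<bar>Lfun H f b' (x, y, s, t) - Lfun H f b' (x', y', s', t')\<bar>" by linarith
    moreover have "\<bar>Lfun H f b (x, y, s, t) - Lfun H f b (x', y', s', t')\<bar> - 2 * \<epsilon> = c * d"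
    proof -
      have "Q b x y s t x' y' s' t' * d = \<bar>Lfun H f b (x, y, s, t) - Lfun H f b (x', y', s', t')\<bar>"
        unfolding Q_def d_def[symmetric] using d0 by simp
      moreover have "2 * \<epsilon> = Q b x y s t x' y' s' t' * d - c * d" by (simp add: \<epsilon>_def left_diff_distrib)
      ultimately show ?thesis by linarith
    qed
    ultimately have "c < Q b' x y s t x' y' s' t'"
      unfolding Q_def d_def[symmetric] using d0 by (simp add: pos_less_divide_eq)
    also have "ereal (Q b' x y s t x' y' s' t') \<le> holder_seminorm \<theta> \<theta>' (Udom \<tau> R T) (Lfun H f b')"
      unfolding holder_seminorm_def Q_def using U by (intro Sup_upper) blast
    finally show ?case using f(1) by (auto simp: less_SUP_iff)
  qed
qed

end

section \<open>The tail estimate\<close>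

context lagrangian
begin

lemma holder_sup_le:
  fixes F :: "(real^'d \<Rightarrow> real^'m) set"
  assumes bound: "\<And>f x y s t x\<^sub>1 y\<^sub>1 s\<^sub>1 t\<^sub>1. f \<in> F \<Longrightarrow> (x, y, s, t) \<in> U \<Longrightarrow> (x\<^sub>1, y\<^sub>1, s\<^sub>1, t\<^sub>1) \<in> U \<Longrightarrow>
      (x, y, s, t) \<noteq> (x\<^sub>1, y\<^sub>1, s\<^sub>1, t\<^sub>1) \<Longrightarrow>
      Lfun H f b (x\<^sub>1, y\<^sub>1, s\<^sub>1, t\<^sub>1) - Lfun H f b (x, y, s, t) \<le>
        c * (norm ((x, y) - (x\<^sub>1, y\<^sub>1)) powr \<theta> + norm ((s, t) - (s\<^sub>1, t\<^sub>1)) powr \<theta>')"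
  shows "(SUP f\<in>F. holder_seminorm \<theta> \<theta>' U (Lfun H f b)) \<le> ereal c"
proof (rule SUP_least)
  fix f assume f: "f \<in> F"
  show "holder_seminorm \<theta> \<theta>' U (Lfun H f b) \<le> ereal c"
    unfolding holder_seminorm_def
  proof (rule Sup_least, elim CollectE exE conjE)
    fix z x y s t x' y' s' t'
    assume z: "z = ereal (\<bar>Lfun H f b (x, y, s, t) - Lfun H f b (x', y', s', t')\<bar> /
           (norm ((x, y) - (x', y')) powr \<theta> + norm ((s, t) - (s', t')) powr \<theta>'))"
      and U: "(x, y, s, t) \<in> U" "(x', y', s', t') \<in> U" "(x, y, s, t) \<noteq> (x', y', s', t')"
    define d where "d = norm ((x, y) - (x', y')) powr \<theta> + norm ((s, t) - (s', t')) powr \<theta>'"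
    have d0: "0 < d" using U(3) by (auto simp: d_def zero_prod_def intro: add_pos_nonneg add_nonneg_pos)
    have d': "d = norm ((x', y') - (x, y)) powr \<theta> + norm ((s', t') - (s, t)) powr \<theta>'"
      unfolding d_def by (simp only: norm_minus_commute)
    have "\<bar>Lfun H f b (x, y, s, t) - Lfun H f b (x', y', s', t')\<bar> \<le> c * d"
      using bound[OF f U] bound[OF f U(2,1) U(3)[symmetric]] unfolding d_def[symmetric] d'[symmetric] by linarith
    then show "z \<le> ereal c"
      unfolding z d_def[symmetric] using d0 by (simp add: pos_divide_le_eq)
  qed
qed

text \<open>The order of the quantifiers carries the dependence of the constants: \<open>C\<close>
  is chosen before \<open>R\<close> and \<open>\<tau>\<close>, and \<open>M\<close> after them but
  before \<open>p\<close>, \<open>\<sigma>\<close> and the Brownian motion.\<close>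

lemma holder_tail:
  fixes T \<sigma>\<^sub>0 K \<theta> :: real
  assumes T: "0 < T" and pos: "\<sigma>\<^sub>0 > 0" "K > 0" and \<theta>: "0 < \<theta>" "\<theta> < q / (2 + q)"
  shows "\<exists>C. (\<forall>p\<ge>1. C p > 0) \<and> (\<forall>R \<tau>. 0 < R \<and> 0 < \<tau> \<and> \<tau> < T \<longrightarrow>
    (\<exists>M>0. \<forall>p\<ge>1. \<forall>(P :: 'w measure) (B :: real \<Rightarrow> 'w \<Rightarrow> real^'m) \<sigma> \<Lambda>.
      standard_brownian_motion P B \<and> 0 < \<sigma> \<and> \<sigma> < \<sigma>\<^sub>0 \<and> \<Lambda> > 0 \<and> \<sigma> * \<Lambda> = K \<longrightarrow>
      (\<forall>l\<ge>1. let E = {\<omega> \<in> space P.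
              (SUP f\<in>Fclass \<sigma> \<Lambda>. holder_seminorm \<theta> (\<theta> / q) (Udom \<tau> R T) (Lfun H f (\<lambda>r. B r \<omega>)))
                > ereal (M + l)}
          in E \<in> sets P \<and> measure P E \<le> C p * M powr p * \<sigma> powr p / l powr p)))"
proof -
  \<comment> \<open>The room left by the strict inequality for \<open>\<theta>\<close>. With
    \<open>1 / r \<le> gap\<close> the noise exponent \<open>\<beta> = 1/2 - 1 / r\<close> still
    satisfies the condition of the Hoelder estimate.\<close>
  define gap where "gap = 1/2 - \<theta> * (2 + q) / (2 * q)"
  have gap: "0 < gap" using \<theta> q(1) by (simp add: gap_def field_simps)
  define r where "r = nat \<lceil>max 12 (max q (1 / gap))\<rceil>"
  have "max 12 (max q (1 / gap)) \<le> real r" unfolding r_def by (rule real_nat_ceiling_ge)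
  then have r: "12 \<le> real r" "q \<le> real r" "1 / gap \<le> real r" by auto
  then have r12: "12 \<le> r" by simp
  define \<beta> where "\<beta> = 1/2 - 1 / real r"
  have \<beta>: "0 < \<beta>" "\<beta> \<le> 1/2" "\<theta> \<le> 2 * q / (2 + q) * \<beta>"
  proof -
    have "1 / real r \<le> 1 / 12" using r by (intro divide_left_mono) auto
    then show "0 < \<beta>" by (simp add: \<beta>_def)
    show "\<beta> \<le> 1/2" using r by (simp add: \<beta>_def)
    have "1 / real r \<le> gap" using r(1,3) gap by (simp add: field_simps)
    then have "\<theta> * (2 + q) / (2 * q) \<le> \<beta>" by (simp add: \<beta>_def gap_def)
    then show "\<theta> \<le> 2 * q / (2 + q) * \<beta>" using q(1) by (simp add: field_simps)
  qed
  define d where "d = CARD('m)"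
  define m where "m = 2 * moment_bound T d r"
  have m0: "0 \<le> m" using T by (simp add: m_def moment_bound_def)
  obtain A where A: "1 \<le> A" and noise: "\<forall>\<sigma> \<Lambda>. 0 < \<sigma> \<and> \<sigma> < \<sigma>\<^sub>0 \<and> \<sigma> * \<Lambda> = K \<longrightarrow>
    (\<exists>n\<^sub>0. 1 / 2 ^ n\<^sub>0 \<le> A * \<sigma>\<^sup>2 \<and>
      (\<forall>z (b :: real \<Rightarrow> real^'m) (f :: real^'d \<Rightarrow> real^'m).
         continuous_on {0..T} b \<and> f \<in> Fclass \<sigma> \<Lambda> \<and> (\<forall>k\<ge>n\<^sub>0. dyadic_mean T r b k \<le> z) \<longrightarrow>
         noise_controlled T q' (1/2 - 1 / r) (c\<^sub>1 / 2) (A * (1 + z)) f b))"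
    using noise_bound[OF T pos _ r12 r(2) q, of "c\<^sub>1 / 2"] cpos by auto
  \<comment> \<open>The seminorm is cubic in the dyadic means, so decay of order \<open>p\<close> in
    \<open>l\<close> takes three times as many powers of \<open>u\<close>.\<close>
  define k where "k p = 3 * nat \<lceil>p::real\<rceil>" for p
  define c where "c p = 2 * (moment_bound T d (r * (2 * k p + 2)) + fact (2 * k p))" for p
  \<comment> \<open>The grid gives the smallness \<open>A * \<sigma>\<^sup>2\<close>, of which
    \<open>A * \<sigma>\<^sub>0 * \<sigma>\<close> is kept: one \<open>\<sigma>\<close> appears in
    the claim, the other is bounded by \<open>\<sigma>\<^sub>0\<close>.\<close>
  define C where "C p = c p * (A * \<sigma>\<^sub>0) powr p" for p
  have c0: "0 < c p" for p
    using T by (auto simp: c_def moment_bound_def intro!: mult_pos_pos add_pos_pos add_pos_nonneg)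
  have C0: "0 < C p" for p using c0 A pos by (simp add: C_def)
  have main: "\<exists>M>0. \<forall>p\<ge>1. \<forall>(P :: 'w measure) (B :: real \<Rightarrow> 'w \<Rightarrow> real^'m) \<sigma> \<Lambda>.
      standard_brownian_motion P B \<and> 0 < \<sigma> \<and> \<sigma> < \<sigma>\<^sub>0 \<and> \<Lambda> > 0 \<and> \<sigma> * \<Lambda> = K \<longrightarrow>
      (\<forall>l\<ge>1. let E = {\<omega> \<in> space P.
              (SUP f\<in>Fclass \<sigma> \<Lambda>. holder_seminorm \<theta> (\<theta> / q) (Udom \<tau> R T) (Lfun H f (\<lambda>r. B r \<omega>)))
                > ereal (M + l)}
          in E \<in> sets P \<and> measure P E \<le> C p * M powr p * \<sigma> powr p / l powr p)"
    if R: "0 < R" and \<tau>: "0 < \<tau>" "\<tau> < T" for R \<tau>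
  proof -
    obtain M' where M': "1 \<le> M'" and holder: "\<forall>Y (f :: real^'d \<Rightarrow> real^'m) b.
      1 \<le> Y \<and> f \<in> C1b \<and> continuous_on {0..T} b \<and> noise_controlled T q' \<beta> (c\<^sub>1 / 2) Y f b \<longrightarrow>
      (\<forall>x y s t x\<^sub>1 y\<^sub>1 s\<^sub>1 t\<^sub>1. (x, y, s, t) \<in> Udom \<tau> R T \<and> (x\<^sub>1, y\<^sub>1, s\<^sub>1, t\<^sub>1) \<in> Udom \<tau> R T \<and>
          (x, y, s, t) \<noteq> (x\<^sub>1, y\<^sub>1, s\<^sub>1, t\<^sub>1) \<longrightarrow>
        Lfun H f b (x\<^sub>1, y\<^sub>1, s\<^sub>1, t\<^sub>1) - Lfun H f b (x, y, s, t) \<le>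
          M' * Y ^ 3 * (norm ((x, y) - (x\<^sub>1, y\<^sub>1)) powr \<theta> + norm ((s, t) - (s\<^sub>1, t\<^sub>1)) powr (\<theta> / q)))"
      using Lfun_holder[OF \<tau> R \<theta> \<beta>] by (elim exE conjE)
    \<comment> \<open>If the means are at most \<open>m + u\<close> with \<open>u \<ge> 1\<close>,
      then \<open>1 + (m + u) \<le> (m + 2) * u\<close>, and the Hoelder bound becomes at most
      \<open>M * u ^ 3\<close>.\<close>
    define M where "M = M' * A ^ 3 * (m + 2) ^ 3"
    have M0: "0 < M" using M' A m0 by (simp add: M_def)
    show ?thesis
    proof (intro exI[of _ M] conjI allI impI)
      fix p :: real and P :: "'w measure" and B :: "real \<Rightarrow> 'w \<Rightarrow> real^'m" and \<sigma> \<Lambda> l :: real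
      assume p: "1 \<le> p" and l: "1 \<le> l"
        and H: "standard_brownian_motion P B \<and> 0 < \<sigma> \<and> \<sigma> < \<sigma>\<^sub>0 \<and> \<Lambda> > 0 \<and> \<sigma> * \<Lambda> = K"
      then have B: "standard_brownian_motion P B" and \<sigma>: "0 < \<sigma>" "\<sigma> < \<sigma>\<^sub>0" "\<sigma> * \<Lambda> = K" by auto
      interpret prob_space P using B by (simp add: standard_brownian_motion_def)
      define \<Psi> where "\<Psi> b \<longleftrightarrow> (SUP f\<in>Fclass \<sigma> \<Lambda>. holder_seminorm \<theta> (\<theta> / q) (Udom \<tau> R T) (Lfun H (f :: real^'d \<Rightarrow> real^'m) b))
                > ereal (M + l)" for b
      define E where "E = {\<omega> \<in> space P. \<Psi> (\<lambda>r. B r \<omega>)}"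
      have cont: "continuous_on {0..T} (\<lambda>t. B t \<omega>)" if "\<omega> \<in> space P" for \<omega>
        using B that by (auto simp: standard_brownian_motion_def intro: continuous_on_subset[of "{0..}"])
      have E_sets: "E \<in> sets P"
        unfolding E_def
      proof (rule open_path_event_measurable[OF T _ cont])
        show "B t \<in> borel_measurable P" if "0 \<le> t" for t
          using B that by (simp add: standard_brownian_motion_def)
        show "\<exists>e>0. \<forall>b'. continuous_on {0..T} b' \<and> (\<forall>r\<in>{0..T}. norm (b' r - b r) \<le> e) \<longrightarrow> \<Psi> b'"
          if "continuous_on {0..T} b" "\<Psi> b" for b
          using holder_sup_open[OF subset_refl \<tau>(1) that(1) that(2)[unfolded \<Psi>_def]] unfolding \<Psi>_def .
      qed
      obtain n0 where n0: "1 / 2 ^ n0 \<le> A * \<sigma>\<^sup>2" and ctrl: "\<And>z (b :: real \<Rightarrow> real^'m) (f :: real^'d \<Rightarrow> real^'m).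
         continuous_on {0..T} b \<Longrightarrow> f \<in> Fclass \<sigma> \<Lambda> \<Longrightarrow> (\<forall>k\<ge>n0. dyadic_mean T r b k \<le> z) \<Longrightarrow>
         noise_controlled T q' \<beta> (c\<^sub>1 / 2) (A * (1 + z)) f b"
        using noise \<sigma> unfolding \<beta>_def by blast
      \<comment> \<open>Chosen so that \<open>M * u ^ 3 = M + l\<close>. It is at least one, as the
        tail estimate for the means requires.\<close>
      define u where "u = (1 + l / M) powr (1 / 3)"
      have lM: "0 < l / M" using l M0 by simp
      have u3: "u ^ 3 = 1 + l / M"
        using lM by (simp add: u_def powr_realpow[symmetric] powr_powr)
      have u1: "1 \<le> u" unfolding u_def using lM by (intro ge_one_powr_ge_zero) auto
      define Bad where "Bad = {\<omega> \<in> space P. \<exists>n\<ge>n0. m + u < dyadic_mean T r (\<lambda>t. B t \<omega>) n}"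
      have k0: "0 < k p" using p by (simp add: k_def)
      have Bad: "Bad \<in> sets P" "prob Bad \<le> c p / (2 ^ n0 * u) ^ k p"
        unfolding Bad_def m_def c_def d_def by (rule dyadic_means_tail[OF B T u1 k0])+
      have "E \<subseteq> Bad"
      proof
        fix \<omega> assume \<omega>: "\<omega> \<in> E"
        show "\<omega> \<in> Bad"
        proof (rule ccontr)
          assume "\<omega> \<notin> Bad"
          then have le: "\<forall>k\<ge>n0. dyadic_mean T r (\<lambda>t. B t \<omega>) k \<le> m + u"
            using \<omega> by (auto simp: Bad_def E_def not_less)
          have b: "continuous_on {0..T} (\<lambda>t. B t \<omega>)" using \<omega> by (intro cont) (simp add: E_def)
          define Y where "Y = A * (1 + (m + u))"
          have Y1: "1 \<le> Y" unfolding Y_def using A m0 u1 mult_mono[of 1 A 1 "1 + (m + u)"] by simp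
          have "M' * Y ^ 3 \<le> M + l"
          proof -
            have "1 + (m + u) \<le> (m + 2) * u" using mult_left_mono[OF u1, of "m + 1"] m0 by (simp add: algebra_simps)
            then have "Y \<le> A * ((m + 2) * u)" unfolding Y_def using A by (intro mult_left_mono) auto
            then have "M' * Y ^ 3 \<le> M' * (A * ((m + 2) * u)) ^ 3"
              using Y1 M' by (intro mult_left_mono power_mono) auto
            also have "\<dots> = M * u ^ 3" by (simp add: M_def power_mult_distrib)
            also have "\<dots> = M + l" using M0 by (simp add: u3 distrib_left)
            finally show ?thesis .
          qed
          moreover have "(SUP f\<in>Fclass \<sigma> \<Lambda>. holder_seminorm \<theta> (\<theta> / q) (Udom \<tau> R T)
              (Lfun H (f :: real^'d \<Rightarrow> real^'m) (\<lambda>t. B t \<omega>))) \<le> ereal (M' * Y ^ 3)"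
          proof (rule holder_sup_le)
            fix f :: "real^'d \<Rightarrow> real^'m" and x y x1 y1 :: "real^'d" and s t s1 t1
            assume f: "f \<in> Fclass \<sigma> \<Lambda>"
              and U: "(x, y, s, t) \<in> Udom \<tau> R T" "(x1, y1, s1, t1) \<in> Udom \<tau> R T" "(x, y, s, t) \<noteq> (x1, y1, s1, t1)"
            have "1 \<le> Y \<and> f \<in> C1b \<and> continuous_on {0..T} (\<lambda>t. B t \<omega>) \<and> noise_controlled T q' \<beta> (c\<^sub>1 / 2) Y f (\<lambda>t. B t \<omega>)"
              using Y1 Fclass_C1b[OF f] b ctrl[OF b f le] by (simp add: Y_def)
            from holder[rule_format, OF this conjI[OF U(1) conjI[OF U(2,3)]]]
            show "Lfun H f (\<lambda>t. B t \<omega>) (x1, y1, s1, t1) - Lfun H f (\<lambda>t. B t \<omega>) (x, y, s, t) \<le>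
              M' * Y ^ 3 * (norm ((x, y) - (x1, y1)) powr \<theta> + norm ((s, t) - (s1, t1)) powr (\<theta> / q))" .
          qed
          ultimately have "(SUP f\<in>Fclass \<sigma> \<Lambda>. holder_seminorm \<theta> (\<theta> / q) (Udom \<tau> R T)
              (Lfun H (f :: real^'d \<Rightarrow> real^'m) (\<lambda>t. B t \<omega>))) \<le> ereal (M + l)"
            by (meson ereal_less_eq(3) order_trans)
          then have "\<not> \<Psi> (\<lambda>t. B t \<omega>)" unfolding \<Psi>_def by (simp only: not_less)
          then show False using \<omega> by (simp add: E_def)
        qed
      qed
      then have "prob E \<le> prob Bad" using Bad(1) by (rule finite_measure_mono)
      also have "\<dots> \<le> c p * ((1 / 2 ^ n0) ^ k p * (1 / u ^ k p))"
        using Bad(2) by (simp add: power_mult_distrib power_divide)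
      also have "\<dots> \<le> c p * ((A * \<sigma>\<^sub>0 * \<sigma>) powr p * (M / l) powr p)"
      proof (intro mult_left_mono mult_mono)
        have kp: "p \<le> real (nat \<lceil>p\<rceil>)" by (rule real_nat_ceiling_ge)
        moreover have "real (k p) = 3 * real (nat \<lceil>p\<rceil>)" by (simp only: k_def of_nat_mult of_nat_numeral)
        ultimately have kp': "p \<le> real (k p)" using p by linarith
        have "(1 / 2 ^ n0) ^ k p = (1 / 2 ^ n0 :: real) powr real (k p)" by (simp add: powr_realpow)
        also have "\<dots> \<le> (1 / 2 ^ n0) powr p" using kp' by (intro powr_mono') auto
        also have "\<dots> \<le> (A * \<sigma>\<^sub>0 * \<sigma>) powr p"
        proof (intro powr_mono2)
          have "A * \<sigma>\<^sup>2 \<le> A * (\<sigma>\<^sub>0 * \<sigma>)" unfolding power2_eq_square using \<sigma> A by (intro mult_left_mono mult_right_mono) auto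
          then show "1 / 2 ^ n0 \<le> A * \<sigma>\<^sub>0 * \<sigma>" using n0 by (simp add: mult.assoc)
        qed (use p in auto)
        finally show "(1 / 2 ^ n0) ^ k p \<le> (A * \<sigma>\<^sub>0 * \<sigma>) powr p" .
        have "(l / M) powr p \<le> (1 + l / M) powr p" using lM p by (intro powr_mono2) auto
        also have "\<dots> \<le> (1 + l / M) powr real (nat \<lceil>p\<rceil>)" using kp lM by (intro powr_mono) auto
        also have "\<dots> = u ^ k p" unfolding k_def power_mult u3 using lM by (simp add: powr_realpow)
        finally have "(l / M) powr p \<le> u ^ k p" .
        then have "1 / u ^ k p \<le> 1 / (l / M) powr p" using l M0 by (intro frac_le) auto
        also have "\<dots> = (M / l) powr p" using l M0 by (simp add: powr_divide)
        finally show "1 / u ^ k p \<le> (M / l) powr p" .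
      qed (use c0[of p] u1 in auto)
      also have "\<dots> = C p * M powr p * \<sigma> powr p / l powr p"
        using \<sigma> pos A M0 l by (simp add: C_def powr_mult powr_divide)
      finally have "E \<in> sets P \<and> prob E \<le> C p * M powr p * \<sigma> powr p / l powr p"
        using E_sets by blast
      then show "let E = {\<omega> \<in> space P.
              (SUP f\<in>Fclass \<sigma> \<Lambda>. holder_seminorm \<theta> (\<theta> / q) (Udom \<tau> R T) (Lfun H (f :: real^'d \<Rightarrow> real^'m) (\<lambda>r. B r \<omega>)))
                > ereal (M + l)}
          in E \<in> sets P \<and> measure P E \<le> C p * M powr p * \<sigma> powr p / l powr p"
        by (simp add: Let_def E_def \<Psi>_def)
    qed (fact M0)
  qed
  show ?thesis using C0 main by (intro exI[of _ C]) auto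
qed

end

theorem proposition3p1:
  fixes H :: "real^'d \<Rightarrow> real" and q :: real
  assumes "q > 1"
    and "convex_on UNIV H"
    and "\<exists>c>1. \<forall>p. norm p powr q / c - c \<le> H p \<and> H p \<le> c * (norm p powr q + 1)"
    and "\<exists>c>0. \<forall>v w. \<bar>legendre H v - legendre H w\<bar> \<le>
           c * (1 + norm v powr (q / (q - 1) - 1) + norm w powr (q / (q - 1) - 1)) * norm (v - w)"
  shows "\<exists>(M :: real \<Rightarrow> real \<Rightarrow> real \<Rightarrow> real \<Rightarrow> real \<Rightarrow> real \<Rightarrow> real)
          (C :: real \<Rightarrow> real \<Rightarrow> real \<Rightarrow> real \<Rightarrow> real \<Rightarrow> real).
    \<forall>R T \<tau> \<sigma>\<^sub>0 K \<theta>.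
      R > 0 \<and> 0 < \<tau> \<and> \<tau> < T \<and> \<sigma>\<^sub>0 > 0 \<and> K > 0 \<and> 0 < \<theta> \<and> \<theta> < q / (2 + q) \<longrightarrow>
      M R T \<tau> \<sigma>\<^sub>0 K \<theta> > 0 \<and>
      (\<forall>p\<ge>1. C T \<sigma>\<^sub>0 K \<theta> p > 0 \<and>
        (\<forall>(P :: 'w measure) (B :: real \<Rightarrow> 'w \<Rightarrow> real^'m) \<sigma> \<Lambda>.
          standard_brownian_motion P B \<and> 0 < \<sigma> \<and> \<sigma> < \<sigma>\<^sub>0 \<and> \<Lambda> > 0 \<and> \<sigma> * \<Lambda> = K \<longrightarrow>
          (\<forall>l\<ge>1.
            let E = {\<omega> \<in> space P.
                      (SUP f\<in>Fclass \<sigma> \<Lambda>.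
                         holder_seminorm \<theta> (\<theta> / q) (Udom \<tau> R T) (Lfun H f (\<lambda>r. B r \<omega>)))
                      > ereal (M R T \<tau> \<sigma>\<^sub>0 K \<theta> + l)}
            in E \<in> sets P \<and>
               measure P E \<le> C T \<sigma>\<^sub>0 K \<theta> p * (M R T \<tau> \<sigma>\<^sub>0 K \<theta>) powr p * \<sigma> powr p / l powr p)))"
proof -
  define q' where "q' = q / (q - 1)"
  obtain c\<^sub>1 c\<^sub>2 c\<^sub>3 where "lagrangian H q q' c\<^sub>1 c\<^sub>2 c\<^sub>3"
    using lagrangian_exists[OF assms(1) q'_def assms(3)] assms(4) unfolding q'_def by blast
  then interpret lagrangian H q q' c\<^sub>1 c\<^sub>2 c\<^sub>3 .
  define tail where "tail T \<sigma>\<^sub>0 K \<theta> R \<tau> M C \<longleftrightarrow> (\<forall>p\<ge>1. \<forall>(P :: 'w measure) (B :: real \<Rightarrow> 'w \<Rightarrow> real^'m) \<sigma> \<Lambda>.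
      standard_brownian_motion P B \<and> 0 < \<sigma> \<and> \<sigma> < \<sigma>\<^sub>0 \<and> \<Lambda> > 0 \<and> \<sigma> * \<Lambda> = K \<longrightarrow>
      (\<forall>l\<ge>1. let E = {\<omega> \<in> space P.
              (SUP f\<in>Fclass \<sigma> \<Lambda>. holder_seminorm \<theta> (\<theta> / q) (Udom \<tau> R T) (Lfun H f (\<lambda>r. B r \<omega>)))
                > ereal (M + l)}
          in E \<in> sets P \<and> measure P E \<le> C p * M powr p * \<sigma> powr p / l powr p))"
    for T \<sigma>\<^sub>0 K \<theta> R \<tau> M :: real and C :: "real \<Rightarrow> real"
  define dom where "dom T \<sigma>\<^sub>0 K \<theta> \<longleftrightarrow> 0 < T \<and> \<sigma>\<^sub>0 > 0 \<and> K > 0 \<and> 0 < \<theta> \<and> \<theta> < q / (2 + q)" for T \<sigma>\<^sub>0 K \<theta> :: real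
  define good where "good T \<sigma>\<^sub>0 K \<theta> C \<longleftrightarrow> (\<forall>p\<ge>1. C p > 0) \<and>
      (\<forall>R \<tau>. 0 < R \<and> 0 < \<tau> \<and> \<tau> < T \<longrightarrow> (\<exists>M>0. tail T \<sigma>\<^sub>0 K \<theta> R \<tau> M C))" for T \<sigma>\<^sub>0 K \<theta> C
  \<comment> \<open>The constants become functions of the parameters by choice. \<open>C\<close> is
    chosen first, so that \<open>R\<close> and \<open>\<tau>\<close> are not among its arguments;
    \<open>M\<close> is then chosen to fit this \<open>C\<close>.\<close>
  define C where "C T \<sigma>\<^sub>0 K \<theta> = (SOME C. good T \<sigma>\<^sub>0 K \<theta> C)" for T \<sigma>\<^sub>0 K \<theta>
  define M where "M R T \<tau> \<sigma>\<^sub>0 K \<theta> = (SOME M. 0 < M \<and> tail T \<sigma>\<^sub>0 K \<theta> R \<tau> M (C T \<sigma>\<^sub>0 K \<theta>))" for R T \<tau> \<sigma>\<^sub>0 K \<theta>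
  have C: "good T \<sigma>\<^sub>0 K \<theta> (C T \<sigma>\<^sub>0 K \<theta>)" if "dom T \<sigma>\<^sub>0 K \<theta>" for T \<sigma>\<^sub>0 K \<theta>
  proof -
    have "\<exists>C. good T \<sigma>\<^sub>0 K \<theta> C"
      unfolding good_def tail_def by (rule holder_tail) (use that in \<open>simp_all add: dom_def\<close>)
    then show ?thesis unfolding C_def by (rule someI_ex)
  qed
  have M: "0 < M R T \<tau> \<sigma>\<^sub>0 K \<theta> \<and> tail T \<sigma>\<^sub>0 K \<theta> R \<tau> (M R T \<tau> \<sigma>\<^sub>0 K \<theta>) (C T \<sigma>\<^sub>0 K \<theta>)"
    if "dom T \<sigma>\<^sub>0 K \<theta>" "0 < R \<and> 0 < \<tau> \<and> \<tau> < T" for R T \<tau> \<sigma>\<^sub>0 K \<theta>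
  proof -
    have "\<exists>M. 0 < M \<and> tail T \<sigma>\<^sub>0 K \<theta> R \<tau> M (C T \<sigma>\<^sub>0 K \<theta>)"
      using C[OF that(1)] that(2) unfolding good_def by blast
    then show ?thesis unfolding M_def by (rule someI_ex)
  qed
  show ?thesis
  proof (intro exI[of _ M] exI[of _ C] allI impI, goal_cases)
    case (1 R T \<tau> \<sigma>\<^sub>0 K \<theta>)
    then have D: "dom T \<sigma>\<^sub>0 K \<theta>" "0 < R \<and> 0 < \<tau> \<and> \<tau> < T" by (auto simp: dom_def)
    have "\<forall>p\<ge>1. C T \<sigma>\<^sub>0 K \<theta> p > 0" using C[OF D(1)] unfolding good_def by (rule conjunct1)
    then show ?case using M[OF D] unfolding tail_def by simp
  qed
qed

end
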